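(* Let $G=\mathbb{R}^n$ be a stratified nilpotent Lie group of rank $r$, identified with $\mathbb{R}^n$ via exponential coordinates of the second type, let $\gamma:[0,1]\to G$ be a horizontal curve with $\gamma(0)=0$, and let $m\ge1$ be an integer. For $v\in\mathbb{R}^n$, $v\ne0$, let $Z_v=\{x\in\mathbb{R}^n: P_j^v(x)=0 \text{ for all } j\in\mathbb{Z}\text{ with } j\le r\}$, where $P_j^v$ are the extremal polynomials associated with an adapted basis of $\mathrm{Prol}(\mathfrak g)$, $\mathfrak g=\mathrm{Lie}(G)$. The following statements are equivalent: (A) The curve $\gamma$ is an abnormal extremal with $\mathrm{corank}(\gamma)\ge m$. (B) There exist $m$ linearly independent vectors $v_1,\dots,v_m\in\mathbb{R}^n$ such that $\gamma(t)\in Z_{v_1}\cap\dots\cap Z_{v_m}$ for all $t\in[0,1]$.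
   Context: Stratified group. $G$ is a (connected, simply connected) nilpotent Lie group of dimension $n$ whose real Lie algebra of left-invariant vector fields is stratified: $\mathfrak g=\mathfrak g_1\oplus\cdots\oplus\mathfrak g_s$, $\mathfrak g_i=[\mathfrak g_{i-1},\mathfrak g_1]$ for $i=2,\dots,s$, $\mathfrak g_i=\{0\}$ for $i>s$; $s$ is the step and $r=\dim\mathfrak g_1$ the rank. Tanaka prolongation. $\mathfrak g_0$ is the space of linear maps $\phi:\mathfrak g\to\mathfrak g$ with $\phi(\mathfrak g_i)\subset\mathfrak g_i$ for $i=1,\dots,s$ and $\phi([X,Y])=[\phi(X),Y]+[X,\phi(Y)]$ for all $X,Y\in\mathfrak g$. Set $[\phi,X]=-[X,\phi]=\phi(X)$ for $\phi\in\mathfrak g_0$, $X\in\mathfrak g$. Inductively for $k\ge1$, when $\mathfrak g_{1-k},\dots,\mathfrak g_s$ and the brackets $[\phi,X]=\phi(X)$ with $X\in\mathfrak g$ are already defined, $\mathfrak g_{-k}$ is the space of linear maps $\phi:\mathfrak g\to\mathfrak g_{1-k}\oplus\cdots\oplus\mathfrak g_{s-k}$ with $\phi(\mathfrak g_i)\subset\mathfrak g_{i-k}$ for $i=1,\dots,s$ and $\phi([X,Y])=[\phi(X),Y]+[X,\phi(Y)]$ for all $X,Y\in\mathfrak g$; again $[\phi,X]=-[X,\phi]=\phi(X)$ for $X\in\mathfrak g$. For $\phi,\psi$ of degree $\le 0$ the bracket is defined inductively by $[\phi,\psi](X)=[[\phi,X],\psi]+[\phi,[\psi,X]]$, $X\in\mathfrak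 g$. Then $\mathrm{Prol}(\mathfrak g)=\bigoplus_{k\le s}\mathfrak g_k$ is a graded Lie algebra ($[\mathfrak g_i,\mathfrak g_j]\subset\mathfrak g_{i+j}$) with finite-dimensional strata, possibly infinite dimensional. Basis and degrees. $X_1,\dots,X_n$ is a basis of $\mathfrak g$ adapted to the stratification, extended to a basis $\{X_j\}_{j\le n}$ of $\mathrm{Prol}(\mathfrak g)$ indexed by integers $j\le n$ (if $\mathrm{Prol}(\mathfrak g)$ is finite dimensional, only by those $j\le n$ above some integer; the notation $j\le n$ is still used and always refers to indices in the range). Each $X_j$ lies in some stratum $\mathfrak g_k$; its degree is $d(j)=k$. The basis is adapted: $i<j$ implies $d(i)\le d(j)$; so $X_1,\dots,X_r$ is a basis of $\mathfrak g_1$. Structure constants: $[X_i,X_j]=\sum_{k\le n}c_{ij}^kX_k$ (a finite sum). Coordinates. $G$ is identified with $\mathbb{R}^n$ by $x=(x_1,\dots,x_n)\leftrightarrow \exp(x_nX_n)\cdot\ldots\cdot\exp(x_1X_1)$, and $X_1,\dots,X_n$ are viewed as left-invariant vector fields on $\mathbb{R}^n$. Generalized structure constants. For $\alpha\in\mathbb{N}^n=\{0,1,2,\dots\}^n$ and $i\le n$, $[X_i,X_\alpha]$ denotes the left-nested iterated bracket in which, starting from $X_i$, one brackets on the right $\alpha_1$ times with $X_1$, then $\alpha_2$ times with $X_2$, ..., finally $\alpha_n$ times with $X_n$; $[X_i,X_0]=X_i$. The constants $c_{i\alpha}^k$ are defined by $[X_i,X_\alpha]=\sum_{k\le n}c_{i\alpha}^kX_k$.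 Extremal polynomials. For $v=(v_1,\dots,v_n)\in\mathbb{R}^n$, with the convention $v_k=0$ for $k\le0$, and for $i\le n$, $$P_i^v(x)=\sum_{\alpha\in\mathbb{N}^n}\frac{(-1)^{|\alpha|}}{\alpha!}\Big(\sum_{k\le n}c_{i\alpha}^kv_k\Big)x^\alpha,\qquad x\in\mathbb{R}^n,$$ where $|\alpha|=\alpha_1+\cdots+\alpha_n$, $\alpha!=\alpha_1!\cdots\alpha_n!$ (only finitely many terms are nonzero). Horizontal curves. A Lipschitz curve $\gamma:[0,1]\to G=\mathbb{R}^n$ is horizontal if there is $h=(h_1,\dots,h_r)\in L^\infty([0,1];\mathbb{R}^r)$ (the controls) with $\dot\gamma=\sum_{j=1}^rh_jX_j(\gamma)$ a.e. on $[0,1]$; then $h_j=\dot\gamma_j$ for $j=1,\dots,r$. Abnormal extremals. A horizontal curve $\gamma:[0,1]\to G$ is an abnormal extremal if there exist Lipschitz functions $\lambda_1,\dots,\lambda_n:[0,1]\to\mathbb{R}$ (coordinates of a dual curve $\lambda=\sum_i\lambda_i\vartheta_i$ in $\mathfrak g^*$, with $\vartheta_1,\dots,\vartheta_n$ the dual basis of $X_1,\dots,X_n$) such that: $(\lambda_1(t),\dots,\lambda_n(t))\ne0$ for every $t\in[0,1]$; $\lambda_1=\dots=\lambda_r=0$ on $[0,1]$; and for all $i=1,\dots,n$, $\dot\lambda_i=-\sum_{k=1}^n\sum_{j=1}^rc_{ij}^k\dot\gamma_j\lambda_k$ a.e. on $[0,1]$. Corank. For $h\in L^2([0,1];\mathbb{R}^r)$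 let $\gamma^h$ solve $\dot\gamma^h=\sum_{j=1}^rh_jX_j(\gamma^h)$, $\gamma^h(0)=x_0$. The end-point mapping with initial point $x_0$ is $\mathcal E:L^2([0,1];\mathbb{R}^r)\to\mathbb{R}^n$, $\mathcal E(h)=\gamma^h(1)$, with differential $d\mathcal E(h)$ at $h$. A horizontal curve starting from $x_0$ with controls $h$ is an abnormal extremal if and only if $d\mathcal E(h)$ is not surjective (known fact). The corank of an abnormal extremal $\gamma$ with $\gamma(0)=x_0$ and controls $h$ is $\mathrm{corank}(\gamma)=n-\dim(\mathrm{Im}\,d\mathcal E(h))\ge1$. Equivalently, it is the maximal number of linearly independent dual curves $\lambda$ of $\gamma$ as in the definition of abnormal extremal. *)

theory Defs
  imports "HOL-Analysis.Analysis" "HOL-Library.Function_Algebras"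
begin

section \<open>Functions into a real vector space form a real vector space\<close>

instantiation "fun" :: (type, real_vector) real_vector
begin

definition scaleR_fun :: "real \<Rightarrow> ('a \<Rightarrow> 'b) \<Rightarrow> 'a \<Rightarrow> 'b" where
  "scaleR_fun c f = (\<lambda>x. c *\<^sub>R f x)"

instance
  by standard (simp_all add: scaleR_fun_def fun_eq_iff plus_fun_def algebra_simps)

end


section \<open>Stratified Lie algebras\<close>

text \<open>
  A Lie algebra is given by its bracket \<open>br\<close> on a real vector space; \<open>V i\<close> is the
  \<open>i\<close>-th stratum for \<open>i \<ge> 1\<close> (the set \<open>V 0\<close> plays no role). The equation
  \<open>V (Suc i) = [V i, V 1]\<close> is required for all \<open>i \<ge> 1\<close>, hence \<open>[V s, V 1] = {0}\<close>.
\<close>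

definition stratification ::
  "('a::real_vector \<Rightarrow> 'a \<Rightarrow> 'a) \<Rightarrow> (nat \<Rightarrow> 'a set) \<Rightarrow> nat \<Rightarrow> bool" where
  "stratification br V s \<longleftrightarrow>
     1 \<le> s \<and> V s \<noteq> {0} \<and>
     (\<forall>i\<ge>1. subspace (V i)) \<and>
     (\<forall>i>s. V i = {0}) \<and>
     (\<forall>x. \<exists>!y. (\<forall>i\<in>{1..s}. y i \<in> V i) \<and> (\<forall>i. i \<notin> {1..s} \<longrightarrow> y i = 0) \<and>
               x = (\<Sum>i=1..s. y i)) \<and>
     (\<forall>i\<ge>1. V (Suc i) = span {br x y | x y. x \<in> V i \<and> y \<in> V 1})"


section \<open>Tanaka prolongation\<close>

text \<open>
  The strata of nonpositive degree are iterated spaces of linear maps and have no common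
  simple type, so all elements of the prolongation are coded in one vector space. An element
  \<open>u\<close> of the prolongation is coded by the function sending a list \<open>[Y\<^sub>1, \<dots>, Y\<^sub>p]\<close> of elements
  of the Lie algebra \<open>\<gg>\<close> to the component in \<open>\<gg>\<close> of \<open>[\<dots>[[u, Y\<^sub>1], Y\<^sub>2], \<dots>, Y\<^sub>p]\<close>. Thus
  \<^item> \<open>u \<in> \<gg>\<close> is coded by its iterated brackets (\<open>prol_embed\<close>);
  \<^item> a linear map \<open>\<phi>\<close> from \<open>\<gg>\<close> to elements already coded is coded by \<open>[] \<mapsto> 0\<close> and
    \<open>Y # Ys \<mapsto> \<phi>(Y)(Ys)\<close>, so that \<open>\<phi>(Y) = [\<phi>, Y]\<close> is \<open>prol_bracket \<phi> Y\<close>.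
\<close>

type_synonym 'a prol = "'a list \<Rightarrow> 'a"

definition prol_embed :: "('a \<Rightarrow> 'a \<Rightarrow> 'a) \<Rightarrow> 'a \<Rightarrow> 'a prol" where
  "prol_embed br u = (\<lambda>Ys. foldl br u Ys)"

definition prol_bracket :: "'a prol \<Rightarrow> 'a \<Rightarrow> 'a prol" where
  "prol_bracket \<phi> Y = (\<lambda>Ys. \<phi> (Y # Ys))"

lemma prol_bracket_embed:
  "prol_bracket (prol_embed br u) Y = prol_embed br (br u Y)"
  by (simp add: prol_bracket_def prol_embed_def)

lemma inj_prol_embed: "inj (prol_embed br)"
proof (rule injI)
  fix u w assume "prol_embed br u = prol_embed br w"
  then have "prol_embed br u [] = prol_embed br w []" by simp
  then show "u = w" by (simp add: prol_embed_def)
qed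

lemma prol_map_eqI:
  assumes "\<phi> [] = \<psi> []" and "\<And>Y. prol_bracket \<phi> Y = prol_bracket \<psi> Y"
  shows "\<phi> = \<psi>"
proof
  fix Ys show "\<phi> Ys = \<psi> Ys"
    using assms by (cases Ys) (auto simp: prol_bracket_def fun_eq_iff)
qed

text \<open>
  In the derivation rule, \<open>[Y, \<phi>(Z)]\<close> is written as \<open>- [\<phi>(Z), Y]\<close>.
\<close>

function prol_stratum ::
  "('a::real_vector \<Rightarrow> 'a \<Rightarrow> 'a) \<Rightarrow> (nat \<Rightarrow> 'a set) \<Rightarrow> nat \<Rightarrow> int \<Rightarrow> 'a prol set" where
  "prol_stratum br V s k =
     (if 1 \<le> k then prol_embed br ` V (nat k)
      else {\<phi>. \<phi> [] = 0 \<and>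
               linear (prol_bracket \<phi>) \<and>
               (\<forall>i\<in>{1..s}. \<forall>Y\<in>V i. prol_bracket \<phi> Y \<in> prol_stratum br V s (k + int i)) \<and>
               (\<forall>Y Z. prol_bracket \<phi> (br Y Z) =
                        prol_bracket (prol_bracket \<phi> Y) Z - prol_bracket (prol_bracket \<phi> Z) Y)})"
  by pat_completeness auto
termination
  by (relation "Wellfounded.measure (\<lambda>(br, V, s, k). nat (1 - k))") auto

declare prol_stratum.simps [simp del]

definition prolongation ::
  "('a::real_vector \<Rightarrow> 'a \<Rightarrow> 'a) \<Rightarrow> (nat \<Rightarrow> 'a set) \<Rightarrow> nat \<Rightarrow> 'a prol set" where
  "prolongation br V s = span (\<Union>k\<in>{..int s}. prol_stratum br V s k)"

text \<open>
  \<open>b 1, \<dots>, b n\<close> is the basis of the Lie algebra, \<open>X j\<close> for \<open>j \<in> J\<close> its extension to a basis of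
  the prolongation, and \<open>d j\<close> the degree of \<open>X j\<close>. The index set \<open>J\<close> consists of the integers
  up to \<open>n\<close>, or of those that are not below some integer \<open>l\<close>.
\<close>

definition adapted_prol_basis ::
  "('a::real_vector \<Rightarrow> 'a \<Rightarrow> 'a) \<Rightarrow> (nat \<Rightarrow> 'a set) \<Rightarrow> nat \<Rightarrow> nat \<Rightarrow> (nat \<Rightarrow> 'a) \<Rightarrow>
   int set \<Rightarrow> (int \<Rightarrow> 'a prol) \<Rightarrow> bool" where
  "adapted_prol_basis br V s n b J X \<longleftrightarrow>
     (J = {..int n} \<or> (\<exists>l. J = {l..int n})) \<and> {1..int n} \<subseteq> J \<and>
     (\<forall>j\<in>{1..n}. X (int j) = prol_embed br (b j)) \<and>
     inj_on X J \<and> independent (X ` J) \<and> span (X ` J) = prolongation br V s \<and>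
     (\<exists>d. (\<forall>j\<in>J. d j \<le> int s \<and> X j \<in> prol_stratum br V s (d j)) \<and>
          (\<forall>i\<in>J. \<forall>j\<in>J. i < j \<longrightarrow> d i \<le> d j))"


section \<open>Lie groups on the manifold $\mathbb{R}^n$\<close>

primrec times_cont_diff ::
  "nat \<Rightarrow> ('a::real_normed_vector \<Rightarrow> 'b::real_normed_vector) \<Rightarrow> bool" where
  "times_cont_diff 0 f \<longleftrightarrow> continuous_on UNIV f"
| "times_cont_diff (Suc k) f \<longleftrightarrow>
     (\<exists>f'. (\<forall>x. (f has_derivative f' x) (at x)) \<and> (\<forall>u. times_cont_diff k (\<lambda>x. f' x u)))"

definition smooth_map :: "('a::real_normed_vector \<Rightarrow> 'b::real_normed_vector) \<Rightarrow> bool" where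
  "smooth_map f \<longleftrightarrow> (\<forall>k. times_cont_diff k f)"

definition lie_group ::
  "('a::real_normed_vector \<Rightarrow> 'a \<Rightarrow> 'a) \<Rightarrow> ('a \<Rightarrow> 'a) \<Rightarrow> bool" where
  "lie_group gmul invr \<longleftrightarrow>
     group gmul 0 invr \<and> smooth_map (\<lambda>p. gmul (fst p) (snd p)) \<and> smooth_map invr"

text \<open>
  The Lie algebra of left-invariant vector fields is identified with the tangent space at the
  identity \<open>0\<close>: the vector \<open>a\<close> corresponds to the field \<open>left_inv_field gmul a\<close>.
\<close>

definition left_inv_field ::
  "('a::real_normed_vector \<Rightarrow> 'a \<Rightarrow> 'a) \<Rightarrow> 'a \<Rightarrow> 'a \<Rightarrow> 'a" where
  "left_inv_field gmul a x = frechet_derivative (\<lambda>y. gmul x y) (at 0) a"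

definition vf_bracket ::
  "('a::real_normed_vector \<Rightarrow> 'a) \<Rightarrow> ('a \<Rightarrow> 'a) \<Rightarrow> 'a \<Rightarrow> 'a" where
  "vf_bracket X Y x = frechet_derivative Y (at x) (X x) - frechet_derivative X (at x) (Y x)"

definition lie_bracket ::
  "('a::real_normed_vector \<Rightarrow> 'a \<Rightarrow> 'a) \<Rightarrow> 'a \<Rightarrow> 'a \<Rightarrow> 'a" where
  "lie_bracket gmul a b = vf_bracket (left_inv_field gmul a) (left_inv_field gmul b) 0"

definition lie_exp :: "('a::real_normed_vector \<Rightarrow> 'a \<Rightarrow> 'a) \<Rightarrow> 'a \<Rightarrow> 'a" where
  "lie_exp gmul a =
     (THE p. \<exists>c. c 0 = 0 \<and>
                 (\<forall>t. (c has_vector_derivative left_inv_field gmul a (c t)) (at t)) \<and> p = c 1)"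

text \<open>
  The coordinates \<open>x\<^sub>1, \<dots>, x\<^sub>n\<close> of \<open>x\<close>, numbered from 1 along the order of the index type.
\<close>

definition ix :: "nat \<Rightarrow> 'n::{finite,linorder}" where
  "ix j = sorted_list_of_set UNIV ! (j - 1)"

definition coord :: "real ^ 'n::{finite,linorder} \<Rightarrow> nat \<Rightarrow> real" where
  "coord x j = x $ ix j"

text \<open>
  The point \<open>x\<close> is \<open>exp (x\<^sub>n X\<^sub>n) \<cdot> \<dots> \<cdot> exp (x\<^sub>1 X\<^sub>1)\<close>.
\<close>

definition exp_coords_second_type ::
  "(real ^ 'n::{finite,linorder} \<Rightarrow> (real, 'n) vec \<Rightarrow> (real, 'n) vec) \<Rightarrow> (nat \<Rightarrow> (real, 'n) vec) \<Rightarrow> bool" where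
  "exp_coords_second_type gmul b \<longleftrightarrow>
     (\<forall>x. x = foldr gmul
                (map (\<lambda>j. lie_exp gmul (coord x j *\<^sub>R b j)) (rev [1..<Suc CARD('n)])) 0)"


section \<open>Extremal polynomials\<close>

text \<open>Multi-indices in $\mathbb{N}^n$ are functions on the index type.\<close>

definition iter_bracket ::
  "(nat \<Rightarrow> 'a) \<Rightarrow> 'a prol \<Rightarrow> ('n::{finite,linorder} \<Rightarrow> nat) \<Rightarrow> 'a prol" where
  "iter_bracket b u \<alpha> =
     foldl prol_bracket u
       (concat (map (\<lambda>j. replicate (\<alpha> (ix j)) (b j)) [1..<Suc CARD('n)]))"

definition gen_struct_const ::
  "(nat \<Rightarrow> 'a::real_vector) \<Rightarrow> int set \<Rightarrow> (int \<Rightarrow> 'a prol) \<Rightarrow>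
   int \<Rightarrow> ('n::{finite,linorder} \<Rightarrow> nat) \<Rightarrow> int \<Rightarrow> real" where
  "gen_struct_const b J X i \<alpha> k = representation (X ` J) (iter_bracket b (X i) \<alpha>) (X k)"

text \<open>
  As \<open>v\<^sub>k = 0\<close> for \<open>k \<le> 0\<close>, the inner sum is over \<open>k = 1, \<dots>, n\<close>; the sum over multi-indices is
  restricted to the nonzero coefficients.
\<close>

definition extremal_coeff ::
  "(nat \<Rightarrow> real ^ 'n::{finite,linorder}) \<Rightarrow> int set \<Rightarrow> (int \<Rightarrow> (real, 'n) vec prol) \<Rightarrow>
   (real, 'n) vec \<Rightarrow> int \<Rightarrow> ('n \<Rightarrow> nat) \<Rightarrow> real" where
  "extremal_coeff b J X v i \<alpha> =
     (- 1) ^ (\<Sum>l\<in>UNIV. \<alpha> l) / (\<Prod>l\<in>UNIV. fact (\<alpha> l)) *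
     (\<Sum>k=1..CARD('n). gen_struct_const b J X i \<alpha> (int k) * coord v k)"

definition extremal_poly ::
  "(nat \<Rightarrow> real ^ 'n::{finite,linorder}) \<Rightarrow> int set \<Rightarrow> (int \<Rightarrow> (real, 'n) vec prol) \<Rightarrow>
   (real, 'n) vec \<Rightarrow> int \<Rightarrow> (real, 'n) vec \<Rightarrow> real" where
  "extremal_poly b J X v i x =
     (\<Sum>\<alpha> | extremal_coeff b J X v i \<alpha> \<noteq> 0.
        extremal_coeff b J X v i \<alpha> * (\<Prod>l\<in>UNIV. (x $ l) ^ \<alpha> l))"

definition extremal_variety ::
  "(nat \<Rightarrow> real ^ 'n::{finite,linorder}) \<Rightarrow> int set \<Rightarrow> (int \<Rightarrow> (real, 'n) vec prol) \<Rightarrow> nat \<Rightarrow>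
   (real, 'n) vec \<Rightarrow> (real, 'n) vec set" where
  "extremal_variety b J X r v =
     {x. \<forall>j\<in>J. j \<le> int r \<longrightarrow> extremal_poly b J X v j x = 0}"


section \<open>Horizontal curves, abnormal extremals and corank\<close>

text \<open>The control \<open>h\<close> has components \<open>h 1, \<dots>, h r\<close>; other components are ignored.\<close>

definition horizontal_curve ::
  "(real ^ 'n::finite \<Rightarrow> real ^ 'n \<Rightarrow> real ^ 'n) \<Rightarrow> (nat \<Rightarrow> real ^ 'n) \<Rightarrow> nat \<Rightarrow>
   (real \<Rightarrow> real ^ 'n) \<Rightarrow> bool" where
  "horizontal_curve gmul b r \<gamma> \<longleftrightarrow>
     (\<exists>C. C-lipschitz_on {0..1} \<gamma>) \<and>
     (\<exists>h. (\<forall>j\<in>{1..r}. h j \<in> borel_measurable (lebesgue_on {0..1}) \<and>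
                        (\<exists>C. AE t in lebesgue_on {0..1}. \<bar>h j t\<bar> \<le> C)) \<and>
          (AE t in lebesgue_on {0..1}.
             (\<gamma> has_vector_derivative (\<Sum>j=1..r. h j t *\<^sub>R left_inv_field gmul (b j) (\<gamma> t))) (at t)))"

text \<open>The controls of a horizontal curve are the derivatives of its first \<open>r\<close> coordinates.\<close>

definition controls :: "(real \<Rightarrow> real ^ 'n::{finite,linorder}) \<Rightarrow> nat \<Rightarrow> real \<Rightarrow> real" where
  "controls \<gamma> j t = coord (vector_derivative \<gamma> (at t)) j"

definition struct_const ::
  "(real ^ 'n::finite \<Rightarrow> real ^ 'n \<Rightarrow> real ^ 'n) \<Rightarrow> (nat \<Rightarrow> real ^ 'n) \<Rightarrow>
   nat \<Rightarrow> nat \<Rightarrow> nat \<Rightarrow> real" where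
  "struct_const gmul b i j k =
     representation (b ` {1..CARD('n)}) (lie_bracket gmul (b i) (b j)) (b k)"

definition abnormal_extremal ::
  "(real ^ 'n::{finite,linorder} \<Rightarrow> (real, 'n) vec \<Rightarrow> (real, 'n) vec) \<Rightarrow> (nat \<Rightarrow> (real, 'n) vec) \<Rightarrow> nat \<Rightarrow>
   (real \<Rightarrow> (real, 'n) vec) \<Rightarrow> bool" where
  "abnormal_extremal gmul b r \<gamma> \<longleftrightarrow>
     horizontal_curve gmul b r \<gamma> \<and>
     (\<exists>\<xi> :: nat \<Rightarrow> real \<Rightarrow> real.
        (\<forall>i\<in>{1..CARD('n)}. \<exists>C. C-lipschitz_on {0..1} (\<xi> i)) \<and>
        (\<forall>t\<in>{0..1}. \<exists>i\<in>{1..CARD('n)}. \<xi> i t \<noteq> 0) \<and>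
        (\<forall>i\<in>{1..r}. \<forall>t\<in>{0..1}. \<xi> i t = 0) \<and>
        (\<forall>i\<in>{1..CARD('n)}. AE t in lebesgue_on {0..1}.
           (\<xi> i has_real_derivative
              - (\<Sum>k=1..CARD('n). \<Sum>j=1..r. struct_const gmul b i j k * controls \<gamma> j t * \<xi> k t))
             (at t)))"

definition L2_controls :: "nat \<Rightarrow> (nat \<Rightarrow> real \<Rightarrow> real) set" where
  "L2_controls r =
     {h. \<forall>j\<in>{1..r}. h j \<in> borel_measurable (lebesgue_on {0..1}) \<and>
                     integrable (lebesgue_on {0..1}) (\<lambda>t. (h j t)\<^sup>2)}"

definition L2_ctrl_norm :: "nat \<Rightarrow> (nat \<Rightarrow> real \<Rightarrow> real) \<Rightarrow> real" where
  "L2_ctrl_norm r h = sqrt (\<Sum>j=1..r. integral\<^sup>L (lebesgue_on {0..1}) (\<lambda>t. (h j t)\<^sup>2))"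

text \<open>
  For \<open>L\<^sup>2\<close> controls the equation \<open>\<gamma>' = \<Sum>\<^sub>j h\<^sub>j X\<^sub>j(\<gamma>)\<close> is understood in integrated form, that is,
  for absolutely continuous curves and almost every time.
\<close>

definition controlled_path ::
  "(real ^ 'n::finite \<Rightarrow> real ^ 'n \<Rightarrow> real ^ 'n) \<Rightarrow> (nat \<Rightarrow> real ^ 'n) \<Rightarrow> nat \<Rightarrow>
   real ^ 'n \<Rightarrow> (nat \<Rightarrow> real \<Rightarrow> real) \<Rightarrow> (real \<Rightarrow> real ^ 'n) \<Rightarrow> bool" where
  "controlled_path gmul b r x0 h \<gamma> \<longleftrightarrow>
     continuous_on {0..1} \<gamma> \<and>
     (\<forall>t\<in>{0..1}. ((\<lambda>\<tau>. \<Sum>j=1..r. h j \<tau> *\<^sub>R left_inv_field gmul (b j) (\<gamma> \<tau>))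
                     has_integral (\<gamma> t - x0)) {0..t})"

definition endpoint_map ::
  "(real ^ 'n::finite \<Rightarrow> real ^ 'n \<Rightarrow> real ^ 'n) \<Rightarrow> (nat \<Rightarrow> real ^ 'n) \<Rightarrow> nat \<Rightarrow>
   real ^ 'n \<Rightarrow> (nat \<Rightarrow> real \<Rightarrow> real) \<Rightarrow> real ^ 'n" where
  "endpoint_map gmul b r x0 h = (THE y. \<exists>\<gamma>. controlled_path gmul b r x0 h \<gamma> \<and> y = \<gamma> 1)"

text \<open>
  Frechet differentiability with respect to the \<open>L\<^sup>2\<close> norm. Controls are not identified when they
  agree almost everywhere; boundedness forces \<open>D\<close> to vanish on null controls.
\<close>

definition has_L2_derivative ::
  "nat \<Rightarrow> ((nat \<Rightarrow> real \<Rightarrow> real) \<Rightarrow> 'b::real_normed_vector) \<Rightarrow>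
   ((nat \<Rightarrow> real \<Rightarrow> real) \<Rightarrow> 'b) \<Rightarrow> (nat \<Rightarrow> real \<Rightarrow> real) \<Rightarrow> bool" where
  "has_L2_derivative r F D h \<longleftrightarrow>
     (\<forall>u\<in>L2_controls r. \<forall>w\<in>L2_controls r. D (u + w) = D u + D w) \<and>
     (\<forall>c. \<forall>u\<in>L2_controls r. D (c *\<^sub>R u) = c *\<^sub>R D u) \<and>
     (\<exists>K. \<forall>u\<in>L2_controls r. norm (D u) \<le> K * L2_ctrl_norm r u) \<and>
     (\<forall>\<epsilon>>0. \<exists>\<delta>>0. \<forall>u\<in>L2_controls r. L2_ctrl_norm r u < \<delta> \<longrightarrow>
        norm (F (h + u) - F h - D u) \<le> \<epsilon> * L2_ctrl_norm r u)"

text \<open>The derivative is determined on \<open>L2_controls r\<close>, hence so is its image.\<close>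

definition corank ::
  "(real ^ 'n::{finite,linorder} \<Rightarrow> (real, 'n) vec \<Rightarrow> (real, 'n) vec) \<Rightarrow> (nat \<Rightarrow> (real, 'n) vec) \<Rightarrow> nat \<Rightarrow>
   (real \<Rightarrow> (real, 'n) vec) \<Rightarrow> nat" where
  "corank gmul b r \<gamma> =
     CARD('n) -
     dim ((SOME D. has_L2_derivative r (endpoint_map gmul b r (\<gamma> 0)) D (controls \<gamma>))
            ` L2_controls r)"

end

theory Submission
  imports Defs
begin

text \<open>
  Write \<open>X\<^sub>w\<close> for the left-invariant field of \<open>w\<close>. In coordinates of the second type
  \<open>x = exp (x\<^sub>n X\<^sub>n) \<cdots> exp (x\<^sub>1 X\<^sub>1)\<close>, so the element \<open>\<Phi>\<^sub>u(x) = Ad(x) u\<close> of the prolongation is a product of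
  exponentials of nilpotent maps applied to \<open>u\<close>. Expanding them gives \<open>P\<^sub>j\<^sup>v(x) = \<langle>v, \<Phi>\<^sub>u(x)\<rangle>\<close> for
  \<open>u = X\<^sub>j\<close>, where only the component of \<open>\<Phi>\<^sub>u(x)\<close> in the Lie algebra matters. Differentiating them
  gives \<open>d\<Phi>\<^sub>u(x)(X\<^sub>w(x)) = - \<Phi>\<^sub>[\<^sub>u\<^sub>,\<^sub>w\<^sub>](x)\<close>.

  Perturbing the controls \<open>h\<close> of \<open>\<gamma>\<close> by \<open>u\<close> replaces \<open>\<gamma>\<close> by \<open>\<eta> \<cdot> \<gamma>\<close>, where \<open>\<eta>\<close> starts at the identity
  and has velocity \<open>Ad(\<gamma>) u\<close>. Hence, up to the differential of a right translation, \<open>d\<E>(h) u\<close> is the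
  integral of \<open>Ad(\<gamma>) u\<close>, and the corank is the dimension of the space of all \<open>v\<close> with
  \<open>\<langle>v, Ad(\<gamma>(t)) X\<^sub>j\<rangle> = P\<^sub>j\<^sup>v(\<gamma>(t)) = 0\<close> for \<open>1 \<le> j \<le> r\<close> and all \<open>t\<close>. For such \<open>v\<close> the polynomials \<open>P\<^sub>j\<^sup>v\<close>
  with \<open>j \<le> 0\<close> vanish along \<open>\<gamma>\<close> too, by induction on the degree: their derivatives along \<open>\<gamma>\<close> are
  combinations of polynomials of one degree higher, and \<open>P\<^sub>j\<^sup>v(0) = v\<^sub>j = 0\<close>. Finally, the functions
  \<open>P\<^sub>i\<^sup>v(\<gamma>)\<close>, \<open>1 \<le> i \<le> n\<close>, are the coordinates of a dual curve.
\<close>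

section \<open>Derivatives\<close>


text \<open>The group is given only by smooth operations, so the Jacobi identity, the derivative of
  Ad and the invariance of the bracket are obtained by differentiating identities between group
  elements. The same device replaces a uniqueness theory for differential equations: two solutions
  y, z of one left-invariant equation have a constant quotient y z^{-1}.

  The degrees of the \<open>X j\<close> with j \<le> 0 may be unbounded below, and an element of
  degree k can reach the Lie algebra after as many as s - k brackets. No truncation order fits all
  of them, so the order \<open>N\<close> of the exponential series is a parameter chosen for each
  element.

  Controls are only integrable; the chain rule and the constancy arguments are therefore made with
  integrals (\<open>ac_path\<close>). Since \<open>endpoint_map\<close> is a definite description,
  perturbed controls need actual trajectories. Writing these as \<eta> \<cdot> \<gamma> leaves only
  \<eta> to be found. It starts at the identity and stays near it, so a fixed point argument in the
  unit ball suffices, however long \<gamma> is.\<close>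

lemma smooth_map_has_derivative:
  assumes "smooth_map f"
  shows "(f has_derivative frechet_derivative f (at x)) (at x)"
proof -
  have "times_cont_diff (Suc 0) f" using assms by (simp only: smooth_map_def)
  then obtain f' where "(f has_derivative f' x) (at x)" by auto
  then show ?thesis using frechet_derivative_at by force
qed

lemma smooth_map_derivative:
  assumes "smooth_map f"
  shows "smooth_map (\<lambda>x. frechet_derivative f (at x) u)"
  unfolding smooth_map_def
proof
  fix k
  have "times_cont_diff (Suc k) f" using assms by (simp only: smooth_map_def)
  then obtain f' where f': "\<And>x. (f has_derivative f' x) (at x)" "times_cont_diff k (\<lambda>x. f' x u)"
    by auto
  have "f' x = frechet_derivative f (at x)" for x using frechet_derivative_at f'(1) by blast
  then show "times_cont_diff k (\<lambda>x. frechet_derivative f (at x) u)" using f'(2) by simp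
qed

lemma smooth_map_continuous: "smooth_map f \<Longrightarrow> continuous_on UNIV f"
  by (metis smooth_map_def times_cont_diff.simps(1))

text \<open>The second difference is symmetric in \<open>u\<close> and \<open>w\<close>. One mean
  value step along \<open>u\<close> and one along \<open>w\<close> express it by the second
  derivative in that order.\<close>

lemma second_difference_mvt:
  fixes f :: "'a::real_normed_vector \<Rightarrow> real"
  assumes d: "\<And>x. (f has_derivative f' x) (at x)"
    and d2: "\<And>x. ((\<lambda>x. f' x u) has_derivative f'' x) (at x)"
    and "0 < s"
  obtains \<sigma> \<tau> where "\<sigma> \<in> {0<..<s}" "\<tau> \<in> {0<..<s}"
    "f (a + s *\<^sub>R u + s *\<^sub>R w) - f (a + s *\<^sub>R u) - f (a + s *\<^sub>R w) + f a
      = s * s * f'' (a + \<sigma> *\<^sub>R u + \<tau> *\<^sub>R w) w"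
proof -
  have lin: "f' x (c *\<^sub>R v) = c * f' x v" "f'' x (c *\<^sub>R v) = c * f'' x v" for x c v
    using linear_cmul[OF has_derivative_linear[OF d]] linear_cmul[OF has_derivative_linear[OF d2]] by auto
  have 1: "((\<lambda>\<sigma>. f (a + \<sigma> *\<^sub>R u + s *\<^sub>R w) - f (a + \<sigma> *\<^sub>R u)) has_real_derivative
         f' (a + \<sigma> *\<^sub>R u + s *\<^sub>R w) u - f' (a + \<sigma> *\<^sub>R u) u) (at \<sigma>)" for \<sigma>
  proof -
    have "((\<lambda>\<sigma>. f (a + \<sigma> *\<^sub>R u + v)) has_derivative (\<lambda>h. f' (a + \<sigma> *\<^sub>R u + v) (h *\<^sub>R u))) (at \<sigma>)" for v
      by (rule has_derivative_compose[OF _ d]) (auto intro!: derivative_eq_intros)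
    from has_derivative_diff[OF this[of "s *\<^sub>R w"] this[of 0], unfolded add_0_right] show ?thesis
      unfolding has_field_derivative_def
      by (rule has_derivative_eq_rhs) (simp add: lin algebra_simps fun_eq_iff)
  qed
  obtain \<sigma> where \<sigma>: "0 < \<sigma>" "\<sigma> < s"
    "(f (a + s *\<^sub>R u + s *\<^sub>R w) - f (a + s *\<^sub>R u)) - (f (a + 0 *\<^sub>R u + s *\<^sub>R w) - f (a + 0 *\<^sub>R u))
      = (s - 0) * (f' (a + \<sigma> *\<^sub>R u + s *\<^sub>R w) u - f' (a + \<sigma> *\<^sub>R u) u)"
    using MVT2[OF \<open>0 < s\<close> 1] by (elim exE conjE) (rule that; assumption)
  have 2: "((\<lambda>\<tau>. f' (a + \<sigma> *\<^sub>R u + \<tau> *\<^sub>R w) u) has_real_derivative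
         f'' (a + \<sigma> *\<^sub>R u + \<tau> *\<^sub>R w) w) (at \<tau>)" for \<tau>
  proof -
    have "((\<lambda>\<tau>. f' (a + \<sigma> *\<^sub>R u + \<tau> *\<^sub>R w) u) has_derivative
        (\<lambda>h. f'' (a + \<sigma> *\<^sub>R u + \<tau> *\<^sub>R w) (h *\<^sub>R w))) (at \<tau>)"
      by (rule has_derivative_compose[OF _ d2]) (auto intro!: derivative_eq_intros)
    then show ?thesis
      unfolding has_field_derivative_def
      by (rule has_derivative_eq_rhs) (simp add: lin algebra_simps fun_eq_iff)
  qed
  obtain \<tau> where \<tau>: "0 < \<tau>" "\<tau> < s"
    "f' (a + \<sigma> *\<^sub>R u + s *\<^sub>R w) u - f' (a + \<sigma> *\<^sub>R u + 0 *\<^sub>R w) u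
      = (s - 0) * f'' (a + \<sigma> *\<^sub>R u + \<tau> *\<^sub>R w) w"
    using MVT2[OF \<open>0 < s\<close> 2] by (elim exE conjE) (rule that; assumption)
  have m: "\<sigma> \<in> {0<..<s}" "\<tau> \<in> {0<..<s}" using \<sigma>(1,2) \<tau>(1,2) by simp_all
  have "f (a + s *\<^sub>R u + s *\<^sub>R w) - f (a + s *\<^sub>R u) - f (a + s *\<^sub>R w) + f a
      = s * s * f'' (a + \<sigma> *\<^sub>R u + \<tau> *\<^sub>R w) w"
    using \<sigma>(3) \<tau>(3) by (simp only: scaleR_zero_left add_0_right diff_zero mult.assoc)
  from that[OF m this] show ?thesis .
qed

text \<open>Exchanging \<open>u\<close> and \<open>w\<close> does not change the second difference,
  so the two mixed derivatives have a common value at points that tend to \<open>a\<close>;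
  continuity passes to the limit.\<close>

lemma symmetric_second_derivative_real:
  fixes f :: "'a::real_normed_vector \<Rightarrow> real"
    and f' :: "'a \<Rightarrow> 'a \<Rightarrow> real" and f'' :: "'a \<Rightarrow> 'a \<Rightarrow> 'a \<Rightarrow> real"
  assumes d: "\<And>x. (f has_derivative f' x) (at x)"
    and d2: "\<And>u x. ((\<lambda>x. f' x u) has_derivative f'' u x) (at x)"
    and c: "\<And>u w. continuous_on UNIV (\<lambda>x. f'' u x w)"
  shows "f'' u a w = f'' w a u"
proof -
  let ?s = "\<lambda>n. 1 / real (Suc n)"
  have ex: "\<exists>\<sigma> \<tau> \<sigma>' \<tau>' :: real. {\<sigma>, \<tau>, \<sigma>', \<tau>'} \<subseteq> {0<..<s} \<and>
      f'' u (a + \<sigma> *\<^sub>R u + \<tau> *\<^sub>R w) w = f'' w (a + \<sigma>' *\<^sub>R w + \<tau>' *\<^sub>R u) u" if s: "0 < s" for s :: real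
  proof -
    obtain \<sigma> \<tau> where 1: "\<sigma> \<in> {0<..<s}" "\<tau> \<in> {0<..<s}"
      "f (a + s *\<^sub>R u + s *\<^sub>R w) - f (a + s *\<^sub>R u) - f (a + s *\<^sub>R w) + f a
      = s * s * f'' u (a + \<sigma> *\<^sub>R u + \<tau> *\<^sub>R w) w"
      by (rule second_difference_mvt[OF d d2[of u] s, of a w])
    obtain \<sigma>' \<tau>' where 2: "\<sigma>' \<in> {0<..<s}" "\<tau>' \<in> {0<..<s}"
      "f (a + s *\<^sub>R w + s *\<^sub>R u) - f (a + s *\<^sub>R w) - f (a + s *\<^sub>R u) + f a
      = s * s * f'' w (a + \<sigma>' *\<^sub>R w + \<tau>' *\<^sub>R u) u"
      by (rule second_difference_mvt[OF d d2[of w] s, of a u])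
    have "a + s *\<^sub>R w + s *\<^sub>R u = a + s *\<^sub>R u + s *\<^sub>R w" by simp
    from 1(3) 2(3)[unfolded this] have "s * s * f'' u (a + \<sigma> *\<^sub>R u + \<tau> *\<^sub>R w) w = s * s * f'' w (a + \<sigma>' *\<^sub>R w + \<tau>' *\<^sub>R u) u"
      by linarith
    then have "f'' u (a + \<sigma> *\<^sub>R u + \<tau> *\<^sub>R w) w = f'' w (a + \<sigma>' *\<^sub>R w + \<tau>' *\<^sub>R u) u" using s by simp
    then show ?thesis using 1 2 by blast
  qed
  have "\<forall>n. \<exists>\<sigma> \<tau> \<sigma>' \<tau>' :: real. {\<sigma>, \<tau>, \<sigma>', \<tau>'} \<subseteq> {0<..<?s n} \<and>
      f'' u (a + \<sigma> *\<^sub>R u + \<tau> *\<^sub>R w) w = f'' w (a + \<sigma>' *\<^sub>R w + \<tau>' *\<^sub>R u) u"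
    by (intro allI ex) simp
  then obtain \<sigma> \<tau> \<sigma>' \<tau>' :: "nat \<Rightarrow> real" where b: "\<And>n. {\<sigma> n, \<tau> n, \<sigma>' n, \<tau>' n} \<subseteq> {0<..<?s n}"
    and e: "\<And>n. f'' u (a + \<sigma> n *\<^sub>R u + \<tau> n *\<^sub>R w) w = f'' w (a + \<sigma>' n *\<^sub>R w + \<tau>' n *\<^sub>R u) u"
    unfolding choice_iff by blast
  have l: "x \<longlonglongrightarrow> 0" if "\<And>n. x n \<in> {0<..<?s n}" for x :: "nat \<Rightarrow> real"
  proof (rule tendsto_sandwich[of "\<lambda>_. 0" _ _ ?s])
    show "\<forall>\<^sub>F n in sequentially. 0 \<le> x n" "\<forall>\<^sub>F n in sequentially. x n \<le> ?s n"
      using that by (auto intro!: always_eventually less_imp_le)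
    show "?s \<longlonglongrightarrow> 0" using LIMSEQ_inverse_real_of_nat by (simp add: inverse_eq_divide)
  qed simp
  have l0: "\<sigma> \<longlonglongrightarrow> 0" "\<tau> \<longlonglongrightarrow> 0" "\<sigma>' \<longlonglongrightarrow> 0" "\<tau>' \<longlonglongrightarrow> 0"
    by (rule l, use b[unfolded insert_subset] in iprover)+
  have "(\<lambda>n. a + \<sigma> n *\<^sub>R u + \<tau> n *\<^sub>R w) \<longlonglongrightarrow> a + 0 *\<^sub>R u + 0 *\<^sub>R w"
    "(\<lambda>n. a + \<sigma>' n *\<^sub>R w + \<tau>' n *\<^sub>R u) \<longlonglongrightarrow> a + 0 *\<^sub>R w + 0 *\<^sub>R u"
    by (intro tendsto_intros l0)+
  moreover have iso: "isCont (\<lambda>x. f'' u x w) y" for u w y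
    using c by (simp add: continuous_on_eq_continuous_at)
  ultimately have "(\<lambda>n. f'' u (a + \<sigma> n *\<^sub>R u + \<tau> n *\<^sub>R w) w) \<longlonglongrightarrow> f'' u a w"
    "(\<lambda>n. f'' w (a + \<sigma>' n *\<^sub>R w + \<tau>' n *\<^sub>R u) u) \<longlonglongrightarrow> f'' w a u"
    using isCont_tendsto_compose[OF iso] by simp_all
  then show ?thesis unfolding e by (rule LIMSEQ_unique)
qed

lemma symmetric_second_derivative:
  fixes f :: "'a::real_normed_vector \<Rightarrow> 'b::euclidean_space"
  assumes d: "\<And>x. (f has_derivative f' x) (at x)"
    and d2: "\<And>u x. ((\<lambda>x. f' x u) has_derivative f'' u x) (at x)"
    and c: "\<And>u w. continuous_on UNIV (\<lambda>x. f'' u x w)"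
  shows "f'' u a w = f'' w a u"
proof (rule euclidean_eqI)
  fix i :: 'b
  show "f'' u a w \<bullet> i = f'' w a u \<bullet> i"
    by (rule symmetric_second_derivative_real[where f="\<lambda>x. f x \<bullet> i" and f'="\<lambda>x v. f' x v \<bullet> i"
          and f''="\<lambda>u x v. f'' u x v \<bullet> i"])
       (intro has_derivative_inner_left d d2 continuous_on_inner continuous_on_const c)+
qed

text \<open>Expanding \<open>k x\<close> in the standard basis reduces this product rule to a finite
  sum of scalars times maps, so no topology on linear maps is involved.\<close>

lemma has_derivative_linear_family:
  fixes T :: "'a::real_normed_vector \<Rightarrow> 'b::euclidean_space \<Rightarrow> 'c::real_normed_vector"
  assumes T: "\<And>x. linear (T x)"
    and D: "\<And>u. ((\<lambda>x. T x u) has_derivative D u) (at a)"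
    and k: "(k has_derivative k') (at a)"
  shows "((\<lambda>x. T x (k x)) has_derivative (\<lambda>d. D (k a) d + T a (k' d))) (at a)"
proof -
  have exp: "T x u = (\<Sum>i\<in>Basis. (u \<bullet> i) *\<^sub>R T x i)" for x u
    using linear_sum[OF T, of x "\<lambda>i. (u \<bullet> i) *\<^sub>R i" Basis]
    by (simp add: euclidean_representation linear_cmul[OF T])
  \<comment> \<open>Linearity of \<open>D\<close> in its first argument comes from the uniqueness of
    derivatives.\<close>
  have "((\<lambda>x. \<Sum>i\<in>Basis. (k a \<bullet> i) *\<^sub>R T x i) has_derivative (\<lambda>d. \<Sum>i\<in>Basis. (k a \<bullet> i) *\<^sub>R D i d)) (at a)"
    by (auto intro!: derivative_eq_intros D)
  then have Dk: "D (k a) = (\<lambda>d. \<Sum>i\<in>Basis. (k a \<bullet> i) *\<^sub>R D i d)"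
    using D has_derivative_unique unfolding exp[symmetric] by blast
  have "((\<lambda>x. \<Sum>i\<in>Basis. (k x \<bullet> i) *\<^sub>R T x i) has_derivative
      (\<lambda>d. \<Sum>i\<in>Basis. (k a \<bullet> i) *\<^sub>R D i d + (k' d \<bullet> i) *\<^sub>R T a i)) (at a)"
    by (auto intro!: derivative_eq_intros D k)
  then show ?thesis
    unfolding exp[symmetric] by (simp add: sum.distrib Dk exp[symmetric])
qed

lemma has_derivative_along:
  assumes "(f has_derivative f') (at x)" "(g has_derivative g') (at 0)" "g 0 = x"
  shows "((\<lambda>z. f (g z)) has_derivative (\<lambda>d. f' (g' d))) (at 0)"
  using has_derivative_compose[OF assms(2), of f f'] assms by simp

text \<open>This rule turns identities between group elements into identities between
  differentials.\<close>

lemma has_derivative_eqD: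
  assumes "(f has_derivative f') (at x)" "(g has_derivative g') (at x)" "\<And>z. f z = g z"
  shows "f' w = g' w"
proof -
  have "f = g" using assms(3) by auto
  then show ?thesis using assms(1,2) has_derivative_unique by metis
qed

section \<open>Lie groups\<close>

locale lie_group_rn =
  fixes gmul :: "'a::euclidean_space \<Rightarrow> 'a \<Rightarrow> 'a" and invr :: "'a \<Rightarrow> 'a"
  assumes lie_group: "lie_group gmul invr"
begin

sublocale G: group gmul 0 invr
  using lie_group by (simp add: lie_group_def)

abbreviation mul (infixl "\<cdot>" 70) where "x \<cdot> y \<equiv> gmul x y"

definition dmul :: "'a \<times> 'a \<Rightarrow> 'a \<times> 'a \<Rightarrow> 'a" where
  "dmul p = frechet_derivative (\<lambda>p. fst p \<cdot> snd p) (at p)"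

lemma smooth_mul: "smooth_map (\<lambda>p. fst p \<cdot> snd p)"
  and smooth_inv: "smooth_map invr"
  using lie_group by (auto simp: lie_group_def)

lemma has_derivative_mul: "((\<lambda>p. fst p \<cdot> snd p) has_derivative dmul p) (at p)"
  unfolding dmul_def by (rule smooth_map_has_derivative[OF smooth_mul])

lemma linear_dmul: "linear (dmul p)"
  using has_derivative_mul has_derivative_linear by blast

lemmas dmul_simps = linear_add[OF linear_dmul] linear_diff[OF linear_dmul] linear_cmul[OF linear_dmul]
  linear_sum[OF linear_dmul] linear_0[OF linear_dmul] linear_neg[OF linear_dmul]

lemma smooth_dmul: "smooth_map (\<lambda>p. dmul p q)"
  unfolding dmul_def by (rule smooth_map_derivative[OF smooth_mul])

lemma has_derivative_mul_compose [derivative_intros]: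
  assumes "(f has_derivative f') (at x)" "(g has_derivative g') (at x)"
  shows "((\<lambda>x. f x \<cdot> g x) has_derivative (\<lambda>d. dmul (f x, g x) (f' d, g' d))) (at x)"
  using has_derivative_compose[OF has_derivative_Pair[OF assms] has_derivative_mul] by simp

abbreviation field :: "'a \<Rightarrow> 'a \<Rightarrow> 'a" where "field \<equiv> left_inv_field gmul"

lemma field_eq: "field w x = dmul (x, 0) (0, w)"
proof -
  have "((\<lambda>y. x \<cdot> y) has_derivative (\<lambda>d. dmul (x, 0) (0, d))) (at 0)"
    by (auto intro!: derivative_eq_intros)
  then show ?thesis
    by (simp add: left_inv_field_def frechet_derivative_at[symmetric])
qed

lemma linear_field: "linear (\<lambda>w. field w x)"
  unfolding field_eq by (rule linearI) (simp_all add: dmul_simps(1,3)[symmetric])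

lemmas field_linear = linear_add[OF linear_field] linear_diff[OF linear_field] linear_cmul[OF linear_field]
  linear_sum[OF linear_field] linear_0[OF linear_field] linear_neg[OF linear_field]

lemma dmul_at_0: "dmul (0, 0) (z, w) = z + w"
proof -
  have d: "((\<lambda>x. 0 \<cdot> x) has_derivative (\<lambda>d. dmul (0, 0) (0, d))) (at 0)"
    "((\<lambda>x. x \<cdot> 0) has_derivative (\<lambda>d. dmul (0, 0) (d, 0))) (at 0)"
    by (rule derivative_eq_intros refl | simp)+
  have "dmul (0, 0) (0, w) = w" "dmul (0, 0) (z, 0) = z"
    using has_derivative_eqD[OF d(1) has_derivative_ident] has_derivative_eqD[OF d(2) has_derivative_ident]
    by simp_all
  then show ?thesis using dmul_simps(1)[of "(0,0)" "(z,0)" "(0,w)"] by simp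
qed

lemma field_at_0 [simp]: "field w 0 = w"
  by (simp add: field_eq dmul_at_0)

text \<open>Associativity x (y z) = (x y) z, differentiated in \<open>z\<close> at the
  identity.\<close>

lemma left_invariant: "dmul (x, y) (0, field w y) = field w (x \<cdot> y)"
proof -
  have "((\<lambda>z. x \<cdot> (y \<cdot> z)) has_derivative (\<lambda>w. dmul (x, y) (0, field w y))) (at 0)"
    by (auto intro!: derivative_eq_intros simp: field_eq)
  moreover have "((\<lambda>z. (x \<cdot> y) \<cdot> z) has_derivative (\<lambda>w. field w (x \<cdot> y))) (at 0)"
    by (auto intro!: derivative_eq_intros simp: field_eq)
  ultimately show ?thesis
    by (rule has_derivative_eqD[OF _ _ G.assoc[symmetric]])
qed

lemma dmul_inv_field: "dmul (invr x, x) (0, field w x) = w"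
  by (simp only: left_invariant G.left_inverse field_at_0)

lemma field_inj: "field w x = field w' x \<Longrightarrow> w = w'"
  using dmul_inv_field by metis

section \<open>The adjoint representation and the Jacobi identity\<close>

definition Ad :: "'a \<Rightarrow> 'a \<Rightarrow> 'a" where
  "Ad x w = dmul (x, invr x) (field w x, 0)"

lemma has_derivative_conj: "((\<lambda>z. x \<cdot> z \<cdot> invr x) has_derivative Ad x) (at 0)"
proof -
  have "((\<lambda>z. x \<cdot> z \<cdot> invr x) has_derivative (\<lambda>d. dmul (x, invr x) (field d x, 0))) (at 0)"
    by (auto intro!: derivative_eq_intros simp: field_eq)
  moreover have "Ad x = (\<lambda>d. dmul (x, invr x) (field d x, 0))"
    by (rule ext) (rule Ad_def)
  ultimately show ?thesis by simp
qed

lemma linear_Ad: "linear (Ad x)"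
  using has_derivative_conj has_derivative_linear by blast

lemmas Ad_simps = linear_add[OF linear_Ad] linear_diff[OF linear_Ad] linear_cmul[OF linear_Ad]
  linear_sum[OF linear_Ad] linear_0[OF linear_Ad] linear_neg[OF linear_Ad]

lemma Ad_0 [simp]: "Ad 0 w = w"
  by (simp add: Ad_def dmul_at_0)

lemma Ad_mul: "Ad (x \<cdot> y) w = Ad x (Ad y w)"
proof -
  have "((\<lambda>z. x \<cdot> (y \<cdot> z \<cdot> invr y) \<cdot> invr x) has_derivative (\<lambda>w. Ad x (Ad y w))) (at 0)"
    by (rule has_derivative_along[OF _ has_derivative_conj]) (auto intro!: has_derivative_conj)
  moreover have "((\<lambda>z. (x \<cdot> y) \<cdot> z \<cdot> invr (x \<cdot> y)) has_derivative Ad (x \<cdot> y)) (at 0)"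
    by (rule has_derivative_conj)
  ultimately show ?thesis
    by (rule has_derivative_eqD[symmetric]) (simp add: G.assoc G.inverse_distrib_swap)
qed

lemma Ad_inv [simp]: "Ad x (Ad (invr x) w) = w" "Ad (invr x) (Ad x w) = w"
  by (simp_all add: Ad_mul[symmetric])

text \<open>Derivative at z = 0 of x (y z y^{-1}) y = (x y) z: right translation by \<open>y\<close>
  matches left-invariant fields after a twist by \<open>Ad y\<close>.\<close>

lemma field_mul_Ad: "dmul (x, y) (field (Ad y w) x, 0) = field w (x \<cdot> y)"
proof -
  have "((\<lambda>z. x \<cdot> (y \<cdot> z \<cdot> invr y) \<cdot> y) has_derivative (\<lambda>w. dmul (x, y) (field (Ad y w) x, 0))) (at 0)"
    by (rule has_derivative_along[OF _ has_derivative_conj])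
       (auto intro!: derivative_eq_intros simp: field_eq)
  moreover have "((\<lambda>z. (x \<cdot> y) \<cdot> z) has_derivative (\<lambda>w. field w (x \<cdot> y))) (at 0)"
    by (auto intro!: derivative_eq_intros simp: field_eq)
  ultimately show ?thesis
    by (rule has_derivative_eqD) (simp add: G.assoc)
qed

text \<open>Velocity of a product of two moving points, the source of the decomposition \<eta>
  \<cdot> \<gamma>: the left factor must move with \<open>Ad y w\<close> in order to contribute
  \<open>w\<close>.\<close>

lemma dmul_fields: "dmul (x, y) (field (Ad y w) x, field w' y) = field (w + w') (x \<cdot> y)"
  using dmul_simps(1)[of "(x,y)" "(field (Ad y w) x, 0)" "(0, field w' y)"]
  by (simp add: field_mul_Ad left_invariant field_linear)

definition dinv :: "'a \<Rightarrow> 'a \<Rightarrow> 'a" where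
  "dinv x = frechet_derivative invr (at x)"

lemma has_derivative_inv: "(invr has_derivative dinv x) (at x)"
  unfolding dinv_def by (rule smooth_map_has_derivative[OF smooth_inv])

lemma has_derivative_inv_compose [derivative_intros]:
  assumes "(f has_derivative f') (at x)"
  shows "((\<lambda>x. invr (f x)) has_derivative (\<lambda>d. dinv (f x) (f' d))) (at x)"
  using has_derivative_compose[OF assms has_derivative_inv] .

text \<open>Right quotients of points moving along the same left-invariant field do not move, since
  \<open>(x \<cdot> z) \<cdot> (y \<cdot> z)\<^sup>-\<^sup>1 = x \<cdot> y\<^sup>-\<^sup>1\<close>.\<close>

lemma dmul_quotient: "dmul (x, invr y) (field w x, dinv y (field w y)) = 0"
proof -
  have "((\<lambda>z. (x \<cdot> z) \<cdot> invr (y \<cdot> z)) has_derivative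
      (\<lambda>w. dmul (x, invr y) (field w x, dinv y (field w y)))) (at 0)"
    by (auto intro!: derivative_eq_intros simp: field_eq)
  moreover have "((\<lambda>z. (x \<cdot> z) \<cdot> invr (y \<cdot> z)) has_derivative (\<lambda>w. 0)) (at 0)"
  proof -
    have "(x \<cdot> z) \<cdot> invr (y \<cdot> z) = x \<cdot> (z \<cdot> invr z) \<cdot> invr y" for z
      by (simp only: G.assoc G.inverse_distrib_swap)
    then have "(x \<cdot> z) \<cdot> invr (y \<cdot> z) = x \<cdot> invr y" for z by simp
    then show ?thesis by simp
  qed
  ultimately show ?thesis by (rule has_derivative_eqD) simp
qed

lemma smooth_field_deriv:
  "((\<lambda>x. field w x) has_derivative (\<lambda>d. frechet_derivative (\<lambda>p. dmul p (0, w)) (at (x, 0)) (d, 0))) (at x)"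
  unfolding field_eq
  by (rule has_derivative_compose[where f="\<lambda>x. (x, 0)" and g="\<lambda>p. dmul p (0, w)"])
     (auto intro!: derivative_eq_intros smooth_map_has_derivative smooth_dmul)

lemma continuous_field: "continuous_on UNIV (field w)"
  by (rule has_derivative_continuous_on, rule has_derivative_at_withinI, rule smooth_field_deriv)

lemma continuous_field_deriv: "continuous_on UNIV (\<lambda>x. frechet_derivative (field w) (at x) d)"
proof -
  have "frechet_derivative (field w) (at x) d
      = frechet_derivative (\<lambda>p. dmul p (0, w)) (at (x, 0)) (d, 0)" for x
    using fun_cong[OF frechet_derivative_at[OF smooth_field_deriv[of w x]], of d] by simp
  moreover have "continuous_on UNIV (\<lambda>x. frechet_derivative (\<lambda>p. dmul p (0, w)) (at (x, 0)) (d, 0))"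
    by (rule continuous_on_compose2[OF smooth_map_continuous[OF smooth_map_derivative[OF smooth_dmul]]])
       (auto intro!: continuous_intros)
  ultimately show ?thesis by simp
qed

lemma field_has_derivative: "(field w has_derivative frechet_derivative (field w) (at x)) (at x)"
  by (rule frechet_derivative_works[THEN iffD1], rule differentiableI, rule smooth_field_deriv)

lemma lie_bracket_eq:
  "lie_bracket gmul a w = frechet_derivative (field w) (at 0) a - frechet_derivative (field a) (at 0) w"
  by (simp add: lie_bracket_def vf_bracket_def)

definition dAd :: "'a \<Rightarrow> 'a \<Rightarrow> 'a \<Rightarrow> 'a" where
  "dAd w x = frechet_derivative (\<lambda>x. Ad x w) (at x)"

lemma has_derivative_Ad: "((\<lambda>x. Ad x w) has_derivative dAd w x) (at x)"
proof -
  define T where "T x v = dmul (x, invr x) (v, 0)" for x v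
  have T: "linear (T x)" for x
    unfolding T_def by (rule linearI) (simp_all add: dmul_simps(1,3)[symmetric])
  have dT: "((\<lambda>x. T x v) has_derivative (\<lambda>d. frechet_derivative (\<lambda>p. dmul p (v, 0)) (at (x, invr x)) (d, dinv x d))) (at x)" for v
    unfolding T_def
    by (rule has_derivative_compose[where f="\<lambda>x. (x, invr x)" and g="\<lambda>p. dmul p (v, 0)"])
       (auto intro!: derivative_eq_intros smooth_map_has_derivative smooth_dmul has_derivative_inv)
  have "((\<lambda>x. T x (field w x)) has_derivative (\<lambda>d. frechet_derivative (\<lambda>p. dmul p (field w x, 0)) (at (x, invr x)) (d, dinv x d) + T x (frechet_derivative (field w) (at x) d))) (at x)"
    by (rule has_derivative_linear_family[OF T dT field_has_derivative])
  then have "(\<lambda>x. Ad x w) differentiable (at x)"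
    unfolding T_def Ad_def by (rule differentiableI)
  then show ?thesis
    unfolding dAd_def by (rule frechet_derivative_works[THEN iffD1])
qed

lemma continuous_Ad: "continuous_on UNIV (\<lambda>x. Ad x w)"
  by (rule has_derivative_continuous_on, rule has_derivative_at_withinI, rule has_derivative_Ad)

text \<open>The field of \<open>w\<close> at \<open>x\<close> is the right translate of
  \<open>Ad x w\<close>. The product rule splits its derivative at 0 into a mixed second derivative
  of the multiplication and \<open>dAd\<close>. As second derivatives are symmetric, the mixed term
  is the derivative of the field of \<open>a\<close> along \<open>w\<close>, and the difference is
  the bracket.\<close>

lemma dAd_at_0: "dAd w 0 a = lie_bracket gmul a w"
proof -
  have T: "linear (\<lambda>v. dmul (0, x) (v, 0))" for x
    by (rule linearI) (simp_all add: dmul_simps(1,3)[symmetric])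
  have dT: "((\<lambda>x. dmul (0, x) (v, 0)) has_derivative
      (\<lambda>d. frechet_derivative (\<lambda>p. dmul p (v, 0)) (at (0, x)) (0, d))) (at x)" for x v
    by (rule has_derivative_compose[where f="\<lambda>x. (0, x)" and g="\<lambda>p. dmul p (v, 0)"])
       (auto intro!: derivative_eq_intros smooth_map_has_derivative smooth_dmul)
  have eq: "field w x = dmul (0, x) (Ad x w, 0)" for x
    using field_mul_Ad[of 0 x w] by simp
  have "(field w has_derivative (\<lambda>d. frechet_derivative (\<lambda>p. dmul p (Ad 0 w, 0)) (at (0, 0)) (0, d)
      + dmul (0, 0) (dAd w 0 d, 0))) (at 0)"
    unfolding eq[abs_def] by (rule has_derivative_linear_family[OF T dT has_derivative_Ad])
  then have 1: "frechet_derivative (field w) (at 0) a = frechet_derivative (\<lambda>p. dmul p (w, 0)) (at (0, 0)) (0, a) + dAd w 0 a"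
    by (simp add: frechet_derivative_at[symmetric] dmul_at_0)
  have "frechet_derivative (\<lambda>p. dmul p (w, 0)) (at (0, 0)) (0, a)
      = frechet_derivative (\<lambda>p. dmul p (0, a)) (at (0, 0)) (w, 0)"
    by (rule symmetric_second_derivative[OF has_derivative_mul smooth_map_has_derivative[OF smooth_dmul]])
       (intro smooth_map_continuous smooth_map_derivative smooth_dmul)
  also have 2: "\<dots> = frechet_derivative (field a) (at 0) w"
    using fun_cong[OF frechet_derivative_at[OF smooth_field_deriv[of a 0]], of w] by simp
  finally have 3: "frechet_derivative (\<lambda>p. dmul p (w, 0)) (at (0, 0)) (0, a)
      = frechet_derivative (field a) (at 0) w" .
  have "C = A - D" if "A = B + C" "B = D" for A B C D :: 'a using that by simp
  from this[OF 1 3] show ?thesis unfolding lie_bracket_eq .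
qed

abbreviation br :: "'a \<Rightarrow> 'a \<Rightarrow> 'a" where "br \<equiv> lie_bracket gmul"

lemma linear_br_left: "linear (\<lambda>a. br a w)"
proof -
  have "(\<lambda>a. br a w) = dAd w 0" by (rule ext) (rule dAd_at_0[symmetric])
  then show ?thesis using has_derivative_linear[OF has_derivative_Ad[of w 0]] by metis
qed

lemma br_anticomm: "br a w = - br w a"
  by (simp add: lie_bracket_eq)

lemma linear_br_right: "linear (br a)"
proof -
  have "br a = (\<lambda>w. - br w a)" by (rule ext) (rule br_anticomm)
  then show ?thesis by (rule ssubst) (rule linear_compose_neg[OF linear_br_left])
qed

lemmas br_simps = linear_add[OF linear_br_left] linear_diff[OF linear_br_left] linear_cmul[OF linear_br_left]
  linear_sum[OF linear_br_left] linear_0[OF linear_br_left] linear_neg[OF linear_br_left]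
  linear_add[OF linear_br_right] linear_diff[OF linear_br_right] linear_cmul[OF linear_br_right]
  linear_sum[OF linear_br_right] linear_0[OF linear_br_right] linear_neg[OF linear_br_right]

lemma has_derivative_Ad_0: "((\<lambda>x. Ad x w) has_derivative (\<lambda>a. br a w)) (at 0)"
proof -
  have "(\<lambda>a. br a w) = dAd w 0" by (rule ext) (rule dAd_at_0[symmetric])
  then show ?thesis using has_derivative_Ad[of w 0] by metis
qed

text \<open>Both sides are derivatives at \<open>y = 0\<close> of \<open>Ad (x \<cdot> y \<cdot> x\<^sup>-\<^sup>1) \<circ> Ad x = Ad x \<circ> Ad y\<close>.\<close>

lemma br_Ad: "br (Ad x b) (Ad x w) = Ad x (br b w)"
proof -
  have "((\<lambda>y. Ad (x \<cdot> y \<cdot> invr x) (Ad x w)) has_derivative (\<lambda>b. br (Ad x b) (Ad x w))) (at 0)"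
    by (rule has_derivative_along[OF has_derivative_Ad_0 has_derivative_conj]) simp
  moreover have "((\<lambda>y. Ad x (Ad y w)) has_derivative (\<lambda>b. Ad x (br b w))) (at 0)"
    by (rule has_derivative_along[OF linear_imp_has_derivative[OF linear_Ad] has_derivative_Ad_0]) simp
  ultimately show ?thesis by (rule has_derivative_eqD) (simp add: Ad_mul)
qed

text \<open>The invariance \<open>br_Ad\<close>, differentiated in \<open>x\<close> at the identity
  along \<open>a\<close>.\<close>

lemma jacobi: "br (br a b) w + br b (br a w) = br a (br b w)"
proof -
  have "((\<lambda>x. br (Ad x b) (Ad x w)) has_derivative (\<lambda>a. br (Ad 0 b) (br a w) + br (br a b) (Ad 0 w))) (at 0)"
  proof -
    have "bounded_bilinear br"
      unfolding bilinear_conv_bounded_bilinear[symmetric] bilinear_def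
      by (intro conjI allI linear_br_left linear_br_right)
    then show ?thesis
      by (rule bounded_bilinear.FDERIV[OF _ has_derivative_Ad_0 has_derivative_Ad_0])
  qed
  then have "((\<lambda>x. Ad x (br b w)) has_derivative (\<lambda>a. br b (br a w) + br (br a b) w)) (at 0)"
    by (simp add: br_Ad)
  then have "br b (br a w) + br (br a b) w = br a (br b w)"
    by (rule has_derivative_eqD[OF _ has_derivative_Ad_0]) simp
  then show ?thesis by (simp add: add.commute)
qed

text \<open>The form of the Jacobi identity that matches the derivation rule of
  \<open>prol_stratum\<close>, where all brackets are taken on the right.\<close>

lemma jacobi_right: "br u (br y z) = br (br u y) z - br (br u z) y"
proof -
  have "C = A - B'" if "A + B = C" "B = - B'" for A B B' C :: 'a using that by simp
  from this[OF jacobi br_anticomm] show ?thesis .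
qed

end

section \<open>One-parameter subgroups and the exponential map\<close>

context lie_group_rn begin

lemma linear_dinv: "linear (dinv x)"
  by (rule has_derivative_linear[OF has_derivative_inv])

text \<open>By \<open>dmul_quotient\<close> the quotient of the two curves has derivative
  zero.\<close>

lemma integral_curve_unique:
  assumes c: "\<And>t. (c has_vector_derivative field w (c t)) (at t)"
    and c': "\<And>t. (c' has_vector_derivative field w (c' t)) (at t)"
    and "c t0 = c' t0"
  shows "c t = c' t"
proof -
  have "((\<lambda>t. c t \<cdot> invr (c' t)) has_derivative (\<lambda>h. 0)) (at t)" for t
  proof -
    have "((\<lambda>t. c t \<cdot> invr (c' t)) has_derivative
        (\<lambda>h. dmul (c t, invr (c' t)) (h *\<^sub>R field w (c t), dinv (c' t) (h *\<^sub>R field w (c' t))))) (at t)"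
      by (intro has_derivative_mul_compose has_derivative_inv_compose
          c[unfolded has_vector_derivative_def] c'[unfolded has_vector_derivative_def])
    moreover have "dmul (c t, invr (c' t)) (h *\<^sub>R field w (c t), dinv (c' t) (h *\<^sub>R field w (c' t))) = 0" for h
    proof -
      have "(h *\<^sub>R field w (c t), dinv (c' t) (h *\<^sub>R field w (c' t)))
          = h *\<^sub>R (field w (c t), dinv (c' t) (field w (c' t)))"
        by (simp add: linear_cmul[OF linear_dinv])
      then show ?thesis by (simp only: dmul_simps dmul_quotient scaleR_zero_right)
    qed
    ultimately show ?thesis by simp
  qed
  then have "\<exists>k. \<forall>t\<in>UNIV. c t \<cdot> invr (c' t) = k"
    by (intro has_derivative_zero_constant) auto
  then obtain k where k: "\<And>t. c t \<cdot> invr (c' t) = k" by blast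
  have "k = 0" using k[of t0] assms(3) by simp
  then have "c t \<cdot> invr (c' t) \<cdot> c' t = c' t" using k by simp
  then show ?thesis by (simp add: G.assoc)
qed

lemma lie_exp_eqI:
  assumes "c 0 = 0" "\<And>t. (c has_vector_derivative field w (c t)) (at t)"
  shows "lie_exp gmul w = c 1"
  unfolding lie_exp_def
proof (rule the_equality)
  show "\<exists>c'. c' 0 = 0 \<and> (\<forall>t. (c' has_vector_derivative field w (c' t)) (at t)) \<and> c 1 = c' 1"
    using assms by (intro exI[of _ c]) simp
  fix p assume "\<exists>c'. c' 0 = 0 \<and> (\<forall>t. (c' has_vector_derivative field w (c' t)) (at t)) \<and> p = c' 1"
  then obtain c' where c': "c' 0 = 0" "\<And>t. (c' has_vector_derivative field w (c' t)) (at t)" "p = c' 1"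
    by (elim exE conjE) (rule that, assumption, erule spec, assumption)
  show "p = c 1"
    unfolding c'(3) by (rule integral_curve_unique[OF c'(2) assms(2), of 0]) (simp add: assms c')
qed

lemma lie_exp_0 [simp]: "lie_exp gmul 0 = 0"
  using lie_exp_eqI[of "\<lambda>_. 0" 0] by (simp add: field_linear)

text \<open>The line t w is then the one-parameter subgroup of \<open>w\<close>, so the exponential
  map is the identity on it. In coordinates of the second type the basis vectors have this property
  (\<open>b_axis_straight\<close>).\<close>

definition straight :: "'a \<Rightarrow> bool" where
  "straight w \<longleftrightarrow> (\<forall>t. field w (t *\<^sub>R w) = w)"

text \<open>As curves in \<open>u\<close>, both sides solve the equation of the field of
  \<open>w\<close> and agree at u = 0.\<close>

lemma straight_mul:
  assumes "straight w"
  shows "(t *\<^sub>R w) \<cdot> (u *\<^sub>R w) = (t + u) *\<^sub>R w"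
proof -
  have w: "field w (u *\<^sub>R w) = w" for u using assms by (simp add: straight_def)
  have "((\<lambda>u. (t *\<^sub>R w) \<cdot> (u *\<^sub>R w)) has_derivative (\<lambda>h. dmul (t *\<^sub>R w, u *\<^sub>R w) (0, h *\<^sub>R w))) (at u)" for u
    by (auto intro!: derivative_eq_intros)
  moreover have "dmul (t *\<^sub>R w, u *\<^sub>R w) (0, h *\<^sub>R w) = h *\<^sub>R field w ((t *\<^sub>R w) \<cdot> (u *\<^sub>R w))" for h u
    using left_invariant[of "t *\<^sub>R w" "u *\<^sub>R w" w] w dmul_simps(3)[of _ h "(0, w)"] by simp
  ultimately have c: "((\<lambda>u. (t *\<^sub>R w) \<cdot> (u *\<^sub>R w)) has_vector_derivative field w ((t *\<^sub>R w) \<cdot> (u *\<^sub>R w))) (at u)" for u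
    unfolding has_vector_derivative_def by simp
  have c': "((\<lambda>u. (t + u) *\<^sub>R w) has_vector_derivative field w ((t + u) *\<^sub>R w)) (at u)" for u
    unfolding w has_vector_derivative_def by (auto intro!: derivative_eq_intros)
  show ?thesis by (rule integral_curve_unique[OF c c', of 0]) simp
qed

text \<open>The subgroup property moves the differentiation from time \<open>t\<close> to the
  identity, where the derivative of \<open>Ad\<close> is the bracket.\<close>

lemma has_vector_derivative_Ad_straight:
  assumes "straight w"
  shows "((\<lambda>t. Ad (t *\<^sub>R w) v) has_vector_derivative Ad (t *\<^sub>R w) (br w v)) (at t)"
proof -
  have "((\<lambda>t. t *\<^sub>R w) has_derivative (\<lambda>h. h *\<^sub>R w)) (at 0)"
    by (auto intro!: derivative_eq_intros)
  from has_derivative_along[OF has_derivative_Ad_0 this]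
  have 1: "((\<lambda>t. Ad (t *\<^sub>R w) v) has_derivative (\<lambda>h. br (h *\<^sub>R w) v)) (at 0)" by simp
  have 2: "((\<lambda>u. u - t) has_derivative (\<lambda>h. h)) (at t)"
    by (auto intro!: derivative_eq_intros)
  have "((\<lambda>u. Ad (t *\<^sub>R w) (Ad ((u - t) *\<^sub>R w) v)) has_derivative (\<lambda>h. Ad (t *\<^sub>R w) (br (h *\<^sub>R w) v))) (at t)"
    by (rule has_derivative_compose[OF _ linear_imp_has_derivative[OF linear_Ad]],
        rule has_derivative_compose[OF 2, of "\<lambda>t. Ad (t *\<^sub>R w) v"]) (simp add: 1)
  moreover have "Ad (t *\<^sub>R w) (Ad ((u - t) *\<^sub>R w) v) = Ad (u *\<^sub>R w) v" for u
    by (simp add: Ad_mul[symmetric] straight_mul[OF assms])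
  ultimately show ?thesis
    unfolding has_vector_derivative_def by (simp add: br_simps Ad_simps)
qed

end

section \<open>Exponential coordinates of the second type\<close>

lemma ix_bij: "bij_betw ix {1..CARD('n)} (UNIV :: 'n::{finite,linorder} set)"
proof -
  let ?xs = "sorted_list_of_set (UNIV :: 'n set)"
  have "bij_betw ((!) ?xs) {..<length ?xs} (set ?xs)"
    by (rule bij_betw_nth) auto
  then have "bij_betw ((!) ?xs) {..<CARD('n)} UNIV" by simp
  moreover have "bij_betw (\<lambda>j. j - 1) {1..CARD('n)} {..<CARD('n)}"
    by (rule bij_betwI[where g=Suc]) auto
  ultimately have "bij_betw ((!) ?xs \<circ> (\<lambda>j. j - 1)) {1..CARD('n)} UNIV"
    by (rule bij_betw_trans[rotated])
  then show ?thesis by (rule bij_betw_cong[THEN iffD1, rotated]) (simp add: ix_def)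
qed

lemma ix_inject: "i \<in> {1..CARD('n)} \<Longrightarrow> j \<in> {1..CARD('n)} \<Longrightarrow>
    (ix i :: 'n::{finite,linorder}) = ix j \<longleftrightarrow> i = j"
  using bij_betw_imp_inj_on[OF ix_bij] by (rule inj_on_eq_iff)

lemma sum_coord: "(\<Sum>j=1..CARD('n). f (ix j)) = (\<Sum>l\<in>(UNIV::'n::{finite,linorder} set). f l)"
  by (rule sum.reindex_bij_betw[OF ix_bij])

lemma linear_coord: "linear (\<lambda>x. coord x j)"
  by (rule linearI) (simp_all add: coord_def)

lemma inner_coord: "x \<bullet> y = (\<Sum>j=1..CARD('n). coord x j * coord y j)"
  for x y :: "real ^ 'n::{finite,linorder}"
  unfolding coord_def sum_coord[where f="\<lambda>l. x $ l * y $ l"] by (simp add: inner_vec_def)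

lemma vec_coord_sum: "x = (\<Sum>j=1..CARD('n). coord x j *\<^sub>R axis (ix j) 1)"
  for x :: "real ^ 'n::{finite,linorder}"
  unfolding coord_def sum_coord[where f="\<lambda>l. x $ l *\<^sub>R axis l (1::real)"]
  by (simp add: scalar_mult_eq_scaleR[symmetric] basis_expansion)

lemma coord_axis: "i \<in> {1..CARD('n)} \<Longrightarrow> j \<in> {1..CARD('n)} \<Longrightarrow>
    coord (axis (ix j) t :: real ^ 'n::{finite,linorder}) i = (if i = j then t else 0)"
  unfolding coord_def axis_def using ix_inject[where ?'n='n] by auto

lemma scaleR_axis: "t *\<^sub>R axis i (1::real) = axis i t"
  by (simp add: vec_eq_iff axis_def)

locale exp_lie_group = lie_group_rn gmul invr
  for gmul :: "real ^ 'n::{finite,linorder} \<Rightarrow> (real, 'n) vec \<Rightarrow> (real, 'n) vec"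
    and invr :: "(real, 'n) vec \<Rightarrow> (real, 'n) vec" +
  fixes b :: "nat \<Rightarrow> (real, 'n) vec"
  assumes exp_coords: "exp_coords_second_type gmul b"
begin

lemma foldr_mul_append: "foldr gmul (xs @ ys) 0 = foldr gmul xs 0 \<cdot> foldr gmul ys 0"
  by (induction xs) (simp_all add: G.assoc)

text \<open>In the coordinate formula for a point of the j-th axis all factors but one are
  exponentials of 0.\<close>

lemma lie_exp_axis:
  assumes "j \<in> {1..CARD('n)}"
  shows "lie_exp gmul (t *\<^sub>R b j) = axis (ix j) t"
proof -
  let ?x = "axis (ix j) t :: (real, 'n) vec"
  let ?f = "\<lambda>i. lie_exp gmul (coord ?x i *\<^sub>R b i)"
  have z: "foldr gmul (map ?f js) 0 = 0" if "set js \<subseteq> {1..CARD('n)} - {j}" for js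
    using that assms by (induction js) (auto simp: coord_axis)
  have "rev [1..<Suc CARD('n)] = rev [Suc j..<Suc CARD('n)] @ j # rev [1..<j]"
  proof -
    have "[1..<Suc CARD('n)] = [1..<j] @ [j..<Suc CARD('n)]"
      using assms upt_add_eq_append[of 1 j "Suc CARD('n) - j"] by auto
    also have "[j..<Suc CARD('n)] = j # [Suc j..<Suc CARD('n)]"
      using assms by (intro upt_conv_Cons) auto
    finally show ?thesis by simp
  qed
  moreover have "?x = foldr gmul (map ?f (rev [1..<Suc CARD('n)])) 0"
    using exp_coords unfolding exp_coords_second_type_def by blast
  ultimately have "?x = foldr gmul (map ?f (rev [Suc j..<Suc CARD('n)])) 0 \<cdot> (?f j \<cdot> foldr gmul (map ?f (rev [1..<j])) 0)"
    by (simp only: map_append list.map foldr_mul_append foldr.simps o_apply)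
  then show ?thesis using assms by (simp add: z subset_iff coord_axis del: upt_Suc)
qed

text \<open>\<open>lie_exp\<close> is an unspecified constant at vectors without integral curve; since
  \<open>t \<mapsto> lie_exp (t b\<^sub>j)\<close> is injective, this can happen for at most one \<open>t\<close>.\<close>

lemma integral_curve_exists:
  assumes "j \<in> {1..CARD('n)}"
  obtains c where "c 0 = 0" "\<And>t. (c has_vector_derivative field (b j) (c t)) (at t)"
proof -
  define P where "P t = (\<lambda>c. c 0 = 0 \<and> (\<forall>\<tau>. (c has_vector_derivative field (t *\<^sub>R b j) (c \<tau>)) (at \<tau>)))" for t :: real
  have junk: "axis (ix j) t = (THE p::(real, 'n) vec. False)" if "\<And>c. \<not> P t c" for t
  proof -
    have "lie_exp gmul (t *\<^sub>R b j) = (THE p. \<exists>c. P t c \<and> p = c 1)"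
      unfolding lie_exp_def P_def by (simp only: conj_assoc)
    then show ?thesis using lie_exp_axis[OF assms, of t] that by simp
  qed
  have ne: "(axis (ix j) 1 :: (real, 'n) vec) \<noteq> axis (ix j) 2"
    by (simp add: axis_eq_axis)
  obtain t :: real where t0: "t \<noteq> 0" and ex: "\<exists>c. P t c"
  proof (cases "\<exists>c. P 1 c")
    case True
    then show ?thesis by (rule that[rotated]) simp
  next
    case False
    have "\<exists>c. P 2 c"
    proof (rule ccontr)
      assume "\<nexists>c. P 2 c"
      with junk[of 2] have "axis (ix j) 2 = (THE p::(real, 'n) vec. False)" by iprover
      moreover from False junk[of 1] have "axis (ix j) 1 = (THE p::(real, 'n) vec. False)" by iprover
      ultimately show False using ne by simp
    qed
    then show ?thesis by (rule that[rotated]) simp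
  qed
  from ex obtain c where t2: "P t c" by (rule exE)
  have c0: "c 0 = 0" using t2 unfolding P_def by (rule conjunct1)
  have "\<forall>\<tau>. (c has_vector_derivative field (t *\<^sub>R b j) (c \<tau>)) (at \<tau>)"
    using t2 unfolding P_def by (rule conjunct2)
  then have cd: "(c has_vector_derivative field (t *\<^sub>R b j) (c \<tau>)) (at \<tau>)" for \<tau>
    by (rule spec)
  have d: "((\<lambda>\<tau>. c (\<tau> / t)) has_vector_derivative field (b j) (c (\<tau> / t))) (at \<tau>)" for \<tau>
  proof -
    have "((\<lambda>\<tau>. \<tau> / t) has_vector_derivative 1 / t) (at \<tau>)"
      unfolding has_real_derivative_iff_has_vector_derivative[symmetric]
      by (auto intro!: derivative_eq_intros simp: t0)
    from vector_diff_chain_at[OF this cd]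
    have "((\<lambda>\<tau>. c (\<tau> / t)) has_vector_derivative (1 / t) *\<^sub>R field (t *\<^sub>R b j) (c (\<tau> / t))) (at \<tau>)"
      by (simp add: o_def)
    then show "((\<lambda>\<tau>. c (\<tau> / t)) has_vector_derivative field (b j) (c (\<tau> / t))) (at \<tau>)"
      using t0 by (simp add: field_linear)
  qed
  show ?thesis by (rule that[OF _ d]) (simp add: c0)
qed

text \<open>Rescaling time shows that the integral curve \<open>c\<close> of \<open>b j\<close> is
  at \<open>lie_exp gmul (t *\<^sub>R b j)\<close> at time \<open>t\<close>. By
  \<open>lie_exp_axis\<close> this point lies on the coordinate axis, so \<open>c\<close> is that
  axis run through with unit speed.\<close>

lemma b_axis_straight:
  assumes j: "j \<in> {1..CARD('n)}"
  shows "b j = axis (ix j) 1 \<and> straight (b j)"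
proof -
  obtain c where c: "c 0 = 0" "\<And>t. (c has_vector_derivative field (b j) (c t)) (at t)"
    by (rule integral_curve_exists[OF j]) (rule that; assumption)
  have ct: "c t = axis (ix j) t" for t
  proof -
    have "lie_exp gmul (t *\<^sub>R b j) = (\<lambda>\<tau>. c (t * \<tau>)) 1"
    proof (rule lie_exp_eqI)
      fix \<tau>
      have "((\<lambda>\<tau>. t * \<tau>) has_vector_derivative t) (at \<tau>)"
        unfolding has_real_derivative_iff_has_vector_derivative[symmetric]
        by (auto intro!: derivative_eq_intros)
      from vector_diff_chain_at[OF this c(2)]
      have "((\<lambda>\<tau>. c (t * \<tau>)) has_vector_derivative t *\<^sub>R field (b j) (c (t * \<tau>))) (at \<tau>)"
        by (simp add: o_def)
      then show "((\<lambda>\<tau>. c (t * \<tau>)) has_vector_derivative field (t *\<^sub>R b j) (c (t * \<tau>))) (at \<tau>)"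
        by (simp add: field_linear)
    qed (simp add: c)
    then show ?thesis using lie_exp_axis[OF j] by simp
  qed
  have d: "(c has_vector_derivative axis (ix j) 1) (at t)" for t
  proof -
    have "((\<lambda>t. t *\<^sub>R axis (ix j) 1 :: (real, 'n) vec) has_vector_derivative axis (ix j) 1) (at t)"
      unfolding has_vector_derivative_def by (auto intro!: derivative_eq_intros)
    moreover have "c = (\<lambda>t. t *\<^sub>R axis (ix j) 1)" by (rule ext) (simp add: ct scaleR_axis)
    ultimately show ?thesis by simp
  qed
  have f: "field (b j) (c t) = axis (ix j) 1" for t
    by (rule vector_derivative_unique_at[OF c(2) d])
  have b: "b j = axis (ix j) 1" using f[of 0] c(1) by simp
  then show ?thesis using f unfolding straight_def ct by (simp add: scaleR_axis)
qed

lemmas b_axis = b_axis_straight[THEN conjunct1]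
  and b_straight = b_axis_straight[THEN conjunct2]

lemma coord_b: "i \<in> {1..CARD('n)} \<Longrightarrow> j \<in> {1..CARD('n)} \<Longrightarrow> coord (b j) i = (if i = j then 1 else 0)"
  by (simp add: b_axis coord_axis)

lemma coord_sum_b: "(\<Sum>j=1..CARD('n). coord x j *\<^sub>R b j) = x"
  unfolding vec_coord_sum[of x, symmetric]
  by (subst (2) vec_coord_sum) (simp add: b_axis)

text \<open>The factors with index below \<open>i\<close>, which stand at the right end of the
  coordinate product. Exponentials are not written because basis vectors are straight.\<close>

definition partial_prod :: "(real, 'n) vec \<Rightarrow> nat \<Rightarrow> (real, 'n) vec" where
  "partial_prod x i = foldr gmul (map (\<lambda>j. coord x j *\<^sub>R b j) (rev [1..<i])) 0"

lemma partial_prod_1 [simp]: "partial_prod x (Suc 0) = 0"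
  by (simp add: partial_prod_def)

lemma partial_prod_Suc: "1 \<le> i \<Longrightarrow> partial_prod x (Suc i) = (coord x i *\<^sub>R b i) \<cdot> partial_prod x i"
  by (simp add: partial_prod_def)

lemma partial_prod_cong:
  "(\<And>j. 1 \<le> j \<Longrightarrow> j < i \<Longrightarrow> coord x j = coord y j) \<Longrightarrow> partial_prod x i = partial_prod y i"
  unfolding partial_prod_def by (intro arg_cong[where f="\<lambda>l. foldr gmul l 0"] map_cong) auto

lemma partial_prod_full: "partial_prod x (Suc CARD('n)) = x"
proof -
  have lin: "lie_exp gmul (coord x j *\<^sub>R b j) = coord x j *\<^sub>R b j" if "j \<in> {1..CARD('n)}" for j
    unfolding lie_exp_axis[OF that] by (simp only: b_axis[OF that] scaleR_axis)
  have "x = foldr gmul (map (\<lambda>j. lie_exp gmul (coord x j *\<^sub>R b j)) (rev [1..<Suc CARD('n)])) 0"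
    using exp_coords unfolding exp_coords_second_type_def by blast
  also have "\<dots> = partial_prod x (Suc CARD('n))"
    unfolding partial_prod_def
    by (intro arg_cong[where f="\<lambda>l. foldr gmul l 0"] map_cong refl lin) auto
  finally show ?thesis by simp
qed

text \<open>Increasing the i-th coordinate by \<epsilon> inserts the factor \<epsilon> b_i just to
  the left of \<open>partial_prod x i\<close>; moving it to the right end conjugates it by that
  product.\<close>

lemma partial_prod_shift:
  assumes i: "1 \<le> i" and k: "i < k" and kn: "k \<le> Suc CARD('n)"
  shows "partial_prod (x + \<epsilon> *\<^sub>R b i) k
    = partial_prod x k \<cdot> (invr (partial_prod x i) \<cdot> (\<epsilon> *\<^sub>R b i) \<cdot> partial_prod x i)"
proof -
  have co: "coord (x + \<epsilon> *\<^sub>R b i) j = (if j = i then coord x j + \<epsilon> else coord x j)"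
    if "1 \<le> j" "j < k" for j
    using coord_b[of j i] that i k kn by (auto simp: coord_def)
  show ?thesis using k kn co
  proof (induction k)
    case (Suc k)
    show ?case
    proof (cases "k = i")
      case True
      have "partial_prod (x + \<epsilon> *\<^sub>R b i) i = partial_prod x i"
        by (rule partial_prod_cong) (use Suc.prems True in auto)
      moreover have "coord (x + \<epsilon> *\<^sub>R b i) i = coord x i + \<epsilon>"
        using Suc.prems(3)[of i] i True by simp
      moreover have "(coord x i + \<epsilon>) *\<^sub>R b i = (coord x i *\<^sub>R b i) \<cdot> (\<epsilon> *\<^sub>R b i)"
        using straight_mul[OF b_straight] i True Suc.prems by simp
      moreover have "p \<cdot> e \<cdot> q = p \<cdot> q \<cdot> (invr q \<cdot> e \<cdot> q)" for p e q
      proof -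
        have "p \<cdot> q \<cdot> (invr q \<cdot> e \<cdot> q) = p \<cdot> (q \<cdot> invr q) \<cdot> e \<cdot> q" by (simp only: G.assoc)
        then show ?thesis by simp
      qed
      ultimately show ?thesis using i True by (simp only: partial_prod_Suc)
    next
      case False
      then have "i < k" using Suc.prems by simp
      moreover have "coord (x + \<epsilon> *\<^sub>R b i) k = coord x k"
        using Suc.prems(3)[of k] i calculation by simp
      ultimately show ?thesis using Suc i by (simp add: partial_prod_Suc G.assoc)
    qed
  qed simp
qed

text \<open>\<open>partial_prod_shift\<close> for the full product, differentiated at \<epsilon> =
  0: the i-th coordinate direction at \<open>x\<close> is the value of a left-invariant
  field.\<close>

lemma field_partial_prod:
  assumes i: "i \<in> {1..CARD('n)}"
  shows "field (Ad (invr (partial_prod x i)) (b i)) x = b i"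
proof -
  let ?p = "partial_prod x i"
  have eq: "x + \<epsilon> *\<^sub>R b i = x \<cdot> (invr ?p \<cdot> (\<epsilon> *\<^sub>R b i) \<cdot> ?p)" for \<epsilon>
    using partial_prod_shift[of i "Suc CARD('n)" x \<epsilon>] i by (simp add: partial_prod_full)
  have e: "((\<lambda>\<epsilon>. \<epsilon> *\<^sub>R b i) has_derivative (\<lambda>h. h *\<^sub>R b i)) (at 0)"
    by (auto intro!: derivative_eq_intros)
  have m: "((\<lambda>z. x \<cdot> z) has_derivative (\<lambda>w. field w x)) (at 0)"
    by (auto intro!: derivative_eq_intros simp: field_eq)
  have c: "((\<lambda>z. invr ?p \<cdot> z \<cdot> ?p) has_derivative Ad (invr ?p)) (at 0)"
    using has_derivative_conj[of "invr ?p"] by simp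
  have "((\<lambda>\<epsilon>. x \<cdot> (invr ?p \<cdot> (\<epsilon> *\<^sub>R b i) \<cdot> ?p)) has_derivative (\<lambda>h. field (Ad (invr ?p) (h *\<^sub>R b i)) x)) (at 0)"
    by (rule has_derivative_along[OF m has_derivative_along[OF c e]]) simp_all
  moreover have "((\<lambda>\<epsilon>. x + \<epsilon> *\<^sub>R b i) has_derivative (\<lambda>h. h *\<^sub>R b i)) (at 0)"
    by (auto intro!: derivative_eq_intros)
  ultimately have "(\<lambda>h. field (Ad (invr ?p) (h *\<^sub>R b i)) x) 1 = (\<lambda>h. h *\<^sub>R b i) (1::real)"
    by (rule has_derivative_eqD) (simp add: eq)
  then show ?thesis by simp
qed

text \<open>The Maurer-Cartan form, which recovers a left-invariant field from its value at
  \<open>x\<close>. The explicit shape comes from the coordinate directions in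
  \<open>field_partial_prod\<close>.\<close>

definition field_inverse :: "(real, 'n) vec \<Rightarrow> (real, 'n) vec \<Rightarrow> (real, 'n) vec" where
  "field_inverse x d = (\<Sum>j=1..CARD('n). coord d j *\<^sub>R Ad (invr (partial_prod x j)) (b j))"

lemma field_field_inverse: "field (field_inverse x d) x = d"
  unfolding field_inverse_def
  by (simp add: field_linear field_partial_prod coord_sum_b[simplified])

lemma field_inverse_field: "field_inverse x (field w x) = w"
  by (rule field_inj[where x=x]) (rule field_field_inverse)

end

section \<open>One-parameter flows on the prolongation\<close>

lemma exp_coeff_derivative:
  "((\<lambda>t. (- t) ^ k / fact k) has_real_derivative
     (if k = 0 then 0 else - ((- t) ^ (k - 1) / fact (k - 1)))) (at t)"
proof (cases k)
  case (Suc j)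
  have "((\<lambda>t. (- t) ^ Suc j / fact (Suc j)) has_real_derivative
      (of_nat (Suc j) * (- 1 * (- t) ^ j)) / fact (Suc j)) (at t)"
    by (rule DERIV_cdivide) (rule derivative_eq_intros refl | simp)+
  also have "(of_nat (Suc j) * (- 1 * (- t) ^ j)) / fact (Suc j) = - ((- t) ^ j / fact j)"
    by (simp add: fact_Suc del: of_nat_Suc)
  finally show ?thesis using Suc by simp
qed simp

text \<open>Differentiating a truncated exponential series shifts its terms by one place. The
  vanishing of \<open>a N\<close> accounts for the last term, which the shift would miss.\<close>

lemma sum_scaleR_shift:
  fixes a :: "nat \<Rightarrow> 'b::real_vector" and c :: "nat \<Rightarrow> real"
  assumes "a N = 0"
  shows "(\<Sum>k<N. (if k = 0 then 0 else - c (k - 1)) *\<^sub>R a k) = - (\<Sum>k<N. c k *\<^sub>R a (Suc k))"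
proof (cases N)
  case (Suc M)
  have "(\<Sum>k<Suc M. (if k = 0 then 0 else - c (k - 1)) *\<^sub>R a k) = (\<Sum>k<M. - c k *\<^sub>R a (Suc k))"
    by (simp add: sum.lessThan_Suc_shift del: sum.lessThan_Suc)
  then show ?thesis using assms Suc by (simp add: sum_negf)
qed simp

text \<open>A bracket with \<open>w\<close> on the right is -ad w, hence the powers of -t.\<close>

definition flow :: "nat \<Rightarrow> real \<Rightarrow> 'a::real_vector \<Rightarrow> 'a prol \<Rightarrow> 'a prol" where
  "flow N t w u = (\<lambda>Ys. \<Sum>k<N. ((- t) ^ k / fact k) *\<^sub>R u (replicate k w @ Ys))"

lemma flow_0: "0 < N \<Longrightarrow> flow N 0 w u = u"
  by (cases N) (simp_all add: flow_def sum.lessThan_Suc_shift del: sum.lessThan_Suc)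

context lie_group_rn begin

text \<open>A coded map is a linear map from the universal enveloping algebra, truncated at degree \<open>N\<close>,
  to the Lie algebra. For \<open>u\<close> in the prolongation \<open>flow N t w u\<close> is \<open>exp (t ad w) u\<close>.\<close>

definition coded :: "nat \<Rightarrow> 'a prol \<Rightarrow> bool" where
  "coded N u \<longleftrightarrow> (\<forall>Ys Zs. linear (\<lambda>Y. u (Ys @ Y # Zs))) \<and>
     (\<forall>Ys Y Z Zs. u (Ys @ br Y Z # Zs) = u (Ys @ Y # Z # Zs) - u (Ys @ Z # Y # Zs)) \<and>
     (\<forall>Ys. N \<le> length Ys \<longrightarrow> u Ys = 0)"

lemma coded_linear: "coded N u \<Longrightarrow> linear (\<lambda>Y. u (Ys @ Y # Zs))"
  and coded_br: "coded N u \<Longrightarrow> u (Ys @ br Y Z # Zs) = u (Ys @ Y # Z # Zs) - u (Ys @ Z # Y # Zs)"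
  and coded_long: "coded N u \<Longrightarrow> N \<le> length Ys \<Longrightarrow> u Ys = 0"
  unfolding coded_def by simp_all

lemma coded_linear_Cons: "coded N u \<Longrightarrow> linear (\<lambda>Y. u (Y # Zs))"
  using coded_linear[of N u "[]" Zs] by simp

lemma coded_mono: "coded M u \<Longrightarrow> M \<le> N \<Longrightarrow> coded N u"
  unfolding coded_def by auto

lemma coded_prol_bracket:
  assumes "coded N u"
  shows "coded (N - 1) (prol_bracket u Z)"
  unfolding coded_def prol_bracket_def
proof (intro conjI allI impI)
  fix Ys Zs
  show "linear (\<lambda>Y. u (Z # Ys @ Y # Zs))"
    using coded_linear[OF assms, of "Z # Ys" Zs] by simp
next
  fix Ys Y Y' Zs
  show "u (Z # Ys @ br Y Y' # Zs) = u (Z # Ys @ Y # Y' # Zs) - u (Z # Ys @ Y' # Y # Zs)"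
    using coded_br[OF assms, of "Z # Ys" Y Y' Zs] by simp
next
  fix Ys :: "'a list" assume "N - 1 \<le> length Ys"
  then show "u (Z # Ys) = 0" by (intro coded_long[OF assms]) auto
qed

lemma coded_prol_bracket': "coded N u \<Longrightarrow> coded N (prol_bracket u Z)"
  using coded_prol_bracket coded_mono diff_le_self by blast

lemma coded_flow:
  assumes "coded N u"
  shows "coded N (flow M t w u)"
  unfolding coded_def flow_def
proof (intro conjI allI impI)
  fix Ys Zs
  have "linear (\<lambda>Y. u ((replicate k w @ Ys) @ Y # Zs))" for k by (rule coded_linear[OF assms])
  then have "linear (\<lambda>Y. ((- t) ^ k / fact k) *\<^sub>R u (replicate k w @ Ys @ Y # Zs))" for k
    by (intro linear_compose_scale_right) simp
  then show "linear (\<lambda>Y. \<Sum>k<M. ((- t) ^ k / fact k) *\<^sub>R u (replicate k w @ Ys @ Y # Zs))"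
    by (intro linear_compose_sum) blast
next
  fix Ys Y Y' Zs
  have "u (replicate k w @ Ys @ br Y Y' # Zs)
      = u (replicate k w @ Ys @ Y # Y' # Zs) - u (replicate k w @ Ys @ Y' # Y # Zs)" for k
    using coded_br[OF assms, of "replicate k w @ Ys" Y Y' Zs] by simp
  then show "(\<Sum>k<M. ((- t) ^ k / fact k) *\<^sub>R u (replicate k w @ Ys @ br Y Y' # Zs))
     = (\<Sum>k<M. ((- t) ^ k / fact k) *\<^sub>R u (replicate k w @ Ys @ Y # Y' # Zs))
     - (\<Sum>k<M. ((- t) ^ k / fact k) *\<^sub>R u (replicate k w @ Ys @ Y' # Y # Zs))"
    by (simp add: scaleR_diff_right sum_subtractf)
next
  fix Ys :: "'a list" assume "N \<le> length Ys"
  then show "(\<Sum>k<M. ((- t) ^ k / fact k) *\<^sub>R u (replicate k w @ Ys)) = 0"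
    by (intro sum.neutral ballI) (simp add: coded_long[OF assms])
qed

text \<open>A product rule in which the time \<open>p x\<close> and the element \<open>v x\<close>
  both move. Assumption \<open>z\<close> closes the series after differentiation in time, so that
  this term is again a flow.\<close>

lemma flow_has_derivative:
  assumes u: "\<And>k. k \<le> N \<Longrightarrow> ((\<lambda>x. v x (replicate k w @ Ys)) has_derivative v' k) (at a)"
    and p: "(p has_derivative p') (at a)"
    and z: "v a (replicate N w @ Ys) = 0"
  shows "((\<lambda>x. flow N (p x) w (v x) Ys) has_derivative
     (\<lambda>d. (\<Sum>k<N. ((- p a) ^ k / fact k) *\<^sub>R v' k d)
        - p' d *\<^sub>R flow N (p a) w (prol_bracket (v a) w) Ys)) (at a)"
proof -
  define c where "c k t = ((- t) ^ k / fact k :: real)" for k t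
  define c' where "c' k t = (if k = 0 then 0 else - ((- t) ^ (k - 1) / fact (k - 1)) :: real)" for k t
  have c: "((\<lambda>x. c k (p x)) has_derivative (\<lambda>d. p' d * c' k (p a))) (at a)" for k
  proof -
    have "(c k has_derivative (\<lambda>h. h * c' k (p a))) (at (p a))"
      unfolding c_def[abs_def] c'_def
      by (rule has_derivative_eq_rhs[OF exp_coeff_derivative[unfolded has_field_derivative_def]])
         (rule ext, rule mult.commute)
    from has_derivative_compose[OF p this] show ?thesis .
  qed
  have "((\<lambda>x. \<Sum>k<N. c k (p x) *\<^sub>R v x (replicate k w @ Ys)) has_derivative
     (\<lambda>d. \<Sum>k<N. c k (p a) *\<^sub>R v' k d + (p' d * c' k (p a)) *\<^sub>R v a (replicate k w @ Ys))) (at a)"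
    by (intro has_derivative_sum has_derivative_scaleR c u) simp
  moreover have "(\<Sum>k<N. c k (p a) *\<^sub>R v' k d + (p' d * c' k (p a)) *\<^sub>R v a (replicate k w @ Ys))
     = (\<Sum>k<N. c k (p a) *\<^sub>R v' k d) - p' d *\<^sub>R flow N (p a) w (prol_bracket (v a) w) Ys" for d
  proof -
    have "(\<Sum>k<N. c' k (p a) *\<^sub>R v a (replicate k w @ Ys))
        = - (\<Sum>k<N. c k (p a) *\<^sub>R v a (replicate (Suc k) w @ Ys))"
      unfolding c'_def c_def[symmetric] by (rule sum_scaleR_shift) (rule z)
    then have "(\<Sum>k<N. (p' d * c' k (p a)) *\<^sub>R v a (replicate k w @ Ys))
        = p' d *\<^sub>R - (\<Sum>k<N. c k (p a) *\<^sub>R v a (replicate (Suc k) w @ Ys))"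
      by (simp only: scaleR_scaleR[symmetric] scaleR_sum_right[symmetric])
    then show ?thesis
      by (simp add: sum.distrib flow_def prol_bracket_def c_def)
  qed
  ultimately have "((\<lambda>x. \<Sum>k<N. c k (p x) *\<^sub>R v x (replicate k w @ Ys)) has_derivative
     (\<lambda>d. (\<Sum>k<N. c k (p a) *\<^sub>R v' k d) - p' d *\<^sub>R flow N (p a) w (prol_bracket (v a) w) Ys)) (at a)"
    by (simp only:)
  moreover have "(\<lambda>x. \<Sum>k<N. c k (p x) *\<^sub>R v x (replicate k w @ Ys)) = (\<lambda>x. flow N (p x) w (v x) Ys)"
    by (simp only: flow_def c_def)
  ultimately show ?thesis unfolding c_def by (simp only:)
qed

lemma flow_diff:
  "(\<And>k. v (replicate k w @ Ys) = v1 (replicate k w @ Ys) - v2 (replicate k w @ Ys)) \<Longrightarrow>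
   flow N t w v Ys = flow N t w v1 Ys - flow N t w v2 Ys"
  by (simp add: flow_def scaleR_diff_right sum_subtractf)

lemma equal_derivative_imp_eq:
  fixes f g :: "real \<Rightarrow> 'b::real_inner"
  assumes "\<And>t. (f has_derivative D t) (at t)" "\<And>t. (g has_derivative D t) (at t)" "f 0 = g 0"
  shows "f t = g t"
proof -
  have "((\<lambda>t. f t - g t) has_derivative (\<lambda>h. 0)) (at t)" for t
    using has_derivative_diff[OF assms(1,2), of t] by simp
  then have "\<exists>k. \<forall>t\<in>UNIV. f t - g t = k"
    by (intro has_derivative_zero_constant) auto
  then show ?thesis using assms(3) by (metis UNIV_I eq_iff_diff_eq_0)
qed

text \<open>Compatibility of exp (t ad w) with brackets. Both sides agree at t = 0, and by the
  derivation rule they have the same derivative once the identity is known for [u, w] with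
  \<open>Z\<close> and for \<open>u\<close> with [w, Z]. The first has a smaller truncation order
  \<open>M\<close>, the second a smaller nilpotency order \<open>K\<close>, hence the induction on M
  + K.\<close>

lemma flow_prol_bracket:
  assumes w: "straight w" and "0 < N"
    and "coded M u" "M \<le> N" and "(br w ^^ K) Z = 0"
  shows "flow N t w (prol_bracket u Z) Ys = flow N t w u (Ad (t *\<^sub>R w) Z # Ys)"
  using assms(3-)
proof (induction "M + K" arbitrary: M K u Z t Ys rule: less_induct)
  case less
  have cu: "coded N u" using coded_mono less.prems by blast
  consider "M = 0" | "K = 0" | "0 < M" "0 < K" by blast
  then show ?case
  proof cases
    case 1
    then have "u = (\<lambda>_. 0)" using coded_long[OF less.prems(1)] by auto
    then show ?thesis by (simp add: flow_def prol_bracket_def)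
  next
    case 2
    then have "Z = 0" using less.prems by simp
    then show ?thesis
      using linear_0[OF coded_linear_Cons[OF coded_flow[OF cu]]]
        linear_0[OF coded_linear_Cons[OF cu]]
      by (simp add: flow_def prol_bracket_def Ad_simps)
  next
    case 3
    let ?A = "\<lambda>t. Ad (t *\<^sub>R w)"
    have f: "((\<lambda>t. flow N t w (prol_bracket u Z) Ys) has_derivative
        (\<lambda>h. - (h *\<^sub>R flow N t w (prol_bracket (prol_bracket u Z) w) Ys))) (at t)" for t
    proof -
      have "prol_bracket u Z (replicate N w @ Ys) = 0"
        by (rule coded_long[OF coded_prol_bracket'[OF cu]]) simp
      from flow_has_derivative[where v="\<lambda>_. prol_bracket u Z" and v'="\<lambda>_ _. 0" and p="\<lambda>t. t" and p'="\<lambda>h. h",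
          OF has_derivative_const has_derivative_ident this]
      show ?thesis by simp
    qed
    have v: "((\<lambda>t. u (replicate k w @ ?A t Z # Ys)) has_derivative
        (\<lambda>h. h *\<^sub>R u (replicate k w @ ?A t (br w Z) # Ys))) (at t)" for k t
      using has_derivative_compose[OF has_vector_derivative_Ad_straight[OF w, unfolded has_vector_derivative_def]
          linear_imp_has_derivative[OF coded_linear[OF cu, of "replicate k w" Ys]], of Z t]
      by (simp add: linear_cmul[OF coded_linear[OF cu]])
    have g: "((\<lambda>t. flow N t w u (?A t Z # Ys)) has_derivative
        (\<lambda>h. h *\<^sub>R flow N t w u (?A t (br w Z) # Ys) - h *\<^sub>R flow N t w (prol_bracket u w) (?A t Z # Ys))) (at t)" for t
    proof -
      define v where "v \<tau> Xs = u (Xs @ ?A \<tau> Z # Ys)" for \<tau> Xs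
      have z: "v t (replicate N w @ []) = 0"
        unfolding v_def by (rule coded_long[OF cu]) simp
      have dv: "((\<lambda>\<tau>. v \<tau> (replicate k w @ [])) has_derivative
        (\<lambda>h. h *\<^sub>R u (replicate k w @ ?A t (br w Z) # Ys))) (at t)" for k
        unfolding v_def using \<open>\<And>k t. ((\<lambda>t. u (replicate k w @ ?A t Z # Ys)) has_derivative
        (\<lambda>h. h *\<^sub>R u (replicate k w @ ?A t (br w Z) # Ys))) (at t)\<close> by simp
      have "flow N \<tau> w (v \<tau>) [] = flow N \<tau> w u (?A \<tau> Z # Ys)" for \<tau>
        by (simp add: flow_def v_def)
      moreover have "flow N t w (prol_bracket (v t) w) [] = flow N t w (prol_bracket u w) (?A t Z # Ys)"
        by (simp add: flow_def v_def prol_bracket_def)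
      moreover have "(\<Sum>k<N. ((- t) ^ k / fact k) *\<^sub>R h *\<^sub>R u (replicate k w @ ?A t (br w Z) # Ys))
          = h *\<^sub>R flow N t w u (?A t (br w Z) # Ys)" for h
        by (simp add: flow_def scaleR_sum_right mult.commute)
      ultimately show ?thesis
        using flow_has_derivative[where v=v and a=t and w=w and Ys="[]" and N=N and p="\<lambda>t. t" and p'="\<lambda>h. h"
            and v'="\<lambda>k h. h *\<^sub>R u (replicate k w @ ?A t (br w Z) # Ys)", OF dv has_derivative_ident z]
        by (simp only:)
    qed
    have 1: "flow N t w (prol_bracket u w) (?A t Z # Ys) = flow N t w (prol_bracket (prol_bracket u w) Z) Ys" for t
      by (rule less.hyps[of "M - 1" K, symmetric]) (use 3 less.prems coded_prol_bracket in auto)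
    have 2: "flow N t w u (?A t (br w Z) # Ys) = flow N t w (prol_bracket u (br w Z)) Ys" for t
    proof (rule less.hyps[of M "K - 1", symmetric])
      show "(br w ^^ (K - 1)) (br w Z) = 0"
        using less.prems(3) 3 by (metis Suc_pred' comp_apply funpow_Suc_right)
    qed (use 3 less.prems in auto)
    have 3: "flow N t w (prol_bracket u (br w Z)) Ys
        = flow N t w (prol_bracket (prol_bracket u w) Z) Ys - flow N t w (prol_bracket (prol_bracket u Z) w) Ys" for t
    proof (rule flow_diff)
      fix k
      show "prol_bracket u (br w Z) (replicate k w @ Ys)
        = prol_bracket (prol_bracket u w) Z (replicate k w @ Ys)
        - prol_bracket (prol_bracket u Z) w (replicate k w @ Ys)"
        using coded_br[OF cu, of "[]" w Z] by (simp add: prol_bracket_def)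
    qed
    have g': "((\<lambda>t. flow N t w u (?A t Z # Ys)) has_derivative
        (\<lambda>h. - (h *\<^sub>R flow N t w (prol_bracket (prol_bracket u Z) w) Ys))) (at t)" for t
      using g[of t] unfolding 1 2 3 by (simp add: scaleR_diff_right)
    show ?thesis
      by (rule equal_derivative_imp_eq[OF f g']) (simp add: flow_0[OF \<open>0 < N\<close>] prol_bracket_def)
  qed
qed

lemma foldl_replicate_br: "foldl br v (replicate k w) = (- 1) ^ k *\<^sub>R (br w ^^ k) v"
proof (induction k)
  case (Suc k)
  have "foldl br v (replicate (Suc k) w) = br (foldl br v (replicate k w)) w"
  proof -
    have "replicate (Suc k) w = replicate k w @ [w]" by (simp add: replicate_append_same)
    then show ?thesis by (simp del: replicate.simps)
  qed
  also have "\<dots> = - br w ((- 1) ^ k *\<^sub>R (br w ^^ k) v)"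
    unfolding Suc by (rule br_anticomm)
  finally show ?case by (simp add: br_simps)
qed simp

lemma foldl_br_linear: "linear (\<lambda>v. foldl br v Ys)"
proof (induction Ys)
  case (Cons Y Ys)
  from linear_compose[OF linear_br_left Cons] show ?case by (simp add: o_def)
qed (simp add: linear_id[unfolded id_def])

lemma coded_embed:
  assumes "\<And>Ys v. N \<le> length Ys \<Longrightarrow> foldl br v Ys = 0"
  shows "coded N (prol_embed br v)"
  unfolding coded_def prol_embed_def
proof (intro conjI allI impI)
  fix Ys Zs
  show "linear (\<lambda>Y. foldl br v (Ys @ Y # Zs))"
    using linear_compose[OF linear_br_right foldl_br_linear] by (simp add: o_def)
  fix Y Z
  show "foldl br v (Ys @ br Y Z # Zs) = foldl br v (Ys @ Y # Z # Zs) - foldl br v (Ys @ Z # Y # Zs)"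
    by (simp add: jacobi_right linear_diff[OF foldl_br_linear])
qed (rule assms)

text \<open>Both sides agree at t = 0 and have the same derivative by the induction hypothesis for
  \<open>br w v\<close>, whose nilpotency order is one less.\<close>

lemma Ad_straight:
  assumes w: "straight w" and K: "(br w ^^ K) v = 0"
  shows "Ad (t *\<^sub>R w) v = (\<Sum>k<K. (t ^ k / fact k) *\<^sub>R (br w ^^ k) v)"
  using K
proof (induction K arbitrary: v t)
  case 0
  then show ?case by (simp add: Ad_simps)
next
  case (Suc K)
  have IH: "Ad (t *\<^sub>R w) (br w v) = (\<Sum>k<K. (t ^ k / fact k) *\<^sub>R (br w ^^ Suc k) v)" for t
    using Suc.IH[of "br w v" t] Suc.prems by (simp add: funpow_swap1)
  have f: "((\<lambda>t. Ad (t *\<^sub>R w) v) has_derivative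
      (\<lambda>h. h *\<^sub>R (\<Sum>k<K. (t ^ k / fact k) *\<^sub>R (br w ^^ Suc k) v))) (at t)" for t
    using has_vector_derivative_Ad_straight[OF w, of v t] unfolding has_vector_derivative_def IH .
  have c: "((\<lambda>t. t ^ Suc k / fact (Suc k)) has_derivative (\<lambda>h. h * (t ^ k / fact k))) (at t)" for k and t :: real
  proof -
    have "((\<lambda>t. t ^ Suc k / fact (Suc k)) has_real_derivative of_nat (Suc k) * (1 * t ^ k) / fact (Suc k)) (at t)"
      by (rule DERIV_cdivide) (rule derivative_eq_intros refl | simp)+
    also have "of_nat (Suc k) * (1 * t ^ k) / fact (Suc k) = t ^ k / fact k"
      by (simp add: fact_Suc del: of_nat_Suc)
    finally show ?thesis unfolding has_field_derivative_def
      by (rule has_derivative_eq_rhs) (rule ext, rule mult.commute)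
  qed
  have g: "((\<lambda>t. \<Sum>k<Suc K. (t ^ k / fact k) *\<^sub>R (br w ^^ k) v) has_derivative
      (\<lambda>h. h *\<^sub>R (\<Sum>k<K. (t ^ k / fact k) *\<^sub>R (br w ^^ Suc k) v))) (at t)" for t
  proof -
    have "((\<lambda>t. v + (\<Sum>k<K. (t ^ Suc k / fact (Suc k)) *\<^sub>R (br w ^^ Suc k) v)) has_derivative
      (\<lambda>h. 0 + (\<Sum>k<K. (h * (t ^ k / fact k)) *\<^sub>R (br w ^^ Suc k) v))) (at t)"
      by (intro has_derivative_add has_derivative_const has_derivative_sum has_derivative_scaleR_left c)
    then show ?thesis
      unfolding sum.lessThan_Suc_shift by (simp add: scaleR_sum_right)
  qed
  show ?case
    by (rule equal_derivative_imp_eq[OF f g]) (simp add: sum.lessThan_Suc_shift del: sum.lessThan_Suc)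
qed

text \<open>The signs in \<open>flow\<close> and those of \<open>foldl_replicate_br\<close> cancel
  and leave the series of \<open>Ad_straight\<close>.\<close>

lemma flow_embed:
  assumes w: "straight w" and N: "\<And>Ys v. N \<le> length Ys \<Longrightarrow> foldl br v Ys = 0"
  shows "flow N t w (prol_embed br v) = prol_embed br (Ad (t *\<^sub>R w) v)"
proof
  fix Ys
  have "foldl br v (replicate N w) = 0" by (rule N) simp
  then have K: "(br w ^^ N) v = 0" by (simp add: foldl_replicate_br)
  have p: "(- t) ^ k * (- 1) ^ k = t ^ k" for k
    by (simp flip: power_mult_distrib)
  have "flow N t w (prol_embed br v) Ys
      = (\<Sum>k<N. ((- t) ^ k / fact k) *\<^sub>R foldl br ((- 1) ^ k *\<^sub>R (br w ^^ k) v) Ys)"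
    by (simp add: flow_def prol_embed_def foldl_replicate_br)
  also have "\<dots> = foldl br (\<Sum>k<N. ((- t) ^ k / fact k) *\<^sub>R (- 1) ^ k *\<^sub>R (br w ^^ k) v) Ys"
    by (simp only: linear_sum[OF foldl_br_linear] linear_cmul[OF foldl_br_linear])
  also have "(\<Sum>k<N. ((- t) ^ k / fact k) *\<^sub>R (- 1) ^ k *\<^sub>R (br w ^^ k) v) = Ad (t *\<^sub>R w) v"
    unfolding Ad_straight[OF w K] by (simp add: p)
  finally show "flow N t w (prol_embed br v) Ys = prol_embed br (Ad (t *\<^sub>R w) v) Ys"
    by (simp add: prol_embed_def)
qed

end

section \<open>The adjoint action on the prolongation as a product of flows\<close>

context exp_lie_group begin

text \<open>The flow of index 1 acts first, as does the rightmost factor of exp (x_n X_n) ... exp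
  (x_1 X_1) under \<open>Ad\<close>.\<close>

fun flows :: "nat \<Rightarrow> (real, 'n) vec \<Rightarrow> nat \<Rightarrow> (real, 'n) vec prol \<Rightarrow> (real, 'n) vec prol" where
  "flows N x 0 u = u"
| "flows N x (Suc i) u = flow N (coord x (Suc i)) (b (Suc i)) (flows N x i u)"

lemma coded_flows: "coded N u \<Longrightarrow> coded N (flows M x i u)"
  by (induction i) (simp_all add: coded_flow)

lemma flows_linear:
  assumes "finite I"
  shows "flows N x i (\<lambda>Ys. \<Sum>k\<in>I. c k *\<^sub>R v k Ys) = (\<lambda>Ys. \<Sum>k\<in>I. c k *\<^sub>R flows N x i (v k) Ys)"
proof (induction i)
  case (Suc i)
  show ?case
    unfolding flows.simps Suc flow_def scaleR_sum_right
    by (subst sum.swap) (simp add: mult.commute)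
qed simp

text \<open>The value at the empty list is the component in the Lie algebra.\<close>

definition Phi :: "nat \<Rightarrow> (real, 'n) vec prol \<Rightarrow> (real, 'n) vec \<Rightarrow> (real, 'n) vec" where
  "Phi N u x = flows N x CARD('n) u []"

end

text \<open>Every order from the step of the group on is admissible here; elements of low degree in
  the prolongation call for larger ones.\<close>

locale nilpotent_exp_group = exp_lie_group gmul invr b
  for gmul :: "real ^ 'n::{finite,linorder} \<Rightarrow> (real, 'n) vec \<Rightarrow> (real, 'n) vec" and invr b +
  fixes N :: nat
  assumes N_pos: "0 < N"
    and nilpotent: "\<And>Ys v. N \<le> length Ys \<Longrightarrow> foldl (lie_bracket gmul) v Ys = 0"
begin

lemma funpow_br_0: "(br w ^^ N) v = 0"
proof -
  have "foldl br v (replicate N w) = 0" by (rule nilpotent) simp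
  then show ?thesis by (simp add: foldl_replicate_br)
qed

lemma flows_embed: "i \<le> CARD('n) \<Longrightarrow> flows N x i (prol_embed br v) = prol_embed br (Ad (partial_prod x (Suc i)) v)"
proof (induction i)
  case (Suc i)
  then show ?case
    by (simp add: flow_embed[OF b_straight nilpotent] partial_prod_Suc Ad_mul)
qed simp

lemma Phi_embed: "Phi N (prol_embed br v) x = Ad x v"
  unfolding Phi_def by (simp add: flows_embed partial_prod_full) (simp add: prol_embed_def)

lemma flows_prol_bracket:
  assumes u: "coded N u"
  shows "i \<le> CARD('n) \<Longrightarrow>
    flows N x i (prol_bracket u Z) = prol_bracket (flows N x i u) (Ad (partial_prod x (Suc i)) Z)"
proof (induction i)
  case (Suc i)
  show ?case
  proof
    fix Ys
    have "flow N (coord x (Suc i)) (b (Suc i)) (prol_bracket (flows N x i u) (Ad (partial_prod x (Suc i)) Z)) Ys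
      = flow N (coord x (Suc i)) (b (Suc i)) (flows N x i u)
          (Ad (coord x (Suc i) *\<^sub>R b (Suc i)) (Ad (partial_prod x (Suc i)) Z) # Ys)"
      by (rule flow_prol_bracket[OF b_straight N_pos coded_flows[OF u] order_refl funpow_br_0])
         (use Suc.prems in simp)
    then show "flows N x (Suc i) (prol_bracket u Z) Ys
      = prol_bracket (flows N x (Suc i) u) (Ad (partial_prod x (Suc (Suc i))) Z) Ys"
      using Suc by (simp add: prol_bracket_def partial_prod_Suc Ad_mul)
  qed
qed simp

lemma flows_has_derivative:
  assumes u: "coded N u"
  shows "i \<le> CARD('n) \<Longrightarrow> ((\<lambda>x. flows N x i u Ys) has_derivative
    (\<lambda>d. - (\<Sum>j=1..i. coord d j *\<^sub>R
        flows N x i (prol_bracket u (Ad (invr (partial_prod x j)) (b j))) Ys))) (at x)"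
proof (induction i arbitrary: Ys)
  case (Suc i)
  let ?Z = "\<lambda>j. Ad (invr (partial_prod x j)) (b j)"
  let ?t = "coord x (Suc i)" and ?w = "b (Suc i)"
  have z: "flows N x i u (replicate N ?w @ Ys) = 0"
    by (rule coded_long[OF coded_flows[OF u]]) simp
  have p: "((\<lambda>x. coord x (Suc i)) has_derivative (\<lambda>d. coord d (Suc i))) (at x)"
    by (rule linear_imp_has_derivative[OF linear_coord])
  have IH: "((\<lambda>x. flows N x i u (replicate k ?w @ Ys)) has_derivative
    (\<lambda>d. - (\<Sum>j=1..i. coord d j *\<^sub>R flows N x i (prol_bracket u (?Z j)) (replicate k ?w @ Ys)))) (at x)" for k
    by (rule Suc.IH) (use Suc.prems in simp)
  have D: "((\<lambda>x. flow N (coord x (Suc i)) ?w (flows N x i u) Ys) has_derivative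
     (\<lambda>d. (\<Sum>k<N. ((- ?t) ^ k / fact k) *\<^sub>R
          - (\<Sum>j=1..i. coord d j *\<^sub>R flows N x i (prol_bracket u (?Z j)) (replicate k ?w @ Ys)))
        - coord d (Suc i) *\<^sub>R flow N ?t ?w (prol_bracket (flows N x i u) ?w) Ys)) (at x)"
    by (rule flow_has_derivative[where v="\<lambda>x. flows N x i u", OF IH p z])
  \<comment> \<open>Differentiation in the new coordinate brackets with \<open>b (Suc i)\<close>
    after the inner flows. Moved inside them, it is a bracket with the vector that \<open>Ad\<close>
    of the partial product sends to \<open>b (Suc i)\<close>.\<close>
  have e1: "prol_bracket (flows N x i u) ?w = flows N x i (prol_bracket u (?Z (Suc i)))"
    unfolding flows_prol_bracket[OF u Suc_leD[OF Suc.prems]] by simp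
  have e2: "(\<Sum>k<N. ((- ?t) ^ k / fact k) *\<^sub>R
          - (\<Sum>j=1..i. coord d j *\<^sub>R flows N x i (prol_bracket u (?Z j)) (replicate k ?w @ Ys)))
      = - (\<Sum>j=1..i. coord d j *\<^sub>R flow N ?t ?w (flows N x i (prol_bracket u (?Z j))) Ys)" for d
    unfolding flow_def scaleR_minus_right sum_negf scaleR_sum_right
    by (subst sum.swap) (simp add: mult.commute)
  show ?case
    unfolding flows.simps
    by (rule has_derivative_eq_rhs[OF D]) (rule ext, simp only: e1 e2, simp)
qed simp

lemma Phi_has_derivative:
  assumes u: "coded N u"
  shows "(Phi N u has_derivative (\<lambda>d. - Phi N (prol_bracket u (field_inverse x d)) x)) (at x)"
proof -
  let ?Z = "\<lambda>j. Ad (invr (partial_prod x j)) (b j)"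
  have "(\<Sum>j=1..CARD('n). coord d j *\<^sub>R flows N x CARD('n) (prol_bracket u (?Z j)) [])
      = Phi N (prol_bracket u (field_inverse x d)) x" for d
  proof -
    have "prol_bracket u (field_inverse x d) = (\<lambda>Ys. \<Sum>j=1..CARD('n). coord d j *\<^sub>R prol_bracket u (?Z j) Ys)"
      unfolding prol_bracket_def field_inverse_def
      by (rule ext) (simp only: linear_sum[OF coded_linear_Cons[OF u]] linear_cmul[OF coded_linear_Cons[OF u]])
    then show ?thesis unfolding Phi_def by (simp only: flows_linear finite_atLeastAtMost)
  qed
  moreover have "Phi N u = (\<lambda>x. flows N x CARD('n) u [])"
    by (rule ext) (rule Phi_def)
  ultimately show ?thesis
    using flows_has_derivative[OF u order_refl, of "[]" x] by (simp only:)
qed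

text \<open>The truncated series are multiplied out. Multi-indices lie in a box and vanish beyond
  the first \<open>i\<close> positions, so each induction step chooses one more exponent. The lists
  have the order of the nested brackets in \<open>iter_bracket\<close>.\<close>

lemma flows_expand:
  assumes u: "coded N u"
  shows "i \<le> CARD('n) \<Longrightarrow> flows N x i u Ys =
    (\<Sum>\<alpha>::'n \<Rightarrow> nat | (\<forall>l. \<alpha> l < N) \<and> (\<forall>l. l \<notin> ix ` {1..i} \<longrightarrow> \<alpha> l = 0).
       (\<Prod>j=1..i. (- coord x j) ^ \<alpha> (ix j) / fact (\<alpha> (ix j))) *\<^sub>R
       u (concat (map (\<lambda>j. replicate (\<alpha> (ix j)) (b j)) [1..<Suc i]) @ Ys))"
    (is "_ \<Longrightarrow> _ = sum (?f i Ys) (?A i)")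
proof (induction i arbitrary: Ys)
  case 0
  have "?A 0 = {\<lambda>_. 0}" using N_pos by auto
  then show ?case by simp
next
  case (Suc i)
  let ?l = "ix (Suc i) :: 'n" and ?t = "coord x (Suc i)" and ?w = "b (Suc i)"
  have ne: "ix j \<noteq> ?l" if "j \<in> {1..i}" for j
    using that Suc.prems ix_inject[where ?'n='n, of j "Suc i"] by simp
  have fin: "finite (?A i)"
  proof -
    have "?A i \<subseteq> Pi\<^sub>E UNIV (\<lambda>_. {..<N})" by auto
    then show ?thesis by (rule finite_subset) (intro finite_PiE, auto)
  qed
  have "bij_betw (\<lambda>(\<alpha>, k). \<alpha>(?l := k)) (?A i \<times> {..<N}) (?A (Suc i))"
  proof (rule bij_betwI[where g="\<lambda>\<alpha>. (\<alpha>(?l := 0), \<alpha> ?l)"])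
    show "(\<lambda>(\<alpha>, k). \<alpha>(?l := k)) \<in> ?A i \<times> {..<N} \<rightarrow> ?A (Suc i)"
      by (auto simp: atLeastAtMostSuc_conv)
    show "(\<lambda>\<alpha>. (\<alpha>(?l := 0), \<alpha> ?l)) \<in> ?A (Suc i) \<rightarrow> ?A i \<times> {..<N}"
      using N_pos by (auto simp: atLeastAtMostSuc_conv)
  next
    fix p assume p: "p \<in> ?A i \<times> {..<N}"
    obtain \<alpha> k where pk: "p = (\<alpha>, k)" by (rule prod.exhaust)
    have "?l \<notin> ix ` {1..i}" using ne by force
    then have "\<alpha> ?l = 0" using p pk by simp
    then have "\<alpha>(?l := k, ?l := 0) = \<alpha>" by auto
    then show "(((case p of (\<alpha>, k) \<Rightarrow> \<alpha>(?l := k))(?l := 0), (case p of (\<alpha>, k) \<Rightarrow> \<alpha>(?l := k)) ?l)) = p"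
      by (simp add: pk)
  next
    fix \<alpha> assume "\<alpha> \<in> ?A (Suc i)"
    show "(case (\<alpha>(?l := 0), \<alpha> ?l) of (\<alpha>, k) \<Rightarrow> \<alpha>(?l := k)) = \<alpha>" by simp
  qed
  then have "sum (?f (Suc i) Ys) (?A (Suc i)) = (\<Sum>(\<alpha>, k)\<in>?A i \<times> {..<N}. ?f (Suc i) Ys (\<alpha>(?l := k)))"
    by (subst sum.reindex_bij_betw[symmetric]) (auto simp: case_prod_unfold)
  also have "\<dots> = (\<Sum>\<alpha>\<in>?A i. \<Sum>k<N. ?f (Suc i) Ys (\<alpha>(?l := k)))"
    by (simp add: sum.cartesian_product)
  also have "\<dots> = (\<Sum>\<alpha>\<in>?A i. \<Sum>k<N. ((- ?t) ^ k / fact k) *\<^sub>R ?f i (replicate k ?w @ Ys) \<alpha>)"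
  proof (intro sum.cong refl)
    fix \<alpha> k
    have m1: "(\<Prod>j=1..i. (- coord x j) ^ (\<alpha>(?l := k)) (ix j) / fact ((\<alpha>(?l := k)) (ix j)))
        = (\<Prod>j=1..i. (- coord x j) ^ \<alpha> (ix j) / fact (\<alpha> (ix j)))"
      by (intro prod.cong refl) (simp add: ne)
    have m2: "map (\<lambda>j. replicate ((\<alpha>(?l := k)) (ix j)) (b j)) [1..<Suc i]
        = map (\<lambda>j. replicate (\<alpha> (ix j)) (b j)) [1..<Suc i]"
      by (intro map_cong refl) (simp add: ne less_Suc_eq_le del: upt_Suc)
    have m3: "[1..<Suc (Suc i)] = [1..<Suc i] @ [Suc i]" by simp
    show "?f (Suc i) Ys (\<alpha>(?l := k)) = ((- ?t) ^ k / fact k) *\<^sub>R ?f i (replicate k ?w @ Ys) \<alpha>"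
      by (simp only: m1 m2 m3 map_append concat_append prod.cl_ivl_Suc)
        (simp add: mult.commute del: upt_Suc)
  qed
  also have "\<dots> = (\<Sum>k<N. ((- ?t) ^ k / fact k) *\<^sub>R flows N x i u (replicate k ?w @ Ys))"
    using Suc by (subst sum.swap) (simp add: scaleR_sum_right)
  also have "\<dots> = flows N x (Suc i) u Ys" by (simp add: flow_def)
  finally show ?case ..
qed

end

section \<open>Strata and adapted bases\<close>

lemma sum_fun_apply: "(\<Sum>i\<in>I. f i) x = (\<Sum>i\<in>I. f i x)"
  by (induction I rule: infinite_finite_induct) auto

locale stratified_group = lie_group_rn gmul invr
  for gmul :: "'a::euclidean_space \<Rightarrow> 'a \<Rightarrow> 'a" and invr +
  fixes V :: "nat \<Rightarrow> 'a set" and s :: nat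
  assumes strat: "stratification (lie_bracket gmul) V s"
begin

lemma s_pos: "1 \<le> s" and subspace_V: "1 \<le> i \<Longrightarrow> subspace (V i)"
  and V_above: "s < i \<Longrightarrow> V i = {0}"
  and V_Suc: "1 \<le> i \<Longrightarrow> V (Suc i) = span {br x y | x y. x \<in> V i \<and> y \<in> V 1}"
  using strat unfolding stratification_def by blast+

lemma decompose: obtains y where "\<And>i. i \<in> {1..s} \<Longrightarrow> y i \<in> V i" "x = (\<Sum>i=1..s. y i)"
proof -
  have "\<exists>!y. (\<forall>i\<in>{1..s}. y i \<in> V i) \<and> (\<forall>i. i \<notin> {1..s} \<longrightarrow> y i = 0) \<and> x = (\<Sum>i=1..s. y i)"
    using strat unfolding stratification_def by blast
  then obtain y where y: "\<forall>i\<in>{1..s}. y i \<in> V i" "x = (\<Sum>i=1..s. y i)"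
    by (elim ex1E conjE) (rule that; assumption)
  show ?thesis by (rule that[OF bspec[OF y(1)] y(2)])
qed

lemma decompose_unique:
  assumes "\<And>i. i \<in> {1..s} \<Longrightarrow> y i \<in> V i" "\<And>i. i \<in> {1..s} \<Longrightarrow> y' i \<in> V i"
    and "(\<Sum>i=1..s. y i) = (\<Sum>i=1..s. y' i)" and i: "i \<in> {1..s}"
  shows "y i = y' i"
proof -
  \<comment> \<open>Uniqueness in \<open>stratification\<close> concerns families on all indices
    that vanish outside \<open>{1..s}\<close>, so both families are cut off.\<close>
  define z where "z y = (\<lambda>i. if i \<in> {1..s} then y i else 0)" for y :: "nat \<Rightarrow> 'a"
  define Q where "Q w \<longleftrightarrow> (\<forall>i\<in>{1..s}. w i \<in> V i) \<and> (\<forall>i. i \<notin> {1..s} \<longrightarrow> w i = 0) \<and>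
      (\<Sum>i=1..s. y' i) = (\<Sum>i=1..s. w i)" for w
  have ex: "\<exists>!w. Q w"
    using strat unfolding stratification_def Q_def by blast
  have "(\<Sum>i=1..s. z w i) = (\<Sum>i=1..s. w i)" for w by (rule sum.cong) (simp_all add: z_def)
  then have "Q (z y)" "Q (z y')" using assms unfolding Q_def by (simp_all add: z_def)
  then have "z y = z y'" using the1_equality[OF ex] by metis
  then have "z y i = z y' i" by simp
  then show ?thesis using i unfolding z_def by simp
qed

lemma br_V_1: "1 \<le> i \<Longrightarrow> x \<in> V i \<Longrightarrow> y \<in> V 1 \<Longrightarrow> br x y \<in> V (Suc i)"
  unfolding V_Suc by (rule span_base) blast

text \<open>Only brackets with \<open>V 1\<close> are given. For a generator [a, c] of the next
  stratum, with \<open>c\<close> in \<open>V 1\<close>, the Jacobi identity rewrites [x, [a, c]] by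
  brackets with \<open>c\<close> and with \<open>a\<close>, whose degree is one lower.\<close>

lemma br_V_Suc: "1 \<le> i \<Longrightarrow> x \<in> V i \<Longrightarrow> y \<in> V (Suc j) \<Longrightarrow> br x y \<in> V (i + Suc j)"
proof (induction j arbitrary: i x y)
  case 0
  then show ?case using br_V_1[of i x y] by simp
next
  case (Suc j)
  have sub: "subspace {y. br x y \<in> V (i + Suc (Suc j))}"
    using subspace_V[of "i + Suc (Suc j)"] by (auto simp: subspace_def br_simps)
  have gen: "br x (br a c) \<in> V (i + Suc (Suc j))" if a: "a \<in> V (Suc j)" and c: "c \<in> V 1" for a c
  proof -
    have "br x a \<in> V (i + Suc j)" using Suc a by simp
    then have 1: "br (br x a) c \<in> V (i + Suc (Suc j))"
      using br_V_1[of "i + Suc j" "br x a" c] c by simp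
    have "br x c \<in> V (Suc i)" by (rule br_V_1) (use Suc.prems c in auto)
    then have 2: "br (br x c) a \<in> V (i + Suc (Suc j))"
      using Suc.IH[of "Suc i" "br x c" a] a by simp
    show ?thesis unfolding jacobi_right by (rule subspace_diff[OF _ 1 2]) (rule subspace_V, simp)
  qed
  have "y \<in> span {br x y | x y. x \<in> V (Suc j) \<and> y \<in> V 1}"
    using Suc.prems V_Suc[of "Suc j"] by simp
  also have "\<dots> \<subseteq> {y. br x y \<in> V (i + Suc (Suc j))}"
    by (rule span_minimal[OF _ sub]) (use gen in blast)
  finally show ?case by simp
qed

lemma br_V: "1 \<le> i \<Longrightarrow> 1 \<le> j \<Longrightarrow> x \<in> V i \<Longrightarrow> y \<in> V j \<Longrightarrow> br x y \<in> V (i + j)"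
  using br_V_Suc[of i x y "j - 1"] by simp

lemma foldl_br_V:
  "1 \<le> i \<Longrightarrow> x \<in> V i \<Longrightarrow> s < i + length Ys \<Longrightarrow> foldl br x Ys = 0"
proof (induction Ys arbitrary: i x)
  case Nil
  then show ?case using V_above[of i] by auto
next
  case (Cons Y Ys)
  obtain y where y: "\<And>k. k \<in> {1..s} \<Longrightarrow> y k \<in> V k" "Y = (\<Sum>k=1..s. y k)"
    by (rule decompose) (rule that; assumption)
  have "foldl br (br x (y k)) Ys = 0" if k: "k \<in> {1..s}" for k
    by (rule Cons.IH[of "i + k"]) (use Cons.prems k br_V[OF _ _ _ y(1)[OF k]] in auto)
  then show ?case
    by (simp add: y(2) br_simps linear_sum[OF foldl_br_linear])
qed

lemma foldl_br_0:
  assumes "s \<le> length Ys"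
  shows "foldl br x Ys = 0"
proof -
  obtain y where y: "\<And>k. k \<in> {1..s} \<Longrightarrow> y k \<in> V k" "x = (\<Sum>k=1..s. y k)"
    by (rule decompose) (rule that; assumption)
  have "foldl br (y k) Ys = 0" if "k \<in> {1..s}" for k
    by (rule foldl_br_V[of k]) (use y that assms in auto)
  then show ?thesis by (simp add: y(2) linear_sum[OF foldl_br_linear])
qed

lemma coded_sum:
  assumes "\<And>i. i \<in> I \<Longrightarrow> coded N (u i)"
  shows "coded N (\<lambda>Ys. \<Sum>i\<in>I. u i Ys)"
  unfolding coded_def
proof (intro conjI allI impI)
  show "linear (\<lambda>Y. \<Sum>i\<in>I. u i (Ys @ Y # Zs))" for Ys Zs
    by (intro linear_compose_sum ballI) (rule coded_linear[OF assms])
  show "(\<Sum>i\<in>I. u i (Ys @ br Y Z # Zs)) = (\<Sum>i\<in>I. u i (Ys @ Y # Z # Zs)) - (\<Sum>i\<in>I. u i (Ys @ Z # Y # Zs))"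
    for Ys Y Z Zs
    by (simp add: coded_br[OF assms] sum_subtractf)
  show "(\<Sum>i\<in>I. u i Ys) = 0" if "N \<le> length Ys" for Ys
    by (intro sum.neutral ballI) (rule coded_long[OF assms that])
qed

text \<open>The conditions on a stratum speak of the first list position only; the later positions
  are covered by the brackets being coded.\<close>

lemma coded_Suc:
  assumes lin: "linear (prol_bracket u)"
    and der: "\<And>Y Z. prol_bracket u (br Y Z) = prol_bracket (prol_bracket u Y) Z - prol_bracket (prol_bracket u Z) Y"
    and br: "\<And>Y. coded N (prol_bracket u Y)"
  shows "coded (Suc N) u"
  unfolding coded_def
proof (intro conjI allI impI)
  fix Ys Zs
  show "linear (\<lambda>Y. u (Ys @ Y # Zs))"
  proof (cases Ys)
    case Nil
    show ?thesis
      unfolding Nil by (rule linearI)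
        (use fun_cong[OF linear_add[OF lin], of _ _ Zs] fun_cong[OF linear_cmul[OF lin], of _ _ Zs] in
          \<open>simp_all add: prol_bracket_def scaleR_fun_def\<close>)
  next
    case (Cons W Ws)
    from coded_linear[OF br[of W], of Ws Zs] show ?thesis by (simp add: Cons prol_bracket_def)
  qed
  fix Y Z
  show "u (Ys @ br Y Z # Zs) = u (Ys @ Y # Z # Zs) - u (Ys @ Z # Y # Zs)"
  proof (cases Ys)
    case Nil
    from fun_cong[OF der[of Y Z], of Zs] show ?thesis by (simp add: Nil prol_bracket_def)
  next
    case (Cons W Ws)
    from coded_br[OF br[of W], of Ws Y Z Zs] show ?thesis by (simp add: Cons prol_bracket_def)
  qed
next
  fix Ys :: "'a list" assume "Suc N \<le> length Ys"
  then obtain W Ws where "Ys = W # Ws" "N \<le> length Ws" by (cases Ys) auto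
  then show "u Ys = 0" using coded_long[OF br[of W], of Ws] by (simp add: prol_bracket_def)
qed

lemma stratum_pos: "1 \<le> k \<Longrightarrow> prol_stratum br V s k = prol_embed br ` V (nat k)"
  by (subst prol_stratum.simps) simp

lemma stratum_nonpos:
  assumes "k \<le> 0" "\<phi> \<in> prol_stratum br V s k"
  shows "\<phi> [] = 0" "linear (prol_bracket \<phi>)"
    "\<And>i Y. i \<in> {1..s} \<Longrightarrow> Y \<in> V i \<Longrightarrow> prol_bracket \<phi> Y \<in> prol_stratum br V s (k + int i)"
    "\<And>Y Z. prol_bracket \<phi> (br Y Z) = prol_bracket (prol_bracket \<phi> Y) Z - prol_bracket (prol_bracket \<phi> Z) Y"
proof -
  have "\<phi> \<in> {\<phi>. \<phi> [] = 0 \<and> linear (prol_bracket \<phi>) \<and>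
               (\<forall>i\<in>{1..s}. \<forall>Y\<in>V i. prol_bracket \<phi> Y \<in> prol_stratum br V s (k + int i)) \<and>
               (\<forall>Y Z. prol_bracket \<phi> (br Y Z) =
                        prol_bracket (prol_bracket \<phi> Y) Z - prol_bracket (prol_bracket \<phi> Z) Y)}"
    using assms by (subst (asm) prol_stratum.simps) simp
  then show "\<phi> [] = 0" "linear (prol_bracket \<phi>)"
    "\<And>i Y. i \<in> {1..s} \<Longrightarrow> Y \<in> V i \<Longrightarrow> prol_bracket \<phi> Y \<in> prol_stratum br V s (k + int i)"
    "\<And>Y Z. prol_bracket \<phi> (br Y Z) = prol_bracket (prol_bracket \<phi> Y) Z - prol_bracket (prol_bracket \<phi> Z) Y"
    by blast+
qed

lemma coded_stratum_pos:
  assumes "1 \<le> k" "u \<in> prol_stratum br V s k"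
  shows "coded (nat (int s + 1 - k)) u"
proof -
  obtain v where v: "v \<in> V (nat k)" "u = prol_embed br v"
    using assms by (auto simp: stratum_pos)
  have 0: "coded s u" unfolding v by (rule coded_embed) (rule foldl_br_0)
  have "u Ys = 0" if "nat (int s + 1 - k) \<le> length Ys" for Ys
    unfolding v prol_embed_def
    by (rule foldl_br_V[OF _ v(1)]) (use assms(1) that in auto)
  with 0 show ?thesis unfolding coded_def by blast
qed

text \<open>Each bracket raises the degree by at least one and nothing lies above degree
  \<open>s\<close>, so s + 1 - k brackets annihilate an element of degree \<open>k\<close>. As the
  strata control brackets with homogeneous vectors only, a general vector is split into its
  components.\<close>

lemma coded_stratum: "u \<in> prol_stratum br V s k \<Longrightarrow> coded (nat (int s + 1 - k)) u"
proof (induction "nat (1 - k)" arbitrary: k u rule: less_induct)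
  case less
  show ?case
  proof (cases "1 \<le> k")
    case True
    then show ?thesis using coded_stratum_pos less by blast
  next
    case False
    then have k: "k \<le> 0" by simp
    note u = stratum_nonpos[OF k less.prems]
    have "coded (nat (int s - k)) (prol_bracket u Y)" for Y
    proof -
      obtain y where y: "\<And>i. i \<in> {1..s} \<Longrightarrow> y i \<in> V i" "Y = (\<Sum>i=1..s. y i)"
        by (rule decompose) (rule that; assumption)
      have "coded (nat (int s - k)) (prol_bracket u (y i))" if i: "i \<in> {1..s}" for i
      proof (rule coded_mono)
        show "coded (nat (int s + 1 - (k + int i))) (prol_bracket u (y i))"
          by (rule less.hyps) (use False i u(3)[OF i y(1)[OF i]] in auto)
      qed (use i in auto)
      then have "coded (nat (int s - k)) (\<lambda>Ys. \<Sum>i=1..s. prol_bracket u (y i) Ys)"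
        by (rule coded_sum)
      moreover have "prol_bracket u Y = (\<lambda>Ys. \<Sum>i=1..s. prol_bracket u (y i) Ys)"
        unfolding y(2) linear_sum[OF u(2)] by (rule ext) (rule sum_fun_apply)
      ultimately show ?thesis by simp
    qed
    from coded_Suc[OF u(2) u(4) this] show ?thesis
      using k by (simp add: nat_diff_distrib Suc_nat_eq_nat_zadd1 algebra_simps)
  qed
qed

lemma stratum_prol_bracket:
  assumes "u \<in> prol_stratum br V s k" "i \<in> {1..s}" "Y \<in> V i"
  shows "prol_bracket u Y \<in> prol_stratum br V s (k + int i)"
proof (cases "1 \<le> k")
  case True
  then obtain v where v: "v \<in> V (nat k)" "u = prol_embed br v"
    using assms by (auto simp: stratum_pos)
  have "br v Y \<in> V (nat k + i)" by (rule br_V) (use v assms True in auto)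
  then show ?thesis using True
    by (simp add: v stratum_pos prol_bracket_embed nat_add_distrib)
next
  case False
  then show ?thesis using stratum_nonpos(3)[of k u] assms by simp
qed

lemma stratum_prolongation: "u \<in> prol_stratum br V s k \<Longrightarrow> u \<in> prolongation br V s"
proof (cases "k \<le> int s")
  case True
  assume "u \<in> prol_stratum br V s k"
  then show ?thesis unfolding prolongation_def using True by (intro span_base) auto
next
  case False
  assume "u \<in> prol_stratum br V s k"
  then have "u \<in> prol_embed br ` V (nat k)" using False s_pos by (simp add: stratum_pos)
  then have "u = prol_embed br 0" using False s_pos V_above[of "nat k"] by auto
  then have "u = 0" by (simp add: prol_embed_def linear_0[OF foldl_br_linear] fun_eq_iff)
  then show ?thesis unfolding prolongation_def by (simp add: span_zero)
qed

end

section \<open>Degrees of an adapted basis; the first r coordinates\<close>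

locale adapted_group = exp_lie_group gmul invr b + stratified_group gmul invr V s
  for gmul :: "real ^ 'n::{finite,linorder} \<Rightarrow> (real, 'n) vec \<Rightarrow> (real, 'n) vec" and invr b V s +
  fixes r :: nat and J :: "int set" and X :: "int \<Rightarrow> (real, 'n) vec prol"
  assumes r_dim: "r = dim (V 1)"
    and adapted: "adapted_prol_basis (lie_bracket gmul) V s CARD('n) b J X"
begin

lemma J_sub: "{1..int CARD('n)} \<subseteq> J" and J_le: "k \<in> J \<Longrightarrow> k \<le> int CARD('n)"
  and X_b: "j \<in> {1..CARD('n)} \<Longrightarrow> X (int j) = prol_embed br (b j)"
  and X_inj: "inj_on X J" and X_indep: "independent (X ` J)"
  and X_span: "span (X ` J) = prolongation br V s"
  using adapted unfolding adapted_prol_basis_def by auto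

definition deg :: "int \<Rightarrow> int" where
  "deg = (SOME d. (\<forall>j\<in>J. d j \<le> int s \<and> X j \<in> prol_stratum br V s (d j)) \<and>
          (\<forall>i\<in>J. \<forall>j\<in>J. i < j \<longrightarrow> d i \<le> d j))"

lemma deg: "j \<in> J \<Longrightarrow> deg j \<le> int s" "j \<in> J \<Longrightarrow> X j \<in> prol_stratum br V s (deg j)"
  "i \<in> J \<Longrightarrow> j \<in> J \<Longrightarrow> i < j \<Longrightarrow> deg i \<le> deg j"
proof -
  have "\<exists>d. (\<forall>j\<in>J. d j \<le> int s \<and> X j \<in> prol_stratum br V s (d j)) \<and>
          (\<forall>i\<in>J. \<forall>j\<in>J. i < j \<longrightarrow> d i \<le> d j)"
    using adapted unfolding adapted_prol_basis_def by blast
  from someI_ex[OF this, folded deg_def]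
  show "j \<in> J \<Longrightarrow> deg j \<le> int s" "j \<in> J \<Longrightarrow> X j \<in> prol_stratum br V s (deg j)"
    "i \<in> J \<Longrightarrow> j \<in> J \<Longrightarrow> i < j \<Longrightarrow> deg i \<le> deg j" by blast+
qed

lemma int_J: "j \<in> {1..CARD('n)} \<Longrightarrow> int j \<in> J"
  using J_sub by auto

lemma b_nonzero: "j \<in> {1..CARD('n)} \<Longrightarrow> b j \<noteq> 0"
  using coord_b[of j j] by (auto simp: coord_def)

lemma deg_pos:
  assumes j: "j \<in> {1..CARD('n)}"
  shows "1 \<le> deg (int j)" "deg (int j) \<le> int s" "b j \<in> V (nat (deg (int j)))"
proof -
  have X: "X (int j) \<in> prol_stratum br V s (deg (int j))" by (rule deg(2)[OF int_J[OF j]])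
  \<comment> \<open>Elements of nonpositive degree vanish at the empty list, whereas here the value
    is \<open>b j\<close>.\<close>
  have "X (int j) [] \<noteq> 0" using b_nonzero[OF j] by (simp add: X_b[OF j] prol_embed_def)
  then show 1: "1 \<le> deg (int j)" using stratum_nonpos(1)[OF _ X] by linarith
  show "deg (int j) \<le> int s" by (rule deg(1)[OF int_J[OF j]])
  have "prol_embed br (b j) \<in> prol_embed br ` V (nat (deg (int j)))"
    using X stratum_pos[OF 1] X_b[OF j] by simp
  then obtain w where "prol_embed br (b j) = prol_embed br w" "w \<in> V (nat (deg (int j)))"
    by (rule imageE)
  with injD[OF inj_prol_embed this(1)] show "b j \<in> V (nat (deg (int j)))" by simp
qed

definition bdeg :: "nat \<Rightarrow> nat" where "bdeg j = nat (deg (int j))"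

lemma bdeg: "j \<in> {1..CARD('n)} \<Longrightarrow> bdeg j \<in> {1..s}" "j \<in> {1..CARD('n)} \<Longrightarrow> b j \<in> V (bdeg j)"
  "i \<in> {1..CARD('n)} \<Longrightarrow> j \<in> {1..CARD('n)} \<Longrightarrow> i < j \<Longrightarrow> bdeg i \<le> bdeg j"
  using deg_pos[of j] deg(3)[OF int_J int_J, of i j] by (auto simp: bdeg_def nat_le_iff)

lemma embed_linear: "linear (prol_embed br)"
  by (rule linearI) (simp_all add: prol_embed_def fun_eq_iff scaleR_fun_def
      linear_add[OF foldl_br_linear] linear_cmul[OF foldl_br_linear])

text \<open>An element of degree at least one lies in the span of \<open>X\<^sub>1, \<dots>, X\<^sub>n\<close>.\<close>

lemma deg_nonpos:
  assumes "j \<in> J" "j \<le> 0"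
  shows "deg j \<le> 0"
proof (rule ccontr)
  assume "\<not> deg j \<le> 0"
  then obtain w where w: "X j = prol_embed br w"
    using deg(2)[OF assms(1)] by (auto simp: stratum_pos)
  have "X j = (\<Sum>i=1..CARD('n). coord w i *\<^sub>R X (int i))"
  proof -
    have "prol_embed br (\<Sum>i=1..CARD('n). coord w i *\<^sub>R b i) = (\<Sum>i=1..CARD('n). coord w i *\<^sub>R prol_embed br (b i))"
      by (simp only: linear_sum[OF embed_linear] linear_cmul[OF embed_linear])
    also have "\<dots> = (\<Sum>i=1..CARD('n). coord w i *\<^sub>R X (int i))"
      by (intro sum.cong refl) (simp add: X_b)
    finally show ?thesis by (simp only: coord_sum_b w)
  qed
  moreover have "X (int i) \<in> X ` J - {X j}" if "i \<in> {1..CARD('n)}" for i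
    using inj_onD[OF X_inj, of "int i" j] int_J[OF that] assms that by force
  then have "(\<Sum>i=1..CARD('n). coord w i *\<^sub>R X (int i)) \<in> span (X ` J - {X j})"
    by (intro span_sum span_scale span_base)
  ultimately have "X j \<in> span (X ` J - {X j})" by (simp only:)
  then show False using X_indep assms(1) by (auto simp: dependent_def)
qed

text \<open>Grouping the coordinate expansion of \<open>x\<close> by degree gives a decomposition
  into strata, which by uniqueness is the trivial one.\<close>

lemma graded_coord:
  assumes x: "x \<in> V k" and k: "k \<in> {1..s}" and j: "j \<in> {1..CARD('n)}" "bdeg j \<noteq> k"
  shows "coord x j = 0"
proof -
  let ?y = "\<lambda>i. \<Sum>l | l \<in> {1..CARD('n)} \<and> bdeg l = i. coord x l *\<^sub>R b l"
  have "(\<Sum>i=1..s. ?y i) = (\<Sum>l=1..CARD('n). coord x l *\<^sub>R b l)"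
    using sum.group[of "{1..CARD('n)}" "{1..s}" bdeg "\<lambda>l. coord x l *\<^sub>R b l"] bdeg(1)
    by (auto simp: image_subset_iff)
  also have "\<dots> = (\<Sum>i=1..s. if i = k then x else 0)"
    using k by (simp add: coord_sum_b[simplified])
  finally have eq: "(\<Sum>i=1..s. ?y i) = (\<Sum>i=1..s. if i = k then x else 0)" .
  have dj: "bdeg j \<in> {1..s}" by (rule bdeg(1)[OF j(1)])
  have "?y (bdeg j) = (if bdeg j = k then x else 0)"
  proof (rule decompose_unique[OF _ _ eq dj])
    fix i assume i: "i \<in> {1..s}"
    show "?y i \<in> V i"
      using i bdeg(2) by (intro subspace_sum subspace_scale subspace_V) auto
    show "(if i = k then x else 0) \<in> V i"
      using i x subspace_0[OF subspace_V[of i]] by auto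
  qed
  then have "coord (?y (bdeg j)) j = 0" using j by (simp add: coord_def)
  moreover have "coord (?y (bdeg j)) j = (\<Sum>l | l \<in> {1..CARD('n)} \<and> bdeg l = bdeg j. if l = j then coord x j else 0)"
    using j(1) by (simp only: linear_sum[OF linear_coord] linear_cmul[OF linear_coord])
      (intro sum.cong refl, auto simp: coord_b)
  ultimately show ?thesis using j(1) by (simp add: sum.delta)
qed

lemma V_eq_span:
  assumes k: "k \<in> {1..s}"
  shows "V k = span (b ` {j \<in> {1..CARD('n)}. bdeg j = k})"
proof
  show "span (b ` {j \<in> {1..CARD('n)}. bdeg j = k}) \<subseteq> V k"
    using bdeg(2) subspace_V[of k] k by (intro span_minimal) auto
  show "V k \<subseteq> span (b ` {j \<in> {1..CARD('n)}. bdeg j = k})"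
  proof
    fix x assume x: "x \<in> V k"
    have "x = (\<Sum>j=1..CARD('n). coord x j *\<^sub>R b j)" by (rule coord_sum_b[symmetric])
    also have "\<dots> \<in> span (b ` {j \<in> {1..CARD('n)}. bdeg j = k})"
    proof (intro span_sum)
      fix j assume j: "j \<in> {1..CARD('n)}"
      show "coord x j *\<^sub>R b j \<in> span (b ` {j \<in> {1..CARD('n)}. bdeg j = k})"
      proof (cases "bdeg j = k")
        case True
        then show ?thesis using j by (intro span_scale span_base) auto
      next
        case False
        then show ?thesis using graded_coord[OF x k j] by (simp add: span_zero)
      qed
    qed
    finally show "x \<in> span (b ` {j \<in> {1..CARD('n)}. bdeg j = k})" .
  qed
qed

lemma b_inj: "inj_on b {1..CARD('n)}"
proof (rule inj_onI)
  fix i j assume ij: "i \<in> {1..CARD('n)}" "j \<in> {1..CARD('n)}" "b i = b j"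
  then show "i = j" using coord_b[OF ij(1) ij(1)] coord_b[OF ij(1) ij(2)] by (metis zero_neq_one)
qed

lemma b_independent: "independent (b ` {1..CARD('n)})"
proof (rule independent_mono[OF independent_Basis])
  show "b ` {1..CARD('n)} \<subseteq> Basis" by (auto simp: b_axis axis_in_Basis_iff)
qed

text \<open>The basis vectors of degree one span \<open>V 1\<close>, so there are \<open>r\<close>
  of them; as degrees increase with the index, they form an initial segment.\<close>

lemma degree_one: "{j \<in> {1..CARD('n)}. bdeg j = 1} = {1..r}"
proof -
  let ?A = "{j \<in> {1..CARD('n)}. bdeg j = 1}"
  have "dim (V 1) = dim (b ` ?A)"
    using V_eq_span[of 1] s_pos by simp
  also have "\<dots> = card (b ` ?A)"
    by (intro dim_eq_card_independent independent_mono[OF b_independent]) auto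
  also have "\<dots> = card ?A" by (intro card_image inj_on_subset[OF b_inj]) auto
  finally have card: "card ?A = r" using r_dim by simp
  have down: "i \<in> ?A" if "j \<in> ?A" "1 \<le> i" "i < j" for i j
    using that bdeg(1)[of i] bdeg(3)[of i j] by auto
  have "finite ?A" by simp
  show ?thesis
  proof (rule card_subset_eq[symmetric])
    show "finite ?A" by simp
    show "card {1..r} = card ?A" using card by simp
    show "{1..r} \<subseteq> ?A"
    proof
      fix i assume i: "i \<in> {1..r}"
      show "i \<in> ?A"
      proof (rule ccontr)
        assume ni: "i \<notin> ?A"
        have "j \<in> {1..<i}" if j: "j \<in> ?A" for j
        proof (rule ccontr)
          assume "j \<notin> {1..<i}"
          then have "i = j \<or> i < j" using j by auto
          then show False using ni j down[OF j] i by auto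
        qed
        then have "?A \<subseteq> {1..<i}" by (rule subsetI)
        then have "card ?A \<le> card {1..<i}" by (rule card_mono[rotated]) simp
        then show False using card i by auto
      qed
    qed
  qed
qed

lemma r_iff: "j \<in> {1..r} \<longleftrightarrow> j \<in> {1..CARD('n)} \<and> bdeg j = 1"
  unfolding degree_one[symmetric] by (rule mem_Collect_eq)

lemma d_le_r: "j \<in> {1..r} \<Longrightarrow> bdeg j = 1"
  by (simp only: r_iff)

lemma r_le: "r \<le> CARD('n)"
proof (cases "r = 0")
  case False
  then have "r \<in> {1..r}" by simp
  then have "r \<in> {1..CARD('n)}" unfolding r_iff by (rule conjunct1)
  then show ?thesis by simp
qed simp

lemma r_sub: "j \<in> {1..r} \<Longrightarrow> j \<in> {1..CARD('n)}"
  using r_le by auto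

lemma b_V1: "j \<in> {1..r} \<Longrightarrow> b j \<in> V 1"
  using bdeg(2)[of j] d_le_r[of j] r_sub[of j] by simp

lemma V1_span: "V 1 = span (b ` {1..r})"
  using V_eq_span[of 1] s_pos degree_one by simp

text \<open>Brackets have components in degree two and higher only.\<close>

lemma coord_br: "j \<in> {1..r} \<Longrightarrow> coord (br x y) j = 0"
proof -
  assume j: "j \<in> {1..r}"
  obtain f where f: "\<And>i. i \<in> {1..s} \<Longrightarrow> f i \<in> V i" "x = (\<Sum>i=1..s. f i)"
    by (rule decompose) (rule that; assumption)
  obtain g where g: "\<And>i. i \<in> {1..s} \<Longrightarrow> g i \<in> V i" "y = (\<Sum>i=1..s. g i)"
    by (rule decompose) (rule that; assumption)
  have "coord (br (f i) (g k)) j = 0" if i: "i \<in> {1..s}" and k: "k \<in> {1..s}" for i k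
  proof (cases "i + k \<le> s")
    case True
    show ?thesis
      by (rule graded_coord[of _ "i + k"])
        (use True i k br_V[OF _ _ f(1)[OF i] g(1)[OF k]] j r_sub[OF j] d_le_r[OF j] in auto)
  next
    case False
    then show ?thesis
      using br_V[OF _ _ f(1)[OF i] g(1)[OF k]] i k V_above[of "i + k"] by (auto simp: coord_def)
  qed
  moreover have "br x y = (\<Sum>i=1..s. br (f i) y)"
    unfolding f(2) by (rule linear_sum[OF linear_br_left])
  moreover have "br (f i) y = (\<Sum>k=1..s. br (f i) (g k))" for i
    unfolding g(2) by (rule linear_sum[OF linear_br_right])
  ultimately show ?thesis by (simp only: linear_sum[OF linear_coord]) simp
qed

lemma coord_Ad_b:
  assumes j: "j \<in> {1..r}" and i: "i \<in> {1..CARD('n)}"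
  shows "coord (Ad (t *\<^sub>R b i) w) j = coord w j"
proof -
  have "foldl br w (replicate s (b i)) = 0" by (rule foldl_br_0) simp
  then have K: "(br (b i) ^^ s) w = 0" by (simp add: foldl_replicate_br)
  have "coord ((br (b i) ^^ k) w) j = 0" if "k \<noteq> 0" for k
    using that coord_br[OF j] by (cases k) auto
  then have "coord (Ad (t *\<^sub>R b i) w) j = (\<Sum>k<s. if k = 0 then coord w j else 0)"
    unfolding Ad_straight[OF b_straight[OF i] K]
    by (simp only: linear_sum[OF linear_coord] linear_cmul[OF linear_coord]) (intro sum.cong refl, auto)
  then show ?thesis using s_pos by (simp add: sum.delta)
qed

lemma coord_Ad:
  assumes j: "j \<in> {1..r}"
  shows "coord (Ad x w) j = coord w j"
proof -
  have "i \<le> CARD('n) \<Longrightarrow> coord (Ad (partial_prod x (Suc i)) w) j = coord w j" for i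
    by (induction i) (simp_all add: partial_prod_Suc Ad_mul coord_Ad_b[OF j])
  from this[of "CARD('n)"] show ?thesis by (simp add: partial_prod_full)
qed

text \<open>The first \<open>r\<close> components of left-invariant fields are constant. This is
  what lets \<open>controls\<close> recover the controls from the velocity of a horizontal
  curve.\<close>

lemma coord_field:
  assumes j: "j \<in> {1..r}"
  shows "coord (field w x) j = coord w j"
proof -
  have "coord (field_inverse x z) j = coord z j" for z
  proof -
    have "coord (field_inverse x z) j = (\<Sum>i=1..CARD('n). coord z i * coord (b i) j)"
      unfolding field_inverse_def
      by (simp add: linear_sum[OF linear_coord] linear_cmul[OF linear_coord] coord_Ad[OF j])
    also have "\<dots> = coord (\<Sum>i=1..CARD('n). coord z i *\<^sub>R b i) j"
      by (simp add: linear_sum[OF linear_coord] linear_cmul[OF linear_coord])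
    finally show ?thesis by (simp only: coord_sum_b)
  qed
  from this[of "field w x"] show ?thesis by (simp add: field_inverse_field)
qed

section \<open>Generalized structure constants and extremal polynomials\<close>

lemma foldl_prol_bracket: "foldl prol_bracket u L Ys = u (L @ Ys)"
  by (induction L arbitrary: u) (simp_all add: prol_bracket_def)

lemma iter_bracket_eval:
  "iter_bracket b u (\<alpha> :: 'n \<Rightarrow> nat) [] = u (concat (map (\<lambda>j. replicate (\<alpha> (ix j)) (b j)) [1..<Suc CARD('n)]))"
  unfolding iter_bracket_def by (simp only: foldl_prol_bracket append_Nil2)

lemma foldl_stratum:
  assumes "u \<in> prol_stratum br V s k" "set L \<subseteq> b ` {1..CARD('n)}"
  shows "\<exists>k'. foldl prol_bracket u L \<in> prol_stratum br V s k'"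
  using assms
proof (induction L arbitrary: u k)
  case (Cons Y L)
  then obtain j where j: "j \<in> {1..CARD('n)}" "Y = b j" by auto
  have "prol_bracket u Y \<in> prol_stratum br V s (k + int (bdeg j))"
    unfolding j(2) by (rule stratum_prol_bracket[OF Cons.prems(1) bdeg(1)[OF j(1)] bdeg(2)[OF j(1)]])
  then show ?case using Cons.IH Cons.prems(2) by simp
qed auto

text \<open>Outside the span \<open>representation\<close> is 0 by default, so this is what gives
  \<open>gen_struct_const\<close> its meaning.\<close>

lemma iter_bracket_span:
  assumes "j \<in> J"
  shows "iter_bracket b (X j) (\<alpha> :: 'n \<Rightarrow> nat) \<in> span (X ` J)"
proof -
  have "set (concat (map (\<lambda>j. replicate (\<alpha> (ix j)) (b j)) [1..<Suc CARD('n)])) \<subseteq> b ` {1..CARD('n)}"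
    by (auto simp: less_Suc_eq_le simp del: upt_Suc)
  from foldl_stratum[OF deg(2)[OF assms] this] show ?thesis
    unfolding iter_bracket_def X_span using stratum_prolongation by blast
qed

lemma X_eval:
  assumes "j \<in> J" "k \<in> {1..CARD('n)}"
  shows "coord (X j []) k = (if j = int k then 1 else 0)"
proof (cases "j \<le> 0")
  case True
  have "X j [] = 0"
    by (rule stratum_nonpos(1)[OF deg_nonpos[OF assms(1) True] deg(2)[OF assms(1)]])
  then show ?thesis using True assms(2) by (simp add: coord_def)
next
  case False
  then obtain i where i: "i \<in> {1..CARD('n)}" "j = int i"
    using J_le[OF assms(1)] zero_le_imp_eq_int[of j] by auto
  then show ?thesis using coord_b[OF assms(2) i(1)] X_b[OF i(1)] by (simp add: prol_embed_def)
qed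

text \<open>Evaluation at the empty list kills the basis elements with index j \<le> 0 and sends the
  others to the basis of the Lie algebra, so it reads off the coefficients with positive
  index.\<close>

lemma representation_eval:
  assumes "u \<in> span (X ` J)" and k: "k \<in> {1..CARD('n)}"
  shows "representation (X ` J) u (X (int k)) = coord (u []) k"
proof -
  let ?R = "representation (X ` J) u"
  have "u = (\<Sum>y | ?R y \<noteq> 0. ?R y *\<^sub>R y)"
    using sum_nonzero_representation_eq[OF X_indep assms(1)] by simp
  then have "u [] = (\<Sum>y | ?R y \<noteq> 0. ?R y *\<^sub>R y) []" by simp
  also have "\<dots> = (\<Sum>y | ?R y \<noteq> 0. ?R y *\<^sub>R y [])"
    by (simp add: sum_fun_apply scaleR_fun_def)
  finally have "coord (u []) k = (\<Sum>y | ?R y \<noteq> 0. ?R y * coord (y []) k)"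
    by (simp add: linear_sum[OF linear_coord] linear_cmul[OF linear_coord])
  also have "\<dots> = (\<Sum>y | ?R y \<noteq> 0. if y = X (int k) then ?R y else 0)"
  proof (intro sum.cong refl)
    fix y assume "y \<in> {y. ?R y \<noteq> 0}"
    then obtain j where j: "j \<in> J" "y = X j" using representation_ne_zero by blast
    have "X j = X (int k) \<longleftrightarrow> j = int k" using inj_on_eq_iff[OF X_inj j(1) int_J[OF k]] .
    then show "?R y * coord (y []) k = (if y = X (int k) then ?R y else 0)"
      using X_eval[OF j(1) k] j(2) by simp
  qed
  also have "\<dots> = ?R (X (int k))"
    using finite_representation[of "X ` J" u] by (simp add: sum.delta')
  finally show ?thesis ..
qed

lemma extremal_coeff_eq:
  assumes "j \<in> J"
  shows "extremal_coeff b J X v j (\<alpha> :: 'n \<Rightarrow> nat) =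
     (- 1) ^ (\<Sum>l\<in>UNIV. \<alpha> l) / (\<Prod>l\<in>UNIV. fact (\<alpha> l)) *
     (v \<bullet> X j (concat (map (\<lambda>j. replicate (\<alpha> (ix j)) (b j)) [1..<Suc CARD('n)])))"
proof -
  have "gen_struct_const b J X j \<alpha> (int k) = coord (iter_bracket b (X j) \<alpha> []) k" if "k \<in> {1..CARD('n)}" for k
    unfolding gen_struct_const_def by (rule representation_eval[OF iter_bracket_span[OF assms] that])
  then have "(\<Sum>k=1..CARD('n). gen_struct_const b J X j \<alpha> (int k) * coord v k) = v \<bullet> iter_bracket b (X j) \<alpha> []"
    unfolding inner_coord by (intro sum.cong refl) (simp add: mult.commute)
  then show ?thesis unfolding extremal_coeff_def iter_bracket_eval by simp
qed

lemma length_monomial: "length (concat (map (\<lambda>j. replicate (\<alpha> (ix j :: 'n)) (b j)) [1..<Suc CARD('n)])) = (\<Sum>l\<in>UNIV. \<alpha> l)"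
proof -
  have "length (concat (map (\<lambda>j. replicate (\<alpha> (ix j :: 'n)) (b j)) js)) = sum_list (map (\<lambda>j. \<alpha> (ix j)) js)" for js
    by (induction js) auto
  then show ?thesis
    using sum_coord[of \<alpha>] by (simp add: sum_list_distinct_conv_sum_set atLeastLessThanSuc_atLeastAtMost del: upt_Suc)
qed

lemma nilpotent_exp_groupI: "s \<le> N \<Longrightarrow> nilpotent_exp_group gmul invr b N"
  by unfold_locales (use s_pos foldl_br_0 in auto)

lemma extremal_poly_eq:
  assumes j: "j \<in> J" and N: "s \<le> N" and u: "coded N (X j)"
  shows "extremal_poly b J X v j x = v \<bullet> Phi N (X j) x"
proof -
  interpret nilpotent_exp_group gmul invr b N by (rule nilpotent_exp_groupI[OF N])
  let ?A = "{\<alpha>::'n \<Rightarrow> nat. (\<forall>l. \<alpha> l < N) \<and> (\<forall>l. l \<notin> ix ` {1..CARD('n)} \<longrightarrow> \<alpha> l = 0)}"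
  let ?L = "\<lambda>\<alpha>::'n \<Rightarrow> nat. concat (map (\<lambda>j. replicate (\<alpha> (ix j)) (b j)) [1..<Suc CARD('n)])"
  let ?g = "\<lambda>\<alpha>. extremal_coeff b J X v j \<alpha> * (\<Prod>l\<in>UNIV. (x $ l) ^ \<alpha> l)"
  have ix: "ix ` {1..CARD('n)} = (UNIV :: 'n set)" using ix_bij by (rule bij_betw_imp_surj_on)
  have fin: "finite ?A"
  proof -
    have "?A \<subseteq> Pi\<^sub>E UNIV (\<lambda>_. {..<N})" by auto
    then show ?thesis by (rule finite_subset) (intro finite_PiE, auto)
  qed
  \<comment> \<open>A nonzero coefficient needs a list shorter than \<open>N\<close>, so all
    exponents are below \<open>N\<close>, and the sum extends to the box of
    \<open>flows_expand\<close>.\<close>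
  have sub: "{\<alpha>. extremal_coeff b J X v j \<alpha> \<noteq> 0} \<subseteq> ?A"
  proof
    fix \<alpha> :: "'n \<Rightarrow> nat" assume "\<alpha> \<in> {\<alpha>. extremal_coeff b J X v j \<alpha> \<noteq> 0}"
    then have "X j (?L \<alpha>) \<noteq> 0" unfolding mem_Collect_eq extremal_coeff_eq[OF j] by auto
    then have "(\<Sum>l\<in>UNIV. \<alpha> l) < N"
      using coded_long[OF u, of "?L \<alpha>"] unfolding length_monomial by (meson not_le)
    moreover have "\<alpha> l \<le> (\<Sum>l\<in>UNIV. \<alpha> l)" for l by (rule member_le_sum) auto
    ultimately have "\<alpha> l < N" for l using le_less_trans by blast
    then show "\<alpha> \<in> ?A" using ix by simp
  qed
  have "extremal_poly b J X v j x = sum ?g ?A"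
    unfolding extremal_poly_def by (rule sum.mono_neutral_left[OF fin sub]) auto
  also have "\<dots> = (\<Sum>\<alpha>\<in>?A. v \<bullet> ((\<Prod>i=1..CARD('n). (- coord x i) ^ \<alpha> (ix i) / fact (\<alpha> (ix i))) *\<^sub>R X j (?L \<alpha> @ [])))"
  proof (intro sum.cong refl)
    fix \<alpha> :: "'n \<Rightarrow> nat"
    have "(\<Prod>i=1..CARD('n). (- coord x i) ^ \<alpha> (ix i) / fact (\<alpha> (ix i)))
        = (\<Prod>l\<in>UNIV. (- x $ l) ^ \<alpha> l / fact (\<alpha> l))"
      unfolding coord_def by (rule prod.reindex_bij_betw[OF ix_bij])
    also have "\<dots> = (\<Prod>l\<in>UNIV. (- 1) ^ \<alpha> l * (x $ l) ^ \<alpha> l / fact (\<alpha> l))"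
      by (intro prod.cong refl) (simp add: power_minus[of "x $ _"])
    also have "\<dots> = (- 1) ^ (\<Sum>l\<in>UNIV. \<alpha> l) * (\<Prod>l\<in>UNIV. (x $ l) ^ \<alpha> l) / (\<Prod>l\<in>UNIV. fact (\<alpha> l))"
      by (simp add: prod_dividef prod.distrib power_sum)
    finally show "?g \<alpha> = v \<bullet> ((\<Prod>i=1..CARD('n). (- coord x i) ^ \<alpha> (ix i) / fact (\<alpha> (ix i))) *\<^sub>R X j (?L \<alpha> @ []))"
      unfolding extremal_coeff_eq[OF j] append_Nil2 by simp
  qed
  also have "\<dots> = v \<bullet> Phi N (X j) x"
    unfolding Phi_def flows_expand[OF u order_refl] inner_sum_right ..
  finally show ?thesis .
qed

end

section \<open>Absolutely continuous paths\<close>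

text \<open>Over a fine subdivision the increments telescope to a total of at most \<epsilon> times
  that of \<open>A\<close>, for every \<epsilon>. This stands in for the constancy of absolutely
  continuous functions with derivative zero almost everywhere.\<close>

lemma const_of_small_increments:
  fixes Q :: "real \<Rightarrow> 'a::real_normed_vector" and A :: "real \<Rightarrow> real"
  assumes small: "\<And>\<epsilon>. 0 < \<epsilon> \<Longrightarrow> \<exists>\<delta>>0. \<forall>s t. 0 \<le> s \<and> s \<le> t \<and> t \<le> 1 \<and> t - s < \<delta> \<longrightarrow>
      norm (Q t - Q s) \<le> \<epsilon> * (A t - A s)"
    and t: "t \<in> {0..1}"
  shows "Q t = Q 0"
proof -
  have le: "norm (Q t - Q 0) \<le> \<epsilon> * (A t - A 0)" if \<epsilon>: "0 < \<epsilon>" for \<epsilon>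
  proof -
    obtain \<delta> where \<delta>: "0 < \<delta>" "\<And>s t. 0 \<le> s \<Longrightarrow> s \<le> t \<Longrightarrow> t \<le> 1 \<Longrightarrow> t - s < \<delta> \<Longrightarrow>
        norm (Q t - Q s) \<le> \<epsilon> * (A t - A s)"
      using small[OF \<epsilon>] by auto
    obtain n :: nat where n: "1 / \<delta> < real n" using reals_Archimedean2 by blast
    then have n0: "0 < real n" using \<delta>(1) by (meson divide_pos_pos less_trans zero_less_one)
    have tn: "t / real n < \<delta>"
    proof -
      have "t / real n \<le> 1 / real n" using t n0 by (simp add: divide_right_mono)
      also have "\<dots> < \<delta>" using n n0 \<delta>(1) by (simp add: field_simps)
      finally show ?thesis .
    qed
    have step: "norm (Q (real k * (t / real n)) - Q 0) \<le> \<epsilon> * (A (real k * (t / real n)) - A 0)" if "k \<le> n" for k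
      using that
    proof (induction k)
      case (Suc k)
      let ?s = "real k * (t / real n)" and ?t = "real (Suc k) * (t / real n)"
      have ts: "?t - ?s = t / real n" by (simp add: algebra_simps add_divide_distrib)
      have "?t \<le> real n * (t / real n)"
        by (rule mult_right_mono) (use Suc.prems t n0 in auto)
      also have "real n * (t / real n) = t" using n0 by simp
      finally have "?t \<le> 1" using t by (meson atLeastAtMost_iff order_trans)
      moreover have pos: "0 \<le> t / real n" using t n0 by simp
      moreover have "0 \<le> ?s" by (rule mult_nonneg_nonneg[OF _ pos]) simp
      moreover have "?s \<le> ?t" using ts pos by linarith
      ultimately have "norm (Q ?t - Q ?s) \<le> \<epsilon> * (A ?t - A ?s)"
        using \<delta>(2)[of ?s ?t, unfolded ts] tn by iprover
      moreover have "norm (Q ?t - Q 0) \<le> norm (Q ?t - Q ?s) + norm (Q ?s - Q 0)"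
        using norm_triangle_ineq[of "Q ?t - Q ?s" "Q ?s - Q 0"] by simp
      moreover have "norm (Q ?s - Q 0) \<le> \<epsilon> * (A ?s - A 0)" using Suc by simp
      moreover have "\<epsilon> * (A ?t - A ?s) + \<epsilon> * (A ?s - A 0) = \<epsilon> * (A ?t - A 0)"
        by (simp add: algebra_simps)
      ultimately show ?case by linarith
    qed simp
    from step[of n] n0 show ?thesis by simp
  qed
  have "norm (Q t - Q 0) \<le> 0"
  proof (rule field_le_epsilon)
    fix e :: real assume e: "0 < e"
    let ?K = "\<bar>A t - A 0\<bar> + 1"
    have "norm (Q t - Q 0) \<le> e / ?K * (A t - A 0)" by (rule le) (use e in auto)
    also have "\<dots> \<le> e / ?K * ?K" by (rule mult_left_mono) (use e in auto)
    also have "\<dots> = e" by simp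
    finally show "norm (Q t - Q 0) \<le> 0 + e" by simp
  qed
  then show ?thesis by simp
qed

text \<open>Absolute continuity with density \<open>f\<close>, expressed by integrals so that no
  derivative of \<open>y\<close> has to exist at given times.\<close>

definition ac_path :: "(real \<Rightarrow> 'a::euclidean_space) \<Rightarrow> (real \<Rightarrow> 'a) \<Rightarrow> bool" where
  "ac_path y f \<longleftrightarrow> f absolutely_integrable_on {0..1} \<and>
     (\<forall>t\<in>{0..1}. (f has_integral (y t - y 0)) {0..t})"

lemma ac_pathI:
  assumes "f absolutely_integrable_on {0..1}"
    "\<And>t. t \<in> {0..1} \<Longrightarrow> (f has_integral (y t - y 0)) {0..t}"
  shows "ac_path y f"
  using assms by (auto simp: ac_path_def)

lemma ac_pathD:
  assumes "ac_path y f"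
  shows "f absolutely_integrable_on {0..1}" "t \<in> {0..1} \<Longrightarrow> (f has_integral (y t - y 0)) {0..t}"
  using assms by (auto simp: ac_path_def)

lemma ac_path_integrable:
  assumes "ac_path y f" "0 \<le> s" "t \<le> 1"
  shows "f absolutely_integrable_on {s..t}" "f integrable_on {s..t}"
proof -
  show "f absolutely_integrable_on {s..t}"
    by (rule absolutely_integrable_on_subinterval[OF ac_pathD(1)[OF assms(1)]]) (use assms in auto)
  then show "f integrable_on {s..t}" by (rule set_lebesgue_integral_eq_integral(1))
qed

lemma ac_path_increment:
  assumes y: "ac_path y f" and "0 \<le> s" "s \<le> t" "t \<le> 1"
  shows "y t - y s = integral {s..t} f"
proof -
  have "integral {0..s} f + integral {s..t} f = integral {0..t} f"
    by (rule Henstock_Kurzweil_Integration.integral_combine[OF _ _ ac_path_integrable(2)[OF y]]) (use assms in auto)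
  moreover have "integral {0..s} f = y s - y 0" "integral {0..t} f = y t - y 0"
    by (rule integral_unique, rule ac_pathD(2)[OF y], use assms in simp)+
  ultimately show ?thesis by (metis add_diff_cancel_left' diff_add_cancel diff_diff_eq2 add_diff_eq)
qed

lemma ac_path_continuous: "ac_path y f \<Longrightarrow> continuous_on {0..1} y"
proof -
  assume y: "ac_path y f"
  have "continuous_on {0..1} (\<lambda>t. y 0 + integral {0..t} f)"
    by (intro continuous_intros indefinite_integral_continuous_1 ac_path_integrable(2)[OF y]) auto
  moreover have "y 0 + integral {0..t} f = y t" if "t \<in> {0..1}" for t
  proof -
    have "integral {0..t} f = y t - y 0"
      by (rule ac_path_increment[OF y, symmetric]) (use that in auto)
    then show ?thesis by simp
  qed
  ultimately show ?thesis by (rule continuous_on_eq)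
qed

lemma ac_path_norm_increment:
  assumes y: "ac_path y f" and "0 \<le> s" "s \<le> t" "t \<le> 1"
  shows "norm (y t - y s) \<le> integral {s..t} (\<lambda>\<tau>. norm (f \<tau>))"
  unfolding ac_path_increment[OF assms]
proof (rule integral_norm_bound_integral)
  have a: "f absolutely_integrable_on {s..t}" by (rule ac_path_integrable[OF y]) (use assms in auto)
  then show "f integrable_on {s..t}" "(\<lambda>\<tau>. norm (f \<tau>)) integrable_on {s..t}"
    by (auto simp: absolutely_integrable_on_def)
qed simp

lemma absolutely_integrable_scaleR_continuous:
  fixes a :: "real \<Rightarrow> 'b::euclidean_space"
  assumes "continuous_on {0..1} a" "g absolutely_integrable_on {0..1::real}"
  shows "(\<lambda>t. g t *\<^sub>R a t) absolutely_integrable_on {0..1}"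
proof (rule absolutely_integrable_bounded_measurable_product[where h="\<lambda>a c. c *\<^sub>R a" and f=a and g=g])
  show "bilinear (\<lambda>a c. c *\<^sub>R (a::'b))"
    by (auto simp: bilinear_def linear_iff algebra_simps)
  show "a \<in> borel_measurable (lebesgue_on {0..1})"
    by (rule continuous_imp_measurable_on_sets_lebesgue[OF assms(1)]) simp
  show "bounded (a ` {0..1})"
    by (intro compact_imp_bounded compact_continuous_image assms(1) compact_Icc)
qed (use assms in auto)

lemma linear_expand: "linear T \<Longrightarrow> T u = (\<Sum>i\<in>Basis. (u \<bullet> i) *\<^sub>R T i)"
  for T :: "'a::euclidean_space \<Rightarrow> 'b::real_vector"
  using linear_sum[of T "\<lambda>i. (u \<bullet> i) *\<^sub>R i" Basis]
  by (simp add: euclidean_representation linear_cmul)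

lemma absolutely_integrable_linear_family:
  fixes T :: "real \<Rightarrow> 'a::euclidean_space \<Rightarrow> 'b::euclidean_space"
  assumes T: "\<And>t. linear (T t)" and c: "\<And>u. continuous_on {0..1} (\<lambda>t. T t u)"
    and f: "f absolutely_integrable_on {0..1}"
  shows "(\<lambda>t. T t (f t)) absolutely_integrable_on {0..1}"
proof -
  have "(\<lambda>t. \<Sum>i\<in>Basis. (f t \<bullet> i) *\<^sub>R T t i) absolutely_integrable_on {0..1}"
  proof (intro absolutely_integrable_sum absolutely_integrable_scaleR_continuous c finite_Basis)
    fix i :: 'a
    show "(\<lambda>t. f t \<bullet> i) absolutely_integrable_on {0..1}"
      using absolutely_integrable_linear[OF f bounded_linear_inner_left[of i]] by (simp add: o_def)
  qed
  then show ?thesis by (simp add: linear_expand[OF T, symmetric])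
qed

text \<open>Uniform continuity of each column of the derivative on a compact set; the tolerance is
  shared among the basis directions.\<close>

lemma uniform_derivative:
  fixes F' :: "'a::euclidean_space \<Rightarrow> 'a \<Rightarrow> 'b::real_normed_vector"
  assumes lin: "\<And>x. linear (F' x)" and c: "\<And>u. continuous_on UNIV (\<lambda>x. F' x u)"
    and K: "compact K" and \<epsilon>: "0 < \<epsilon>"
  obtains \<delta> where "0 < \<delta>"
    "\<And>x x' u. x \<in> K \<Longrightarrow> x' \<in> K \<Longrightarrow> dist x x' < \<delta> \<Longrightarrow> norm (F' x u - F' x' u) \<le> \<epsilon> * norm u"
proof -
  let ?e = "\<epsilon> / real (DIM('a))"
  have "\<exists>\<delta>>0. \<forall>x\<in>K. \<forall>x'\<in>K. dist x' x < \<delta> \<longrightarrow> dist (F' x' i) (F' x i) < ?e" for i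
    using compact_uniformly_continuous[OF continuous_on_subset[OF c[of i] subset_UNIV] K] \<epsilon>
    unfolding uniformly_continuous_on_def by simp
  then obtain \<delta> where \<delta>: "\<And>i. 0 < \<delta> i"
    "\<And>i x x'. x \<in> K \<Longrightarrow> x' \<in> K \<Longrightarrow> dist x' x < \<delta> i \<Longrightarrow> dist (F' x' i) (F' x i) < ?e"
    by metis
  show ?thesis
  proof
    show "0 < Min (\<delta> ` (Basis :: 'a set))" using \<delta>(1) by simp
    fix x x' u assume x: "x \<in> K" "x' \<in> K" "dist x x' < Min (\<delta> ` (Basis :: 'a set))"
    have "norm (F' x u - F' x' u) = norm (\<Sum>i\<in>Basis. (u \<bullet> i) *\<^sub>R (F' x i - F' x' i))"
      by (simp add: linear_expand[OF lin, of _ u] scaleR_diff_right sum_subtractf)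
    also have "\<dots> \<le> (\<Sum>i\<in>(Basis::'a set). norm u * ?e)"
    proof (rule sum_norm_le)
      fix i :: 'a assume i: "i \<in> Basis"
      then have "dist x x' < \<delta> i" using x(3) by simp
      then have "norm (F' x i - F' x' i) \<le> ?e" using \<delta>(2)[OF x(2,1)] by (simp add: dist_norm less_imp_le)
      then show "norm ((u \<bullet> i) *\<^sub>R (F' x i - F' x' i)) \<le> norm u * ?e"
        unfolding norm_scaleR by (intro mult_mono Basis_le_norm i) auto
    qed
    also have "\<dots> = \<epsilon> * norm u" by simp
    finally show "norm (F' x u - F' x' u) \<le> \<epsilon> * norm u" .
  qed
qed

lemma linearization_error:
  fixes F :: "'a::euclidean_space \<Rightarrow> 'b::real_normed_vector"
  assumes F: "\<And>x. (F has_derivative F' x) (at x)"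
    and S: "convex S" "p \<in> S" "q \<in> S" and "0 \<le> B"
    and B: "\<And>x u. x \<in> S \<Longrightarrow> norm (F' x u - F' p u) \<le> B * norm u"
  shows "norm (F q - F p - F' p (q - p)) \<le> B * norm (q - p)"
proof -
  have "norm (F q - F p - F' p (q - p)) \<le> norm (q - p) * B"
  proof (rule differentiable_bound_linearization[where S=S])
    show "p + t *\<^sub>R (q - p) \<in> S" if "t \<in> {0..1}" for t
      using convexD_alt[OF S(1) S(2) S(3), of t] that by (simp add: algebra_simps)
    show "(F has_derivative F' x) (at x within S)" for x by (rule has_derivative_at_withinI[OF F])
    show "onorm (F' x - F' p) \<le> B" if "x \<in> S" for x
      using B[OF that] by (intro onorm_le) simp
  qed (rule S)
  then show ?thesis by (simp add: mult.commute)
qed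

text \<open>Chain rule for absolutely continuous paths. On a short interval, F \<circ> y minus the
  integral of its expected density changes by at most \<epsilon> times the integral of |f|: one half
  is the linearization error of \<open>F\<close>, the other the oscillation of its derivative along
  \<open>y\<close>.\<close>

lemma ac_path_compose:
  fixes F :: "'a::euclidean_space \<Rightarrow> 'b::euclidean_space"
  assumes y: "ac_path y f" and F: "\<And>x. (F has_derivative F' x) (at x)"
    and c: "\<And>u. continuous_on UNIV (\<lambda>x. F' x u)"
  shows "ac_path (\<lambda>t. F (y t)) (\<lambda>t. F' (y t) (f t))"
proof -
  let ?G = "\<lambda>t. F' (y t) (f t)"
  note lin = has_derivative_linear[OF F]
  note cy = ac_path_continuous[OF y]
  have G: "?G absolutely_integrable_on {0..1}"
    by (rule absolutely_integrable_linear_family[where T="\<lambda>t. F' (y t)", OF lin _ ac_pathD(1)[OF y]])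
       (rule continuous_on_compose2[OF c cy subset_UNIV])
  have Gi: "?G integrable_on {s..t}" if "0 \<le> s" "t \<le> 1" for s t
    using absolutely_integrable_on_subinterval[OF G, of s t] that
    by (intro set_lebesgue_integral_eq_integral(1)) auto
  have fi: "f integrable_on {s..t}" "(\<lambda>\<tau>. norm (f \<tau>)) integrable_on {s..t}" if "0 \<le> s" "t \<le> 1" for s t
    using ac_path_integrable(1)[OF y that] by (auto simp: absolutely_integrable_on_def)
  have "bounded (y ` {0..1})"
    by (intro compact_imp_bounded compact_continuous_image cy compact_Icc)
  then obtain R where "\<forall>x\<in>y ` {0..1}. norm x \<le> R"
    unfolding bounded_iff by (rule exE)
  then have R: "y t \<in> cball 0 R" if "t \<in> {0..1}" for t using that by simp
  define Q where "Q t = F (y t) - integral {0..t} ?G" for t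
  define A where "A t = integral {0..t} (\<lambda>\<tau>. norm (f \<tau>))" for t
  have Q: "Q t = Q 0" if "t \<in> {0..1}" for t
  proof (rule const_of_small_increments[OF _ that])
    fix \<epsilon> :: real assume \<epsilon>: "0 < \<epsilon>"
    then have "0 < \<epsilon> / 2" by simp
    obtain \<delta>1 where \<delta>1: "0 < \<delta>1" "\<And>x x' u. x \<in> cball 0 R \<Longrightarrow> x' \<in> cball 0 R \<Longrightarrow> dist x x' < \<delta>1 \<Longrightarrow>
        norm (F' x u - F' x' u) \<le> \<epsilon> / 2 * norm u"
      by (rule uniform_derivative[OF lin c compact_cball \<open>0 < \<epsilon> / 2\<close>, of 0 R]) (rule that; assumption)
    have "uniformly_continuous_on {0..1} y"
      by (rule compact_uniformly_continuous[OF cy compact_Icc])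
    then obtain \<delta> where \<delta>: "0 < \<delta>" "\<And>s t. s \<in> {0..1} \<Longrightarrow> t \<in> {0..1} \<Longrightarrow> dist t s < \<delta> \<Longrightarrow> dist (y t) (y s) < \<delta>1"
      unfolding uniformly_continuous_on_def using \<delta>1(1) by meson
    show "\<exists>\<delta>>0. \<forall>s t. 0 \<le> s \<and> s \<le> t \<and> t \<le> 1 \<and> t - s < \<delta> \<longrightarrow> norm (Q t - Q s) \<le> \<epsilon> * (A t - A s)"
    proof (intro exI conjI allI impI)
      show "0 < \<delta>" by (rule \<delta>(1))
      fix s t assume st: "0 \<le> s \<and> s \<le> t \<and> t \<le> 1 \<and> t - s < \<delta>"
      let ?A = "integral {s..t} (\<lambda>\<tau>. norm (f \<tau>))"
      have near: "dist (y \<tau>) (y s) < \<delta>1" "y \<tau> \<in> cball 0 R" if "\<tau> \<in> {s..t}" for \<tau>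
        using \<delta>(2)[of s \<tau>] R[of \<tau>] st that by (auto simp: dist_real_def)
      have sR: "y s \<in> cball 0 R" using R[of s] st by simp
      have 1: "norm (F (y t) - F (y s) - F' (y s) (y t - y s)) \<le> \<epsilon> / 2 * norm (y t - y s)"
      \<comment> \<open>The intersection is convex, contains both endpoints and stays where
        \<open>\<delta>1\<close> controls the derivative.\<close>
      proof (rule linearization_error[OF F, where S="cball 0 R \<inter> ball (y s) \<delta>1"])
        show "y t \<in> cball 0 R \<inter> ball (y s) \<delta>1" using near[of t] st by (simp add: dist_commute)
        show "y s \<in> cball 0 R \<inter> ball (y s) \<delta>1" using sR \<delta>1(1) by simp
        show "norm (F' x u - F' (y s) u) \<le> \<epsilon> / 2 * norm u" if "x \<in> cball 0 R \<inter> ball (y s) \<delta>1" for x u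
          by (rule \<delta>1(2)) (use that sR in \<open>auto simp: dist_commute\<close>)
      qed (use \<epsilon> in \<open>auto intro!: convex_Int\<close>)
      have "norm (y t - y s) \<le> ?A"
        by (rule ac_path_norm_increment[OF y]) (use st in auto)
      then have e1: "norm (F (y t) - F (y s) - F' (y s) (y t - y s)) \<le> \<epsilon> / 2 * ?A"
        by (rule order_trans[OF 1 mult_left_mono]) (use \<epsilon> in simp)
      have bl: "bounded_linear (F' (y s))" using lin by (rule linear_conv_bounded_linear[THEN iffD1])
      have fst: "f integrable_on {s..t}" "?G integrable_on {s..t}" using fi Gi st by auto
      have int: "F' (y s) (y t - y s) = integral {s..t} (\<lambda>\<tau>. F' (y s) (f \<tau>))"
        using integral_linear[OF fst(1) bl] ac_path_increment[OF y, of s t] st by (simp add: o_def)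
      have Fi: "(\<lambda>\<tau>. F' (y s) (f \<tau>)) integrable_on {s..t}"
        using integrable_linear[OF fst(1) bl] by (simp add: o_def)
      have "norm (integral {s..t} (\<lambda>\<tau>. F' (y s) (f \<tau>) - ?G \<tau>)) \<le> integral {s..t} (\<lambda>\<tau>. \<epsilon> / 2 * norm (f \<tau>))"
      proof (rule integral_norm_bound_integral)
        show "(\<lambda>\<tau>. F' (y s) (f \<tau>) - ?G \<tau>) integrable_on {s..t}" by (rule integrable_diff[OF Fi fst(2)])
        show "(\<lambda>\<tau>. \<epsilon> / 2 * norm (f \<tau>)) integrable_on {s..t}"
          by (rule integrable_cmul[where c="\<epsilon> / 2", OF fi(2), unfolded real_scaleR_def]) (use st in auto)
        fix \<tau> assume \<tau>: "\<tau> \<in> {s..t}"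
        show "norm (F' (y s) (f \<tau>) - ?G \<tau>) \<le> \<epsilon> / 2 * norm (f \<tau>)"
          by (rule \<delta>1(2)[OF sR near(2)[OF \<tau>]]) (use near(1)[OF \<tau>] in \<open>simp add: dist_commute\<close>)
      qed
      then have 2: "norm (F' (y s) (y t - y s) - integral {s..t} ?G) \<le> \<epsilon> / 2 * ?A"
        unfolding int integral_diff[OF Fi fst(2)] by simp
      have Q: "Q t - Q s = F (y t) - F (y s) - integral {s..t} ?G"
      proof -
        have "integral {0..s} ?G + integral {s..t} ?G = integral {0..t} ?G"
          by (rule Henstock_Kurzweil_Integration.integral_combine) (use st Gi in auto)
        then show ?thesis unfolding Q_def by (simp add: algebra_simps)
      qed
      have A: "A t - A s = ?A"
      proof -
        have "A s + ?A = A t" unfolding A_def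
          by (rule Henstock_Kurzweil_Integration.integral_combine) (use st fi in auto)
        then show ?thesis by simp
      qed
      have "norm (Q t - Q s) \<le> norm (F (y t) - F (y s) - F' (y s) (y t - y s))
          + norm (F' (y s) (y t - y s) - integral {s..t} ?G)"
        unfolding Q using norm_triangle_ineq[of "F (y t) - F (y s) - F' (y s) (y t - y s)"
            "F' (y s) (y t - y s) - integral {s..t} ?G"] by simp
      also have "\<dots> \<le> \<epsilon> * (A t - A s)" unfolding A using e1 2 by simp
      finally show "norm (Q t - Q s) \<le> \<epsilon> * (A t - A s)" .
    qed
  qed
  have "(?G has_integral (F (y t) - F (y 0))) {0..t}" if t: "t \<in> {0..1}" for t
  proof -
    have "Q 0 = F (y 0)" by (simp add: Q_def)
    then have "F (y t) - integral {0..t} ?G = F (y 0)" using Q[OF t] by (simp only: Q_def)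
    then have eq: "F (y t) - F (y 0) = integral {0..t} ?G" by (simp only: diff_eq_eq add.commute eq_diff_eq)
    have "?G integrable_on {0..t}" by (rule Gi) (use t in auto)
    then show ?thesis unfolding eq by (rule integrable_integral)
  qed
  with G show ?thesis by (rule ac_pathI)
qed

lemma ac_path_Pair:
  assumes "ac_path y f" "ac_path z g"
  shows "ac_path (\<lambda>t. (y t, z t)) (\<lambda>t. (f t, g t))"
proof -
  have e: "(f t, g t) = (f t, 0) + (0, g t)" for t by simp
  have bl: "bounded_linear (\<lambda>x. (x, 0))" "bounded_linear (\<lambda>x. (0, x))"
    by (intro bounded_linear_Pair bounded_linear_ident bounded_linear_zero)+
  have "(\<lambda>t. (f t, 0) + (0, g t)) absolutely_integrable_on {0..1}"
    using absolutely_integrable_linear[OF ac_pathD(1)[OF assms(1)] bl(1)]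
      absolutely_integrable_linear[OF ac_pathD(1)[OF assms(2)] bl(2)]
    by (intro set_integral_add) (simp_all add: o_def)
  moreover have "((\<lambda>t. (f t, 0) + (0, g t)) has_integral (y t - y 0, 0) + (0, z t - z 0)) {0..t}" if "t \<in> {0..1}" for t
    using has_integral_linear[OF ac_pathD(2)[OF assms(1) that] bl(1)]
      has_integral_linear[OF ac_pathD(2)[OF assms(2) that] bl(2)]
    by (intro has_integral_add) (simp_all add: o_def)
  ultimately show ?thesis unfolding ac_path_def by simp
qed

lemma ac_path_spike:
  assumes "ac_path y f" "negligible N" "\<And>t. t \<in> {0..1} - N \<Longrightarrow> g t = f t"
  shows "ac_path y g"
proof (rule ac_pathI)
  show "g absolutely_integrable_on {0..1}"
    by (rule absolutely_integrable_spike_eq[OF assms(2,3), THEN iffD1], assumption)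
       (rule ac_pathD(1)[OF assms(1)])
  show "(g has_integral (y t - y 0)) {0..t}" if t: "t \<in> {0..1}" for t
  proof (rule has_integral_spike[OF assms(2) _ ac_pathD(2)[OF assms(1) t]])
    show "g x = f x" if "x \<in> {0..t} - N" for x
      by (rule assms(3)) (use that t in simp)
  qed
qed

lemma AE_lebesgue_on_negligible:
  assumes "AE t in lebesgue_on S. P t" "S \<in> sets lebesgue"
  shows "negligible {t \<in> S. \<not> P t}"
proof -
  have "AE t in lebesgue. t \<in> S \<longrightarrow> P t"
    using assms by (simp add: AE_restrict_space_iff)
  then obtain N where N: "{t \<in> space lebesgue. \<not> (t \<in> S \<longrightarrow> P t)} \<subseteq> N" "N \<in> null_sets lebesgue"
    unfolding eventually_ae_filter by (elim bexE) (rule that; assumption)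
  have "negligible N" using N(2) by (simp add: negligible_iff_null_sets)
  then show ?thesis by (rule negligible_subset) (use N(1) in auto)
qed

lemma has_vector_derivative_quotient_sequence:
  assumes "(g has_vector_derivative g') (at x)"
  shows "(\<lambda>n. real (Suc n) *\<^sub>R (g (x + 1 / real (Suc n)) - g x)) \<longlonglongrightarrow> g'"
proof -
  let ?h = "\<lambda>n. x + 1 / real (Suc n)"
  have "((\<lambda>z. norm ((g z - g x) - (z - x) *\<^sub>R g') / norm (z - x)) \<longlongrightarrow> 0) (at x)"
    using assms unfolding has_vector_derivative_def has_derivative_iff_norm by (rule conjunct2)
  moreover have "filterlim ?h (at x) sequentially"
    unfolding filterlim_at
  proof
    have "(\<lambda>n. x + 1 / real (Suc n)) \<longlonglongrightarrow> x + 0"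
      by (intro tendsto_intros LIMSEQ_Suc[OF lim_1_over_n])
    then show "?h \<longlonglongrightarrow> x" by simp
  qed simp
  ultimately have lim: "(\<lambda>n. norm ((g (?h n) - g x) - (?h n - x) *\<^sub>R g') / norm (?h n - x)) \<longlonglongrightarrow> 0"
    by (rule filterlim_compose)
  have "norm ((g (?h n) - g x) - (?h n - x) *\<^sub>R g') / norm (?h n - x)
      = norm (real (Suc n) *\<^sub>R (g (?h n) - g x) - g')" for n
  proof -
    have "real (Suc n) *\<^sub>R (g (?h n) - g x) - g'
        = real (Suc n) *\<^sub>R ((g (?h n) - g x) - (1 / real (Suc n)) *\<^sub>R g')"
      by (simp add: scaleR_diff_right)
    then show ?thesis by (simp only: add_diff_cancel_left' norm_scaleR) (simp del: of_nat_Suc)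
  qed
  with lim have "(\<lambda>n. norm (real (Suc n) *\<^sub>R (g (?h n) - g x) - g')) \<longlonglongrightarrow> 0" by (simp only:)
  then show ?thesis by (simp only: tendsto_norm_zero_iff LIM_zero_iff)
qed

text \<open>Forward difference quotients are bounded by \<open>C\<close> and converge almost
  everywhere to \<open>f\<close>. Their integrals are differences of local averages of
  \<open>y\<close>, which tend to y t - y 0, so dominated convergence applies.\<close>

lemma lipschitz_ac_path:
  fixes y :: "real \<Rightarrow> 'a::euclidean_space"
  assumes lip: "C-lipschitz_on {0..1} y"
    and ae: "AE t in lebesgue_on {0..1}. (y has_vector_derivative f t) (at t)"
  shows "ac_path y f"
proof -
  \<comment> \<open>The constant continuation beyond \<open>{0..1}\<close> makes forward quotients
    available at all times and keeps the Lipschitz constant.\<close>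
  define Y where "Y t = y (max 0 (min 1 t))" for t :: real
  have Y: "Y t = y t" if "t \<in> {0..1}" for t using that by (simp add: Y_def)
  have C: "0 \<le> C" using lip by (rule lipschitz_on_nonneg)
  have lipY: "norm (Y t - Y s) \<le> C * \<bar>t - s\<bar>" for s t
  proof -
    have "norm (Y t - Y s) \<le> C * \<bar>max 0 (min 1 t) - max 0 (min 1 s)\<bar>"
      unfolding Y_def using lipschitz_onD[OF lip, of "max 0 (min 1 t)" "max 0 (min 1 s)"]
      by (simp add: dist_norm)
    also have "\<dots> \<le> C * \<bar>t - s\<bar>" by (rule mult_left_mono[OF _ C]) (auto simp: max_def min_def)
    finally show ?thesis .
  qed
  have contY: "continuous_on S Y" for S
    by (rule lipschitz_on_continuous_on[of C]) (auto simp: lipschitz_on_def dist_norm C lipY)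
  \<comment> \<open>The endpoints are included because the continuation may fail to be
    differentiable there.\<close>
  define N where "N = {t \<in> {0..1}. \<not> (y has_vector_derivative f t) (at t)} \<union> {0, 1}"
  have N: "negligible N"
    unfolding N_def by (intro negligible_Un AE_lebesgue_on_negligible[OF ae]) auto
  define q where "q n t = real (Suc n) *\<^sub>R (Y (t + 1 / real (Suc n)) - Y t)" for n t
  \<comment> \<open>Starting the primitive at -1 makes all times in \<open>{0..2}\<close>, which the
    quotients reach, interior points.\<close>
  define I where "I t = integral {-1..t} Y" for t
  have I: "(I has_vector_derivative Y t) (at t)" if "t \<in> {0..2}" for t
  proof -
    have eq: "I = (\<lambda>u. integral {-1..u} Y)" by (rule ext) (rule I_def)
    have "(I has_vector_derivative Y t) (at t within {-1..3})"
      unfolding eq by (rule integral_has_vector_derivative[OF contY]) (use that in simp)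
    moreover have "at t within {-1..3} = at t"
      by (rule at_within_interior) (use that in simp)
    ultimately show ?thesis by (simp only:)
  qed
  define W where "W n t = real (Suc n) *\<^sub>R (I (t + 1 / real (Suc n)) - I t)" for n t
  have W: "(W n has_vector_derivative q n t) (at t)" if "t \<in> {0..1}" for n t
  proof -
    have s: "((\<lambda>t. t + 1 / real (Suc n)) has_vector_derivative 1) (at t)"
      unfolding has_real_derivative_iff_has_vector_derivative[symmetric]
      by (rule derivative_eq_intros refl | simp)+
    have le: "1 / real (Suc n) \<le> 1" by simp
    have ge: "0 \<le> 1 / real (Suc n)" by simp
    have "t + 1 / real (Suc n) \<in> {0..2}"
      using that le ge unfolding atLeastAtMost_iff by linarith
    from vector_diff_chain_at[OF s I[OF this]]
    have 1: "((\<lambda>t. I (t + 1 / real (Suc n))) has_vector_derivative Y (t + 1 / real (Suc n))) (at t)"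
      by (simp add: o_def)
    have 2: "(I has_vector_derivative Y t) (at t)" by (rule I) (use that in auto)
    have "((\<lambda>t. real (Suc n) *\<^sub>R (I (t + 1 / real (Suc n)) - I t)) has_vector_derivative q n t) (at t)"
      unfolding q_def
      by (rule bounded_linear.has_vector_derivative[OF bounded_linear_scaleR_right
          has_vector_derivative_diff[OF 1 2]])
    moreover have "W n = (\<lambda>t. real (Suc n) *\<^sub>R (I (t + 1 / real (Suc n)) - I t))"
      by (rule ext) (rule W_def)
    ultimately show ?thesis by (simp only:)
  qed
  have q_int: "(q n has_integral (W n t - W n 0)) {0..t}" if "t \<in> {0..1}" for n t
  proof (rule fundamental_theorem_of_calculus)
    show "(W n has_vector_derivative q n x) (at x within {0..t})" if "x \<in> {0..t}" for x
      by (rule has_vector_derivative_at_within[OF W]) (use that \<open>t \<in> {0..1}\<close> in auto)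
  qed (use that in auto)
  define f0 where "f0 t = (if t \<in> N then 0 else f t)" for t
  define q0 where "q0 n t = (if t \<in> N then 0 else q n t)" for n t
  have q0_int: "(q0 n has_integral (W n t - W n 0)) {0..t}" if "t \<in> {0..1}" for n t
    by (rule has_integral_spike[OF N _ q_int[OF that]]) (simp add: q0_def)
  have bound: "norm (q0 n t) \<le> C" for n t
  proof -
    have "norm (q n t) \<le> real (Suc n) * (C * \<bar>(t + 1 / real (Suc n)) - t\<bar>)"
      unfolding q_def norm_scaleR by (intro mult_mono lipY) auto
    also have "\<dots> = C" by simp
    finally show ?thesis unfolding q0_def using C by simp
  qed
  have conv: "(\<lambda>n. q0 n t) \<longlonglongrightarrow> f0 t" if t: "t \<in> {0..1}" for t
  proof (cases "t \<in> N")
    case False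
    then have d: "(y has_vector_derivative f t) (at t)" and t01: "t \<in> {0<..<1}"
      using t by (auto simp: N_def)
    have "(Y has_vector_derivative f t) (at t)"
      by (rule has_vector_derivative_transform_within_open[OF d open_greaterThanLessThan t01]) (simp add: Y)
    from has_vector_derivative_quotient_sequence[OF this] show ?thesis
      using False by (simp add: q0_def f0_def q_def)
  qed (simp add: q0_def f0_def)
  have f0: "(f0 has_integral (y t - y 0)) {0..t}" if t: "t \<in> {0..1}" for t
  proof -
    have dc: "f0 integrable_on {0..t}" "(\<lambda>n. integral {0..t} (q0 n)) \<longlonglongrightarrow> integral {0..t} f0"
    proof (rule_tac [!] dominated_convergence[where h="\<lambda>_. C" and f=q0])
      show "q0 n integrable_on {0..t}" for n using q0_int[OF t] by (rule has_integral_integrable)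
      show "(\<lambda>_. C) integrable_on {0..t}" by (rule integrable_const_ivl)
      show "q0 n integrable_on {0..t}" for n using q0_int[OF t] by (rule has_integral_integrable)
      show "(\<lambda>_. C) integrable_on {0..t}" by (rule integrable_const_ivl)
    qed (use bound conv t in auto)
    have "integral {0..t} (q0 n) = W n t - W n 0" for n by (rule integral_unique[OF q0_int[OF t]])
    moreover have "(\<lambda>n. W n t - W n 0) \<longlonglongrightarrow> Y t - Y 0"
      unfolding W_def
      by (intro tendsto_diff has_vector_derivative_quotient_sequence[OF I]) (use t in auto)
    ultimately have "integral {0..t} f0 = Y t - Y 0"
      using LIMSEQ_unique[OF dc(2)] by simp
    then show ?thesis using integrable_integral[OF dc(1)] Y[OF t] Y[of 0] by simp
  qed
  have "f0 absolutely_integrable_on {0..1}"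
  proof (rule absolutely_integrable_integrable_bound[where g="\<lambda>_. C"])
    show "f0 integrable_on {0..1}" using f0[of 1] by (auto intro: has_integral_integrable)
    show "norm (f0 t) \<le> C" if "t \<in> {0..1}" for t
      by (rule Lim_bounded[OF tendsto_norm[OF conv[OF that]], of 0]) (simp add: bound)
  qed (rule integrable_const_ivl)
  from this f0 have "ac_path y f0" by (rule ac_pathI)
  then show ?thesis by (rule ac_path_spike[OF _ N]) (simp add: f0_def)
qed

lemma C1_lipschitz:
  fixes F :: "'a::euclidean_space \<Rightarrow> 'b::real_normed_vector"
  assumes F: "\<And>x. (F has_derivative F' x) (at x)" and c: "\<And>u. continuous_on UNIV (\<lambda>x. F' x u)"
    and K: "compact K" "convex K"
  obtains L where "L-lipschitz_on K F"
proof -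
  note lin = has_derivative_linear[OF F]
  have "\<exists>B. \<forall>x\<in>K. norm (F' x i) \<le> B" for i
  proof -
    have "bounded ((\<lambda>x. F' x i) ` K)"
      by (intro compact_imp_bounded compact_continuous_image K continuous_on_subset[OF c]) simp
    then show ?thesis unfolding bounded_iff by simp
  qed
  then obtain B where B: "\<And>i x. x \<in> K \<Longrightarrow> norm (F' x i) \<le> B i" by metis
  define L where "L = (\<Sum>i\<in>(Basis::'a set). \<bar>B i\<bar>)"
  have "norm (F' x u) \<le> L * norm u" if x: "x \<in> K" for x u
  proof -
    have "norm (F' x u) = norm (\<Sum>i\<in>Basis. (u \<bullet> i) *\<^sub>R F' x i)"
      using linear_expand[OF lin[of x], of u] by simp
    also have "\<dots> \<le> (\<Sum>i\<in>(Basis::'a set). norm u * \<bar>B i\<bar>)"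
    proof (rule sum_norm_le)
      fix i :: 'a assume i: "i \<in> Basis"
      have "norm (F' x i) \<le> \<bar>B i\<bar>" using B[OF x, of i] by simp
      then show "norm ((u \<bullet> i) *\<^sub>R F' x i) \<le> norm u * \<bar>B i\<bar>"
        unfolding norm_scaleR by (intro mult_mono Basis_le_norm i) auto
    qed
    also have "\<dots> = L * norm u" by (simp add: L_def sum_distrib_left mult.commute)
    finally show ?thesis .
  qed
  then have on: "onorm (F' x) \<le> L" if "x \<in> K" for x using that by (intro onorm_le) auto
  have "L-lipschitz_on K F"
  proof (rule lipschitz_onI)
    fix x y assume xy: "x \<in> K" "y \<in> K"
    have "norm (F x - F y) \<le> L * norm (x - y)"
      by (rule differentiable_bound[OF K(2) _ on _ _]) (use xy in \<open>auto intro: has_derivative_at_withinI F\<close>)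
    then show "dist (F x) (F y) \<le> L * dist x y" by (simp add: dist_norm)
  qed (simp add: L_def sum_nonneg)
  then show ?thesis by (rule that)
qed

lemma continuous_linear_family:
  fixes T :: "'a::topological_space \<Rightarrow> 'b::euclidean_space \<Rightarrow> 'c::real_normed_vector"
  assumes "\<And>x. linear (T x)" "\<And>u. continuous_on S (\<lambda>x. T x u)" "continuous_on S k"
  shows "continuous_on S (\<lambda>x. T x (k x))"
proof -
  have "continuous_on S (\<lambda>x. \<Sum>i\<in>Basis. (k x \<bullet> i) *\<^sub>R T x i)"
    by (intro continuous_intros assms)
  then show ?thesis by (simp add: linear_expand[OF assms(1), symmetric])
qed

section \<open>Left-invariant control equations\<close>

context lie_group_rn begin

lemma continuous_dmul: "continuous_on UNIV (\<lambda>p. dmul p q)"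
  by (rule smooth_map_continuous[OF smooth_dmul])

lemma continuous_dinv: "continuous_on UNIV (\<lambda>x. dinv x u)"
  unfolding dinv_def by (rule smooth_map_continuous[OF smooth_map_derivative[OF smooth_inv]])

lemma continuous_inv: "continuous_on UNIV invr"
  by (rule smooth_map_continuous[OF smooth_inv])

text \<open>The equation y' = X_w(y), in integrated form, for a left velocity \<open>w\<close> that
  varies with time.\<close>

definition driven :: "(real \<Rightarrow> 'a) \<Rightarrow> (real \<Rightarrow> 'a) \<Rightarrow> bool" where
  "driven w y \<longleftrightarrow> ac_path y (\<lambda>t. field (w t) (y t))"

text \<open>As in \<open>integral_curve_unique\<close>, the quotient of the two paths has velocity
  zero, now by the chain rule for integrals.\<close>

lemma driven_unique:
  assumes "driven w y" "driven w z" "y 0 = z 0" "t \<in> {0..1}"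
  shows "y t = z t"
proof -
  let ?F = "\<lambda>p. fst p \<cdot> invr (snd p)"
  let ?F' = "\<lambda>p d. dmul (fst p, invr (snd p)) (fst d, dinv (snd p) (snd d))"
  have F: "(?F has_derivative ?F' p) (at p)" for p
    by (intro has_derivative_mul_compose has_derivative_inv_compose has_derivative_fst has_derivative_snd
        has_derivative_ident)
  have cF: "continuous_on UNIV (\<lambda>p. ?F' p u)" for u
  proof (rule continuous_linear_family[where T="\<lambda>p. dmul (fst p, invr (snd p))"
        and k="\<lambda>p. (fst u, dinv (snd p) (snd u))"])
    show "continuous_on UNIV (\<lambda>p. dmul (fst p, invr (snd p)) q)" for q
      by (rule continuous_on_compose2[OF continuous_dmul]) (intro continuous_intros continuous_on_compose2[OF continuous_inv] subset_UNIV)+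
    show "continuous_on UNIV (\<lambda>p. (fst u, dinv (snd p) (snd u)))"
      by (intro continuous_intros continuous_on_compose2[OF continuous_dinv] subset_UNIV)
  qed (rule linear_dmul)
  have "ac_path (\<lambda>t. (y t, z t)) (\<lambda>t. (field (w t) (y t), field (w t) (z t)))"
    using assms(1,2) unfolding driven_def by (rule ac_path_Pair)
  from ac_path_compose[OF this F cF]
  have "ac_path (\<lambda>t. y t \<cdot> invr (z t)) (\<lambda>t. 0)" by (simp add: dmul_quotient)
  from ac_pathD(2)[OF this assms(4)] have "y t \<cdot> invr (z t) = y 0 \<cdot> invr (z 0)"
    using has_integral_unique[OF _ has_integral_0] by fastforce
  then have "y t \<cdot> invr (z t) \<cdot> z t = z t" using assms(3) by simp
  then show ?thesis by (simp add: G.assoc)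
qed

lemma driven_mul:
  assumes y: "driven (\<lambda>t. Ad (z t) (u t)) y" and z: "driven w z"
  shows "driven (\<lambda>t. u t + w t) (\<lambda>t. y t \<cdot> z t)"
proof -
  have "ac_path (\<lambda>t. (y t, z t)) (\<lambda>t. (field (Ad (z t) (u t)) (y t), field (w t) (z t)))"
    using y z unfolding driven_def by (rule ac_path_Pair)
  from ac_path_compose[OF this has_derivative_mul continuous_dmul]
  show ?thesis unfolding driven_def by (simp add: dmul_fields)
qed

lemma field_lipschitz:
  obtains L where "0 \<le> L" "\<And>x y w. x \<in> cball 0 1 \<Longrightarrow> y \<in> cball 0 1 \<Longrightarrow>
      norm (field w x - field w y) \<le> L * norm w * norm (x - y)"
proof -
  have "\<exists>L. L-lipschitz_on (cball 0 1) (field i)" for i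
    by (rule C1_lipschitz[OF field_has_derivative continuous_field_deriv compact_cball[of 0 1] convex_cball])
       (rule exI)
  then obtain l where l: "\<And>i. (l i)-lipschitz_on (cball 0 1) (field i)" by metis
  show ?thesis
  proof
    show "0 \<le> (\<Sum>i\<in>(Basis::'a set). l i)" by (intro sum_nonneg lipschitz_on_nonneg[OF l])
    fix x y w :: 'a assume xy: "x \<in> cball 0 1" "y \<in> cball 0 1"
    have "norm (field w x - field w y) = norm (\<Sum>i\<in>Basis. (w \<bullet> i) *\<^sub>R (field i x - field i y))"
      using linear_expand[OF linear_field, of w x] linear_expand[OF linear_field, of w y]
      by (simp add: scaleR_diff_right sum_subtractf)
    also have "\<dots> \<le> (\<Sum>i\<in>(Basis::'a set). norm w * (l i * norm (x - y)))"
    proof (rule sum_norm_le)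
      fix i :: 'a assume i: "i \<in> Basis"
      have "norm (field i x - field i y) \<le> l i * norm (x - y)"
        using lipschitz_onD[OF l xy] by (simp add: dist_norm)
      then show "norm ((w \<bullet> i) *\<^sub>R (field i x - field i y)) \<le> norm w * (l i * norm (x - y))"
        unfolding norm_scaleR by (intro mult_mono Basis_le_norm i) auto
    qed
    also have "\<dots> = (\<Sum>i\<in>(Basis::'a set). l i) * norm w * norm (x - y)"
      by (simp add: sum_distrib_left sum_distrib_right mult_ac)
    finally show "norm (field w x - field w y) \<le> (\<Sum>i\<in>(Basis::'a set). l i) * norm w * norm (x - y)" .
  qed
qed

lemma absolutely_integrable_field:
  assumes "a absolutely_integrable_on {0..1}" "continuous_on {0..1::real} y"
  shows "(\<lambda>t. field (a t) (y t)) absolutely_integrable_on {0..1}"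
  by (rule absolutely_integrable_linear_family[where T="\<lambda>t w. field w (y t)", OF linear_field _ assms(1)])
     (rule continuous_on_compose2[OF continuous_field assms(2) subset_UNIV])

text \<open>A contraction argument for continuous paths in the unit ball. There
  \<open>field w x\<close> is bounded by 1 + L times the norm of \<open>w\<close>, because
  \<open>field w 0 = w\<close>. With A the integral of |a|, the bound (1 + L) A \<le> 1/2 keeps the
  paths in the ball and gives contraction by 1/2. The solution has size at most (1 + L) A, so
  replacing the field by its value at 0 costs an error quadratic in A.\<close>

lemma small_driven_path:
  assumes L: "0 \<le> L" "\<And>x y w. x \<in> cball 0 1 \<Longrightarrow> y \<in> cball 0 1 \<Longrightarrow>
      norm (field w x - field w y) \<le> L * norm w * norm (x - y)"
    and a: "a absolutely_integrable_on {0..1}"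
    and small: "(1 + L) * integral {0..1} (\<lambda>t. norm (a t)) \<le> 1 / 2"
  obtains y where "driven a y" "y 0 = 0"
    "norm (y 1) \<le> (1 + L) * integral {0..1} (\<lambda>t. norm (a t))"
    "norm (y 1 - integral {0..1} a) \<le> L * (1 + L) * (integral {0..1} (\<lambda>t. norm (a t)))\<^sup>2"
proof -
  let ?A = "integral {0..1} (\<lambda>t. norm (a t))"
  let ?c = "\<lambda>t::real. max 0 (min 1 t)"
  have ai: "(\<lambda>t. norm (a t)) integrable_on {0..t}" "a integrable_on {0..t}" if "t \<le> 1" for t
    using absolutely_integrable_on_subinterval[OF a, of 0 t] that
    by (auto simp: absolutely_integrable_on_def)
  have A0: "0 \<le> ?A" by (intro integral_nonneg ai) auto
  have int_le: "norm (integral {0..t} f) \<le> K * ?A"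
    if f: "f integrable_on {0..t}" and t: "t \<in> {0..1}" and K: "0 \<le> K"
      and le: "\<And>\<tau>. \<tau> \<in> {0..t} \<Longrightarrow> norm (f \<tau>) \<le> K * norm (a \<tau>)" for f :: "real \<Rightarrow> 'a" and t K
  proof -
    have t1: "t \<le> 1" using t by simp
    have Ka: "(\<lambda>t. K * norm (a t)) integrable_on {0..s}" if "s \<le> 1" for s
      using integrable_cmul[OF ai(1)[OF that], of K] by simp
    have "norm (integral {0..t} f) \<le> integral {0..t} (\<lambda>t. K * norm (a t))"
      by (rule integral_norm_bound_integral[OF f Ka[OF t1] le])
    also have "\<dots> \<le> integral {0..1} (\<lambda>t. K * norm (a t))"
      by (rule integral_subset_le) (use t K Ka in auto)
    finally show ?thesis by simp
  qed
  \<comment> \<open>Bounded continuous functions live on the whole line, so the time is clamped to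
    \<open>{0..1}\<close>.\<close>
  define G where "G f t = integral {0..?c t} (\<lambda>\<tau>. field (a \<tau>) (f \<tau>))" for f :: "real \<Rightarrow> 'a" and t
  have fi: "(\<lambda>\<tau>. field (a \<tau>) (f \<tau>)) integrable_on {0..t}" if "continuous_on UNIV f" "t \<le> 1" for f t
    using absolutely_integrable_on_subinterval[OF absolutely_integrable_field[OF a continuous_on_subset[OF that(1) subset_UNIV]], of 0 t] that(2)
    by (intro set_lebesgue_integral_eq_integral(1)) auto
  have field_le: "norm (field w x) \<le> (1 + L) * norm w" if x: "x \<in> cball 0 1" for w x
  proof -
    have "norm (field w x - field w 0) \<le> L * norm w * norm (x - 0)" by (rule L(2)[OF x]) simp
    also have "\<dots> \<le> L * norm w * 1" by (rule mult_left_mono) (use x L in auto)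
    finally have "norm (field w x - w) \<le> L * norm w" by simp
    then show ?thesis using norm_triangle_ineq[of "field w x - w" w] by (simp add: algebra_simps)
  qed
  have c01: "?c t \<in> {0..1}" for t by auto
  have G_norm: "norm (G f t) \<le> (1 + L) * ?A" if f: "continuous_on UNIV f" "\<And>\<tau>. f \<tau> \<in> cball 0 1" for f t
    unfolding G_def
    by (rule int_le[OF fi[OF f(1)] c01]) (use L field_le[OF f(2)] in auto)
  have G_cont: "continuous_on UNIV (G f)" if f: "continuous_on UNIV f" for f
  proof -
    have "continuous_on {0..1} (\<lambda>t. integral {0..t} (\<lambda>\<tau>. field (a \<tau>) (f \<tau>)))"
      by (rule indefinite_integral_continuous_1[OF fi[OF f]]) simp
    then have "continuous_on UNIV (\<lambda>t. integral {0..?c t} (\<lambda>\<tau>. field (a \<tau>) (f \<tau>)))"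
      by (rule continuous_on_compose2) (auto intro!: continuous_intros)
    moreover have "G f = (\<lambda>t. integral {0..?c t} (\<lambda>\<tau>. field (a \<tau>) (f \<tau>)))" by (rule ext) (rule G_def)
    ultimately show ?thesis by simp
  qed
  let ?S = "PiC UNIV (\<lambda>_::real. cball (0::'a) 1)"
  define T where "T f = Bcontfun (G (apply_bcontfun f))" for f
  have cf: "continuous_on UNIV (apply_bcontfun f)" for f :: "real \<Rightarrow>\<^sub>C 'a"
    using apply_bcontfun[of f] by (simp add: bcontfun_def)
  have fS: "apply_bcontfun f \<tau> \<in> cball 0 1" if "f \<in> ?S" for f \<tau>
    using that by (simp add: mem_PiC_iff Pi_iff)
  have T: "apply_bcontfun (T f) = G (apply_bcontfun f)" if f: "f \<in> ?S" for f
    unfolding T_def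
    by (rule Bcontfun_inverse, rule bcontfun_normI[OF G_cont[OF cf]]) (rule G_norm[OF cf fS[OF f]])
  have "\<exists>!f\<in>?S. T f = f"
  proof (rule Banach_fix[where c="1/2"])
    show "complete ?S" unfolding complete_eq_closed by (rule closed_PiC) simp
    show "?S \<noteq> {}"
    proof -
      have "(0 :: real \<Rightarrow>\<^sub>C 'a) \<in> ?S" by (simp add: mem_PiC_iff)
      then show ?thesis by blast
    qed
    show "T ` ?S \<subseteq> ?S"
    proof safe
      fix f assume f: "f \<in> ?S"
      have "norm (G (apply_bcontfun f) t) \<le> 1" for t
        using G_norm[OF cf fS[OF f], of t] small by linarith
      then show "T f \<in> ?S" unfolding mem_PiC_iff T[OF f] by simp
    qed
    show "dist (T f) (T g) \<le> 1 / 2 * dist f g" if f: "f \<in> ?S" and g: "g \<in> ?S" for f g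
    proof (rule dist_bound)
      fix t
      let ?f = "apply_bcontfun f" and ?g = "apply_bcontfun g"
      have i: "(\<lambda>\<tau>. field (a \<tau>) (?f \<tau>)) integrable_on {0..?c t}" "(\<lambda>\<tau>. field (a \<tau>) (?g \<tau>)) integrable_on {0..?c t}"
        by (rule fi[OF cf], simp)+
      have "norm (integral {0..?c t} (\<lambda>\<tau>. field (a \<tau>) (?f \<tau>) - field (a \<tau>) (?g \<tau>))) \<le> (L * dist f g) * ?A"
      proof (rule int_le[OF integrable_diff[OF i] c01])
        show "0 \<le> L * dist f g" using L(1) by simp
        fix \<tau>
        have "norm (field (a \<tau>) (?f \<tau>) - field (a \<tau>) (?g \<tau>)) \<le> L * norm (a \<tau>) * norm (?f \<tau> - ?g \<tau>)"
          by (rule L(2)[OF fS[OF f] fS[OF g]])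
        also have "\<dots> \<le> L * norm (a \<tau>) * dist f g"
          using dist_bounded[of f \<tau> g] L(1) by (intro mult_left_mono) (auto simp: dist_norm)
        finally show "norm (field (a \<tau>) (?f \<tau>) - field (a \<tau>) (?g \<tau>)) \<le> L * dist f g * norm (a \<tau>)"
          by (simp add: mult_ac)
      qed
      also have "(L * dist f g) * ?A \<le> 1 / 2 * dist f g"
      proof -
        have "L * ?A \<le> 1 / 2" using small A0 by (simp add: algebra_simps)
        then have "L * ?A * dist f g \<le> 1 / 2 * dist f g" by (rule mult_right_mono) simp
        then show ?thesis by (simp add: mult_ac)
      qed
      finally show "dist (apply_bcontfun (T f) t) (apply_bcontfun (T g) t) \<le> 1 / 2 * dist f g"
        unfolding T[OF f] T[OF g] G_def dist_norm integral_diff[OF i] .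
    qed
  qed auto
  then obtain f where f: "f \<in> ?S" "T f = f" by (elim ex1E conjE) (rule that; assumption)
  let ?y = "apply_bcontfun f"
  have yG: "?y t = G ?y t" for t using T[OF f(1)] f(2) by simp
  have y: "?y t = integral {0..t} (\<lambda>\<tau>. field (a \<tau>) (?y \<tau>))" if "t \<in> {0..1}" for t
  proof -
    have "?c t = t" using that by auto
    then show ?thesis using yG[of t] unfolding G_def by simp
  qed
  have y0: "?y 0 = 0" using y[of 0] by simp
  show ?thesis
  proof (rule that)
    show "driven a ?y" unfolding driven_def
    proof (rule ac_pathI)
      show "(\<lambda>t. field (a t) (?y t)) absolutely_integrable_on {0..1}"
        by (rule absolutely_integrable_field[OF a continuous_on_subset[OF cf subset_UNIV]])
      fix t :: real assume t: "t \<in> {0..1}"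
      have "(\<lambda>t. field (a t) (?y t)) integrable_on {0..t}" by (rule fi[OF cf]) (use t in simp)
      then show "((\<lambda>t. field (a t) (?y t)) has_integral (?y t - ?y 0)) {0..t}"
        unfolding y0 diff_zero y[OF t] by (rule integrable_integral)
    qed
    show "?y 0 = 0" by (rule y0)
    have ny: "norm (?y t) \<le> (1 + L) * ?A" for t
      using yG[of t] G_norm[OF cf fS[OF f(1)], of t] by simp
    then show "norm (?y 1) \<le> (1 + L) * ?A" .
    have i: "(\<lambda>t. field (a t) (?y t)) integrable_on {0..1}" by (rule fi[OF cf]) simp
    have "?y 1 - integral {0..1} a = integral {0..1} (\<lambda>t. field (a t) (?y t) - a t)"
      unfolding integral_diff[OF i ai(2)[OF order_refl]] using y[of 1] by simp
    also have "norm \<dots> \<le> (L * ((1 + L) * ?A)) * ?A"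
    proof (rule int_le[OF integrable_diff[OF i ai(2)[OF order_refl]]])
      fix \<tau>
      have "norm (field (a \<tau>) (?y \<tau>) - field (a \<tau>) 0) \<le> L * norm (a \<tau>) * norm (?y \<tau> - 0)"
        by (rule L(2)[OF fS[OF f(1)]]) simp
      also have "\<dots> \<le> L * norm (a \<tau>) * ((1 + L) * ?A)"
        using ny[of \<tau>] L(1) by (intro mult_left_mono) auto
      finally show "norm (field (a \<tau>) (?y \<tau>) - a \<tau>) \<le> L * ((1 + L) * ?A) * norm (a \<tau>)"
        by (simp add: mult_ac)
    qed (use L A0 in auto)
    finally show "norm (?y 1 - integral {0..1} a) \<le> L * (1 + L) * ?A\<^sup>2"
      by (simp add: power2_eq_square mult_ac)
  qed
qed

end

section \<open>The end-point map\<close>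

lemma lebesgue_on_abs_integrable:
  fixes f :: "real \<Rightarrow> 'b::euclidean_space"
  shows "integrable (lebesgue_on {0..1}) f \<Longrightarrow> f absolutely_integrable_on {0..1}"
  by (simp add: set_integrable_def integrable_restrict_space)

lemma finite_measure_unit: "finite_measure (lebesgue_on {0..1::real})"
  using finite_measure_lebesgue_on[OF lmeasurable_cbox[of 0 "1::real"]] by (simp only: cbox_interval)

lemma L2_controls_square:
  assumes "u \<in> L2_controls r" "j \<in> {1..r}"
  shows "(\<lambda>t. (u j t)\<^sup>2) integrable_on {0..1}"
    "integral {0..1} (\<lambda>t. (u j t)\<^sup>2) \<le> (L2_ctrl_norm r u)\<^sup>2"
proof -
  have i: "integrable (lebesgue_on {0..1}) (\<lambda>t. (u i t)\<^sup>2)" if "i \<in> {1..r}" for i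
    using assms(1) that by (simp add: L2_controls_def)
  have e: "integral\<^sup>L (lebesgue_on {0..1}) (\<lambda>t. (u i t)\<^sup>2) = integral {0..1} (\<lambda>t. (u i t)\<^sup>2)" if "i \<in> {1..r}" for i
    by (rule lebesgue_integral_eq_integral[OF i[OF that]]) simp
  show "(\<lambda>t. (u j t)\<^sup>2) integrable_on {0..1}"
    by (rule integrable_on_lebesgue_on[OF i[OF assms(2)]]) simp
  have nn: "0 \<le> integral\<^sup>L (lebesgue_on {0..1}) (\<lambda>t. (u i t)\<^sup>2)" for i
    by (rule Bochner_Integration.integral_nonneg) simp
  have "integral {0..1} (\<lambda>t. (u j t)\<^sup>2) \<le> (\<Sum>i=1..r. integral\<^sup>L (lebesgue_on {0..1}) (\<lambda>t. (u i t)\<^sup>2))"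
    unfolding e[OF assms(2), symmetric] by (rule member_le_sum[OF assms(2)]) (use nn in auto)
  also have "\<dots> = (L2_ctrl_norm r u)\<^sup>2"
    unfolding L2_ctrl_norm_def by (rule real_sqrt_pow2[symmetric]) (rule sum_nonneg[OF nn])
  finally show "integral {0..1} (\<lambda>t. (u j t)\<^sup>2) \<le> (L2_ctrl_norm r u)\<^sup>2" .
qed

lemma L2_ctrl_norm_nonneg: "0 \<le> L2_ctrl_norm r u"
  unfolding L2_ctrl_norm_def
  by (intro real_sqrt_ge_zero sum_nonneg Bochner_Integration.integral_nonneg) simp

lemma L2_controls_integrable:
  assumes "u \<in> L2_controls r" "j \<in> {1..r}"
  shows "u j absolutely_integrable_on {0..1}"
proof (rule lebesgue_on_abs_integrable)
  interpret finite_measure "lebesgue_on {0..1::real}" by (rule finite_measure_unit)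
  have u: "u j \<in> borel_measurable (lebesgue_on {0..1})" "integrable (lebesgue_on {0..1}) (\<lambda>t. (u j t)\<^sup>2)"
    using assms by (auto simp: L2_controls_def)
  have "\<bar>x\<bar> \<le> 1 + x\<^sup>2" for x :: real
    using sum_power2_ge_zero[of "\<bar>x\<bar> - 1 / 2" 0] by (simp add: power2_eq_square algebra_simps)
  then have le: "\<bar>x\<bar> \<le> \<bar>1 + x\<^sup>2\<bar>" for x :: real by (meson abs_ge_self order_trans)
  show "integrable (lebesgue_on {0..1}) (u j)"
    by (rule Bochner_Integration.integrable_bound[where f="\<lambda>t. 1 + (u j t)\<^sup>2"])
       (use u le in auto)
qed

text \<open>The Cauchy-Schwarz inequality on the unit interval, by integrating |x| \<le> c/2 +
  x^2/(2c). Taking \<open>c\<close> above the norm, and not equal to it, avoids division by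
  zero.\<close>

lemma L1_le_L2_ctrl_norm:
  assumes "u \<in> L2_controls r" "j \<in> {1..r}"
  shows "integral {0..1} (\<lambda>t. \<bar>u j t\<bar>) \<le> L2_ctrl_norm r u"
proof (rule dense_ge)
  fix c assume c: "L2_ctrl_norm r u < c"
  then have c0: "0 < c" using L2_ctrl_norm_nonneg[of r u] by linarith
  note sq = L2_controls_square[OF assms]
  have i: "(\<lambda>t. \<bar>u j t\<bar>) integrable_on {0..1}"
    using L2_controls_integrable[OF assms] by (simp add: absolutely_integrable_on_def)
  have k: "((\<lambda>t. c / 2 + 1 / (2 * c) * (u j t)\<^sup>2) has_integral
      c / 2 + 1 / (2 * c) * integral {0..1} (\<lambda>t. (u j t)\<^sup>2)) {0..1}"
    using has_integral_add[OF has_integral_const_real[of "c / 2" 0 1]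
        has_integral_mult_right[OF integrable_integral[OF sq(1)], of "1 / (2 * c)"]] by simp
  have le: "\<bar>x\<bar> \<le> c / 2 + 1 / (2 * c) * x\<^sup>2" for x
  proof -
    have "0 \<le> (\<bar>x\<bar> - c)\<^sup>2 / (2 * c)" using c0 by simp
    also have "\<dots> = c / 2 + 1 / (2 * c) * x\<^sup>2 - \<bar>x\<bar>"
      using c0 by (simp add: power2_eq_square field_simps)
    finally show ?thesis by simp
  qed
  have "integral {0..1} (\<lambda>t. \<bar>u j t\<bar>) \<le> c / 2 + 1 / (2 * c) * integral {0..1} (\<lambda>t. (u j t)\<^sup>2)"
    by (rule has_integral_le[OF integrable_integral[OF i] k le])
  also have "\<dots> \<le> c / 2 + 1 / (2 * c) * c\<^sup>2"
  proof -
    have "(L2_ctrl_norm r u)\<^sup>2 \<le> c\<^sup>2" by (rule power_mono) (use c L2_ctrl_norm_nonneg in auto)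
    then have "integral {0..1} (\<lambda>t. (u j t)\<^sup>2) \<le> c\<^sup>2" using sq(2) by linarith
    then show ?thesis using c0 by (intro add_left_mono mult_left_mono) auto
  qed
  also have "\<dots> = c" using c0 by (simp add: power2_eq_square field_simps)
  finally show "integral {0..1} (\<lambda>t. \<bar>u j t\<bar>) \<le> c" .
qed

lemma L2_controls_scale: "u \<in> L2_controls r \<Longrightarrow> c *\<^sub>R u \<in> L2_controls r"
  by (auto simp: L2_controls_def scaleR_fun_def power_mult_distrib)

lemma L2_ctrl_norm_scale: "L2_ctrl_norm r (c *\<^sub>R u) = \<bar>c\<bar> * L2_ctrl_norm r u"
  by (simp add: L2_ctrl_norm_def scaleR_fun_def power_mult_distrib real_sqrt_mult flip: sum_distrib_left)

lemma L2_controls_add: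
  assumes "u \<in> L2_controls r" "w \<in> L2_controls r"
  shows "u + w \<in> L2_controls r"
  unfolding L2_controls_def
proof (intro CollectI ballI conjI)
  fix j assume j: "j \<in> {1..r}"
  have m: "u j \<in> borel_measurable (lebesgue_on {0..1})" "w j \<in> borel_measurable (lebesgue_on {0..1})"
    and i: "integrable (lebesgue_on {0..1}) (\<lambda>t. (u j t)\<^sup>2)" "integrable (lebesgue_on {0..1}) (\<lambda>t. (w j t)\<^sup>2)"
    using assms j by (auto simp: L2_controls_def)
  have e: "(u + w) j = (\<lambda>t. u j t + w j t)" by (simp add: fun_eq_iff)
  show "(u + w) j \<in> borel_measurable (lebesgue_on {0..1})"
    unfolding e using m by simp
  have "(x + y)\<^sup>2 \<le> 2 * x\<^sup>2 + 2 * y\<^sup>2" for x y :: real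
    using zero_le_power2[of "x - y"] by (simp add: power2_eq_square algebra_simps)
  then have le: "norm ((x + y)\<^sup>2) \<le> norm (2 * x\<^sup>2 + 2 * y\<^sup>2)" for x y :: real
    by (simp add: abs_of_nonneg)
  show "integrable (lebesgue_on {0..1}) (\<lambda>t. ((u + w) j t)\<^sup>2)"
    unfolding e
  proof (rule Bochner_Integration.integrable_bound[where f="\<lambda>t. 2 * (u j t)\<^sup>2 + 2 * (w j t)\<^sup>2"])
    show "integrable (lebesgue_on {0..1}) (\<lambda>t. 2 * (u j t)\<^sup>2 + 2 * (w j t)\<^sup>2)" using i by simp
    show "(\<lambda>t. (u j t + w j t)\<^sup>2) \<in> borel_measurable (lebesgue_on {0..1})" using m by simp
    show "AE t in lebesgue_on {0..1}. norm ((u j t + w j t)\<^sup>2) \<le> norm (2 * (u j t)\<^sup>2 + 2 * (w j t)\<^sup>2)"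
      by (intro AE_I2 le)
  qed
qed

text \<open>Two derivatives differ by o(c) at c u but scale linearly in \<open>c\<close>. It is
  needed because \<open>corank\<close> selects an arbitrary derivative.\<close>

lemma has_L2_derivative_unique:
  assumes D: "has_L2_derivative r F D h" and D': "has_L2_derivative r F D' h" and u: "u \<in> L2_controls r"
  shows "D u = D' u"
proof -
  let ?n = "L2_ctrl_norm r u"
  have "norm (D u - D' u) \<le> 0"
  proof (rule field_le_epsilon)
    fix e :: real assume e: "0 < e"
    define \<epsilon> where "\<epsilon> = e / (?n + 1) / 2"
    have n: "0 \<le> ?n" by (rule L2_ctrl_norm_nonneg)
    have \<epsilon>: "0 < \<epsilon>" using e n by (simp add: \<epsilon>_def)
    obtain d where d: "0 < d" "\<And>u. u \<in> L2_controls r \<Longrightarrow> L2_ctrl_norm r u < d \<Longrightarrow>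
        norm (F (h + u) - F h - D u) \<le> \<epsilon> * L2_ctrl_norm r u"
      using D \<epsilon> unfolding has_L2_derivative_def by meson
    obtain d' where d': "0 < d'" "\<And>u. u \<in> L2_controls r \<Longrightarrow> L2_ctrl_norm r u < d' \<Longrightarrow>
        norm (F (h + u) - F h - D' u) \<le> \<epsilon> * L2_ctrl_norm r u"
      using D' \<epsilon> unfolding has_L2_derivative_def by meson
    \<comment> \<open>The denominator is the norm plus 1 because the norm of \<open>u\<close> may
      vanish.\<close>
    define c where "c = min d d' / (?n + 1)"
    have c: "0 < c" using d(1) d'(1) n by (simp add: c_def)
    have "?n / (?n + 1) < 1" using n by simp
    then have "min d d' * (?n / (?n + 1)) < min d d' * 1"
      by (rule mult_strict_left_mono) (use d(1) d'(1) in simp)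
    then have cn: "c * ?n < min d d'" by (simp add: c_def)
    let ?w = "c *\<^sub>R u"
    have w: "?w \<in> L2_controls r" by (rule L2_controls_scale[OF u])
    have nw: "L2_ctrl_norm r ?w = c * ?n" using c by (simp add: L2_ctrl_norm_scale)
    have cd: "c * ?n < d" "c * ?n < d'" using cn by simp_all
    note e1 = d(2)[OF w, unfolded nw, OF cd(1)] and e2 = d'(2)[OF w, unfolded nw, OF cd(2)]
    have tri: "norm (p - q) \<le> A + A'" if "norm (x - p) \<le> A" "norm (x - q) \<le> A'" for p q x and A A' :: real
      using norm_triangle_ineq4[of "x - q" "x - p"] that by simp
    have "norm (D ?w - D' ?w) \<le> c * (2 * \<epsilon> * ?n)"
      using tri[OF e1 e2] by (simp add: mult_ac)
    moreover have "D ?w = c *\<^sub>R D u" "D' ?w = c *\<^sub>R D' u"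
      using D D' u unfolding has_L2_derivative_def by blast+
    ultimately have "c * norm (D u - D' u) \<le> c * (2 * \<epsilon> * ?n)"
      using c by (simp flip: scaleR_diff_right)
    then have "norm (D u - D' u) \<le> 2 * \<epsilon> * ?n" using c by simp
    also have "2 * \<epsilon> = e / (?n + 1)" unfolding \<epsilon>_def by (rule mult_2[THEN trans, OF field_sum_of_halves])
    also have "e / (?n + 1) * ?n = e * (?n / (?n + 1))" by (simp only: times_divide_eq_left times_divide_eq_right)
    also have "\<dots> \<le> e * 1" by (rule mult_left_mono) (use n e in auto)
    finally show "norm (D u - D' u) \<le> 0 + e" by simp
  qed
  then show ?thesis by simp
qed

section \<open>Trajectories of controls\<close>

context adapted_group begin

definition drive :: "(nat \<Rightarrow> real \<Rightarrow> real) \<Rightarrow> real \<Rightarrow> (real, 'n) vec" where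
  "drive h t = (\<Sum>j=1..r. h j t *\<^sub>R b j)"

lemma field_drive: "field (drive h t) x = (\<Sum>j=1..r. h j t *\<^sub>R field (b j) x)"
  by (simp add: drive_def field_linear)

lemma coord_drive:
  assumes j: "j \<in> {1..r}"
  shows "coord (drive h t) j = h j t"
proof -
  have "coord (drive h t) j = (\<Sum>i=1..r. h i t * coord (b i) j)"
    unfolding drive_def by (simp add: linear_sum[OF linear_coord] linear_cmul[OF linear_coord])
  also have "\<dots> = (\<Sum>i=1..r. if j = i then h i t else 0)"
    by (intro sum.cong refl) (simp add: coord_b[OF r_sub[OF j] r_sub])
  finally show ?thesis using j by (simp add: sum.delta)
qed

lemma drive_add: "drive (u + w) t = drive u t + drive w t"
  by (simp add: drive_def scaleR_add_left sum.distrib)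

lemma drive_scale: "drive (c *\<^sub>R u) t = c *\<^sub>R drive u t"
  by (simp add: drive_def scaleR_fun_def scaleR_sum_right)

lemma drive_integrable:
  assumes "\<And>j. j \<in> {1..r} \<Longrightarrow> h j absolutely_integrable_on {0..1}"
  shows "drive h absolutely_integrable_on {0..1}"
proof -
  have "(\<lambda>t. \<Sum>j=1..r. h j t *\<^sub>R b j) absolutely_integrable_on {0..1}"
    by (intro absolutely_integrable_sum absolutely_integrable_scaleR_continuous assms) auto
  then show ?thesis by (simp add: drive_def[abs_def])
qed

lemma controlled_path_iff:
  assumes "drive h absolutely_integrable_on {0..1}"
  shows "controlled_path gmul b r x0 h y \<longleftrightarrow> driven (drive h) y \<and> y 0 = x0"
proof
  assume c: "controlled_path gmul b r x0 h y"
  have y: "continuous_on {0..1} y"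
    and int: "\<And>t. t \<in> {0..1} \<Longrightarrow> ((\<lambda>\<tau>. field (drive h \<tau>) (y \<tau>)) has_integral (y t - x0)) {0..t}"
    using c unfolding controlled_path_def field_drive by auto
  have 0: "((\<lambda>\<tau>. field (drive h \<tau>) (y \<tau>)) has_integral 0) {0..0}" by (simp add: has_integral_refl)
  have "((\<lambda>\<tau>. field (drive h \<tau>) (y \<tau>)) has_integral (y 0 - x0)) {0..0}" by (rule int) simp
  from has_integral_unique[OF this 0] have y0: "y 0 = x0" by simp
  have "driven (drive h) y"
    unfolding driven_def by (rule ac_pathI[OF absolutely_integrable_field[OF assms y]]) (use int y0 in auto)
  then show "driven (drive h) y \<and> y 0 = x0" using y0 by simp
next
  assume d: "driven (drive h) y \<and> y 0 = x0"
  then have a: "ac_path y (\<lambda>\<tau>. field (drive h \<tau>) (y \<tau>))" unfolding driven_def by simp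
  show "controlled_path gmul b r x0 h y"
    unfolding controlled_path_def field_drive[symmetric]
    using ac_path_continuous[OF a] ac_pathD(2)[OF a] d by auto
qed

lemma endpoint_map_eq:
  assumes "drive h absolutely_integrable_on {0..1}" "driven (drive h) y"
  shows "endpoint_map gmul b r (y 0) h = y 1"
  unfolding endpoint_map_def controlled_path_iff[OF assms(1)]
proof (rule the_equality)
  show "\<exists>z. (driven (drive h) z \<and> z 0 = y 0) \<and> y 1 = z 1" using assms(2) by blast
  fix p assume "\<exists>z. (driven (drive h) z \<and> z 0 = y 0) \<and> p = z 1"
  then obtain z where "driven (drive h) z" "z 0 = y 0" "p = z 1" by blast
  then show "p = y 1" using driven_unique[of "drive h" z y 1] assms(2) by simp
qed

text \<open>Off a null set the curve has the velocity given by some controls \<open>h\<close>, and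
  by \<open>coord_field\<close> these are the first \<open>r\<close> components of that
  velocity.\<close>

lemma horizontal_curve_driven:
  assumes "horizontal_curve gmul b r \<gamma>"
  shows "drive (controls \<gamma>) absolutely_integrable_on {0..1}" "driven (drive (controls \<gamma>)) \<gamma>"
    "AE t in lebesgue_on {0..1}. (\<gamma> has_vector_derivative field (drive (controls \<gamma>) t) (\<gamma> t)) (at t)"
proof -
  obtain C h where lip: "C-lipschitz_on {0..1} \<gamma>"
    and h: "\<And>j. j \<in> {1..r} \<Longrightarrow> h j \<in> borel_measurable (lebesgue_on {0..1})"
      "\<And>j. j \<in> {1..r} \<Longrightarrow> \<exists>C. AE t in lebesgue_on {0..1}. \<bar>h j t\<bar> \<le> C"
    and ae: "AE t in lebesgue_on {0..1}. (\<gamma> has_vector_derivative field (drive h t) (\<gamma> t)) (at t)"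
    using assms unfolding horizontal_curve_def field_drive by blast
  have eq: "drive (controls \<gamma>) t = drive h t"
    if d: "(\<gamma> has_vector_derivative field (drive h t) (\<gamma> t)) (at t)" for t
  proof -
    have "controls \<gamma> j t = h j t" if j: "j \<in> {1..r}" for j
      unfolding controls_def vector_derivative_at[OF d] by (simp only: coord_field[OF j] coord_drive[OF j])
    then show ?thesis unfolding drive_def by (intro sum.cong) auto
  qed
  interpret finite_measure "lebesgue_on {0..1::real}" by (rule finite_measure_unit)
  have "h j absolutely_integrable_on {0..1}" if j: "j \<in> {1..r}" for j
  proof (rule lebesgue_on_abs_integrable)
    obtain C where "AE t in lebesgue_on {0..1}. \<bar>h j t\<bar> \<le> C" using h(2)[OF j] by blast
    then show "integrable (lebesgue_on {0..1}) (h j)"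
      by (intro integrable_const_bound[where B=C] h(1)[OF j]) simp
  qed
  then have dh: "drive h absolutely_integrable_on {0..1}" by (rule drive_integrable)
  define N where "N = {t \<in> {0..1}. \<not> (\<gamma> has_vector_derivative field (drive h t) (\<gamma> t)) (at t)}"
  have N: "negligible N" unfolding N_def by (rule AE_lebesgue_on_negligible[OF ae]) simp
  have eqN: "drive (controls \<gamma>) t = drive h t" if "t \<in> {0..1} - N" for t
    by (rule eq) (use that in \<open>auto simp: N_def\<close>)
  show "drive (controls \<gamma>) absolutely_integrable_on {0..1}"
    by (rule absolutely_integrable_spike_eq[OF N eqN, THEN iffD1], assumption) (rule dh)
  show "driven (drive (controls \<gamma>)) \<gamma>"
    unfolding driven_def by (rule ac_path_spike[OF lipschitz_ac_path[OF lip ae] N]) (simp add: eqN)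
  show "AE t in lebesgue_on {0..1}. (\<gamma> has_vector_derivative field (drive (controls \<gamma>) t) (\<gamma> t)) (at t)"
    using ae by eventually_elim (simp add: eq)
qed

end

section \<open>The differential of the end-point map along the curve\<close>

locale horizontal_start = adapted_group gmul invr b V s r J X
  for gmul :: "real ^ 'n::{finite,linorder} \<Rightarrow> (real, 'n) vec \<Rightarrow> (real, 'n) vec"
    and invr b V s r J X +
  fixes \<gamma> :: "real \<Rightarrow> (real, 'n) vec"
  assumes horizontal: "horizontal_curve gmul b r \<gamma>" and start: "\<gamma> 0 = 0"
begin

lemmas controls_integrable = horizontal_curve_driven(1)[OF horizontal]
  and curve_driven = horizontal_curve_driven(2)[OF horizontal]
  and curve_derivative = horizontal_curve_driven(3)[OF horizontal]

lemma curve_continuous: "continuous_on {0..1} \<gamma>"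
  using curve_driven unfolding driven_def by (rule ac_path_continuous)

lemma Ad_curve_continuous: "continuous_on {0..1} (\<lambda>t. Ad (\<gamma> t) w)"
  by (rule continuous_on_compose2[OF continuous_Ad curve_continuous subset_UNIV])

definition pull :: "(nat \<Rightarrow> real \<Rightarrow> real) \<Rightarrow> real \<Rightarrow> (real, 'n) vec" where
  "pull u t = Ad (\<gamma> t) (drive u t)"

lemma drive_L2_integrable: "u \<in> L2_controls r \<Longrightarrow> drive u absolutely_integrable_on {0..1}"
  by (rule drive_integrable) (rule L2_controls_integrable)

lemma pull_integrable: "u \<in> L2_controls r \<Longrightarrow> pull u absolutely_integrable_on {0..1}"
  unfolding pull_def[abs_def]
  by (rule absolutely_integrable_linear_family[where T="\<lambda>t. Ad (\<gamma> t)", OF linear_Ad Ad_curve_continuous drive_L2_integrable])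

lemma pull_integrable_on:
  assumes "u \<in> L2_controls r"
  shows "pull u integrable_on {0..1}" "(\<lambda>t. norm (pull u t)) integrable_on {0..1}"
  using pull_integrable[OF assms] unfolding absolutely_integrable_on_def by auto

text \<open>\<open>Ad\<close> is bounded along the compact curve, and each control has an L1 norm
  below the L2 norm.\<close>

lemma pull_bound:
  obtains C where "0 \<le> C"
    "\<And>u. u \<in> L2_controls r \<Longrightarrow> integral {0..1} (\<lambda>t. norm (pull u t)) \<le> C * L2_ctrl_norm r u"
proof -
  have "\<exists>B. \<forall>t\<in>{0..1}. norm (Ad (\<gamma> t) (b j)) \<le> B" for j
  proof -
    have "bounded ((\<lambda>t. Ad (\<gamma> t) (b j)) ` {0..1})"
      by (intro compact_imp_bounded compact_continuous_image Ad_curve_continuous compact_Icc)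
    then show ?thesis unfolding bounded_iff by simp
  qed
  then obtain B where B: "\<And>j t. t \<in> {0..1} \<Longrightarrow> norm (Ad (\<gamma> t) (b j)) \<le> B j" by metis
  have B0: "0 \<le> B j" for j using order_trans[OF norm_ge_zero B[of 0 j]] by simp
  show ?thesis
  proof
    show "0 \<le> (\<Sum>j=1..r. B j)" by (rule sum_nonneg[OF B0])
    fix u assume u: "u \<in> L2_controls r"
    have i: "(\<lambda>t. \<bar>u j t\<bar>) integrable_on {0..1}" if "j \<in> {1..r}" for j
      using L2_controls_integrable[OF u that] by (simp add: absolutely_integrable_on_def)
    have i': "(\<lambda>t. B j * \<bar>u j t\<bar>) integrable_on {0..1}" if "j \<in> {1..r}" for j
      using integrable_cmul[OF i[OF that], of "B j"] by simp
    have "integral {0..1} (\<lambda>t. norm (pull u t)) \<le> integral {0..1} (\<lambda>t. \<Sum>j=1..r. B j * \<bar>u j t\<bar>)"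
    proof (rule integral_le)
      show "(\<lambda>t. \<Sum>j=1..r. B j * \<bar>u j t\<bar>) integrable_on {0..1}"
        by (rule integrable_sum) (use i' in auto)
      fix t :: real assume t: "t \<in> {0..1}"
      have "pull u t = (\<Sum>j=1..r. u j t *\<^sub>R Ad (\<gamma> t) (b j))"
        unfolding pull_def drive_def by (simp only: Ad_simps)
      also have "norm \<dots> \<le> (\<Sum>j=1..r. B j * \<bar>u j t\<bar>)"
      proof (rule sum_norm_le)
        fix j assume "j \<in> {1..r}"
        show "norm (u j t *\<^sub>R Ad (\<gamma> t) (b j)) \<le> B j * \<bar>u j t\<bar>"
          using mult_right_mono[OF B[OF t, of j], of "\<bar>u j t\<bar>"] by (simp add: mult.commute)
      qed
      finally show "norm (pull u t) \<le> (\<Sum>j=1..r. B j * \<bar>u j t\<bar>)" .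
    qed (rule pull_integrable_on[OF u])
    also have "\<dots> = (\<Sum>j=1..r. integral {0..1} (\<lambda>t. B j * \<bar>u j t\<bar>))"
      by (rule integral_sum) (use i' in auto)
    also have "\<dots> \<le> (\<Sum>j=1..r. B j * L2_ctrl_norm r u)"
    proof (rule sum_mono)
      fix j assume j: "j \<in> {1..r}"
      show "integral {0..1} (\<lambda>t. B j * \<bar>u j t\<bar>) \<le> B j * L2_ctrl_norm r u"
        using mult_left_mono[OF L1_le_L2_ctrl_norm[OF u j] B0[of j]] by simp
    qed
    also have "\<dots> = (\<Sum>j=1..r. B j) * L2_ctrl_norm r u" by (simp add: sum_distrib_right)
    finally show "integral {0..1} (\<lambda>t. norm (pull u t)) \<le> (\<Sum>j=1..r. B j) * L2_ctrl_norm r u" .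
  qed
qed

definition right_deriv :: "(real, 'n) vec \<Rightarrow> (real, 'n) vec" where
  "right_deriv z = dmul (0, \<gamma> 1) (z, 0)"

lemma linear_right_deriv: "linear right_deriv"
  unfolding right_deriv_def[abs_def]
  by (rule linearI) (simp_all add: dmul_simps(1,3)[symmetric])

text \<open>Up to an invertible \<open>Ad\<close>, this map evaluates a left-invariant field at the
  end-point.\<close>

lemma inj_right_deriv: "inj right_deriv"
proof (rule injI)
  have eq: "right_deriv z = field (Ad (invr (\<gamma> 1)) z) (\<gamma> 1)" for z
    using field_mul_Ad[of 0 "\<gamma> 1" "Ad (invr (\<gamma> 1)) z"] by (simp add: right_deriv_def)
  fix z z' assume "right_deriv z = right_deriv z'"
  then have "Ad (invr (\<gamma> 1)) z = Ad (invr (\<gamma> 1)) z'" unfolding eq by (rule field_inj)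
  then have "Ad (\<gamma> 1) (Ad (invr (\<gamma> 1)) z) = Ad (\<gamma> 1) (Ad (invr (\<gamma> 1)) z')" by simp
  then show "z = z'" by simp
qed

lemma has_derivative_right: "((\<lambda>z. z \<cdot> \<gamma> 1) has_derivative right_deriv) (at 0)"
proof -
  have "((\<lambda>z. z \<cdot> \<gamma> 1) has_derivative (\<lambda>d. dmul (0, \<gamma> 1) (d, 0))) (at 0)"
    by (rule has_derivative_mul_compose[OF has_derivative_ident has_derivative_const])
  then show ?thesis by (simp add: right_deriv_def[abs_def])
qed

text \<open>The path with controls \<open>h + u\<close> is \<open>\<eta> \<cdot> \<gamma>\<close>, where \<open>\<eta>\<close> is the path through the identity
  driven by \<open>Ad(\<gamma>) u\<close>; to first order \<open>\<eta>(1)\<close> is the integral of \<open>Ad(\<gamma>) u\<close>.\<close>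

definition endpoint_deriv :: "(nat \<Rightarrow> real \<Rightarrow> real) \<Rightarrow> (real, 'n) vec" where
  "endpoint_deriv u = right_deriv (integral {0..1} (pull u))"

lemma endpoint_perturbed:
  assumes u: "u \<in> L2_controls r" and \<eta>: "driven (pull u) \<eta>" "\<eta> 0 = 0"
  shows "endpoint_map gmul b r (\<gamma> 0) (controls \<gamma> + u) = \<eta> 1 \<cdot> \<gamma> 1"
proof -
  have "driven (\<lambda>t. drive u t + drive (controls \<gamma>) t) (\<lambda>t. \<eta> t \<cdot> \<gamma> t)"
    by (rule driven_mul[OF _ curve_driven]) (use \<eta>(1) in \<open>simp add: pull_def[abs_def]\<close>)
  moreover have "(\<lambda>t. drive u t + drive (controls \<gamma>) t) = drive (controls \<gamma> + u)"
    by (rule ext) (simp only: drive_add add.commute)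
  ultimately have d: "driven (drive (controls \<gamma> + u)) (\<lambda>t. \<eta> t \<cdot> \<gamma> t)" by simp
  have "(\<lambda>t. drive (controls \<gamma>) t + drive u t) absolutely_integrable_on {0..1}"
    by (rule set_integral_add(1)[OF controls_integrable drive_L2_integrable[OF u]])
  moreover have "(\<lambda>t. drive (controls \<gamma>) t + drive u t) = drive (controls \<gamma> + u)"
    by (rule ext) (simp only: drive_add)
  ultimately have "drive (controls \<gamma> + u) absolutely_integrable_on {0..1}" by simp
  from endpoint_map_eq[OF this d] show ?thesis by (simp add: \<eta>(2))
qed

lemma endpoint_unperturbed: "endpoint_map gmul b r (\<gamma> 0) (controls \<gamma>) = \<gamma> 1"
  by (rule endpoint_map_eq[OF controls_integrable curve_driven])

lemma pull_add: "pull (u + w) t = pull u t + pull w t"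
  by (simp only: pull_def drive_add Ad_simps)

lemma pull_scale: "pull (c *\<^sub>R u) t = c *\<^sub>R pull u t"
  by (simp only: pull_def drive_scale Ad_simps)

lemma integral_pull_add:
  "u \<in> L2_controls r \<Longrightarrow> w \<in> L2_controls r \<Longrightarrow>
    integral {0..1} (pull (u + w)) = integral {0..1} (pull u) + integral {0..1} (pull w)"
  using integral_add[OF pull_integrable_on(1) pull_integrable_on(1)]
  by (simp add: pull_add[abs_def])

lemma integral_pull_scale:
  "integral {0..1} (pull (c *\<^sub>R u)) = c *\<^sub>R integral {0..1} (pull u)"
  by (simp add: pull_scale[abs_def])

lemma norm_integral_pull:
  "u \<in> L2_controls r \<Longrightarrow> norm (integral {0..1} (pull u)) \<le> integral {0..1} (\<lambda>t. norm (pull u t))"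
  by (rule integral_norm_bound_integral) (auto intro: pull_integrable_on)

text \<open>The error has two parts: that of linearizing right translation at \<eta>(1), and the
  image under \<open>right_deriv\<close> of the difference between \<eta>(1) and the integral, which
  is quadratic in the norm of \<open>u\<close>.\<close>

lemma has_L2_derivative_endpoint:
  "has_L2_derivative r (endpoint_map gmul b r (\<gamma> 0)) endpoint_deriv (controls \<gamma>)"
proof -
  obtain C where C: "0 \<le> C"
    "\<And>u. u \<in> L2_controls r \<Longrightarrow> integral {0..1} (\<lambda>t. norm (pull u t)) \<le> C * L2_ctrl_norm r u"
    by (rule pull_bound) (rule that; assumption)
  obtain L where L: "0 \<le> L" "\<And>x y w. x \<in> cball 0 1 \<Longrightarrow> y \<in> cball 0 1 \<Longrightarrow>
      norm (field w x - field w y) \<le> L * norm w * norm (x - y)"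
    by (rule field_lipschitz) (rule that; assumption)
  obtain B where B: "0 < B" "\<And>z. norm (right_deriv z) \<le> B * norm z"
    using linear_bounded_pos[OF linear_right_deriv] by blast
  have "norm (endpoint_deriv u) \<le> (B * C) * L2_ctrl_norm r u" if u: "u \<in> L2_controls r" for u
  proof -
    have "norm (endpoint_deriv u) \<le> B * norm (integral {0..1} (pull u))"
      unfolding endpoint_deriv_def by (rule B(2))
    also have "\<dots> \<le> B * (C * L2_ctrl_norm r u)"
      by (rule mult_left_mono[OF order_trans[OF norm_integral_pull[OF u] C(2)[OF u]]]) (use B(1) in simp)
    finally show ?thesis by simp
  qed
  moreover have "\<exists>\<delta>>0. \<forall>u\<in>L2_controls r. L2_ctrl_norm r u < \<delta> \<longrightarrow>
      norm (endpoint_map gmul b r (\<gamma> 0) (controls \<gamma> + u) - endpoint_map gmul b r (\<gamma> 0) (controls \<gamma>) - endpoint_deriv u)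
      \<le> \<epsilon> * L2_ctrl_norm r u" if \<epsilon>: "0 < \<epsilon>" for \<epsilon>
  proof -
    \<comment> \<open>\<open>K\<close> bounds \<eta>(1) relative to the norm of \<open>u\<close>,
      and \<open>M\<close> the second part of the error relative to its square. The summands 1 make
      both positive.\<close>
    define K where "K = (1 + L) * C + 1"
    have K: "0 < K" "(1 + L) * C \<le> K" using L(1) C(1) by (auto simp: K_def add_nonneg_pos)
    define M where "M = B * (L * (1 + L) * C\<^sup>2) + 1"
    have M: "0 < M" "B * (L * (1 + L) * C\<^sup>2) \<le> M" using L(1) B(1) by (auto simp: M_def add_nonneg_pos)
    define e where "e = \<epsilon> / 2 / K"
    have e: "0 < e" using \<epsilon> K by (simp add: e_def)
    have "\<exists>d>0. \<forall>z. norm z < d \<longrightarrow> norm (z \<cdot> \<gamma> 1 - \<gamma> 1 - right_deriv z) \<le> e * norm z"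
      using has_derivative_right[unfolded has_derivative_at_alt, THEN conjunct2, rule_format, OF e] by simp
    then obtain d where d1: "0 < d"
      and d2: "\<forall>z. norm z < d \<longrightarrow> norm (z \<cdot> \<gamma> 1 - \<gamma> 1 - right_deriv z) \<le> e * norm z"
      by (elim exE conjE) (rule that; assumption)
    note d = d1 d2[rule_format]
    \<comment> \<open>In this order: \<eta> exists, \<eta>(1) is close enough to the identity for
      linearizing right translation, and the quadratic error is below half the tolerance.\<close>
    define \<delta> where "\<delta> = min (1 / 2 / K) (min (d / K) (\<epsilon> / 2 / M))"
    have \<delta>: "0 < \<delta>" using K M d(1) \<epsilon> by (simp add: \<delta>_def)
    have "norm (endpoint_map gmul b r (\<gamma> 0) (controls \<gamma> + u) - endpoint_map gmul b r (\<gamma> 0) (controls \<gamma>) - endpoint_deriv u)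
      \<le> \<epsilon> * L2_ctrl_norm r u" if u: "u \<in> L2_controls r" and small: "L2_ctrl_norm r u < \<delta>" for u
    proof -
      let ?n = "L2_ctrl_norm r u" and ?A = "integral {0..1} (\<lambda>t. norm (pull u t))" and ?z = "integral {0..1} (pull u)"
      have n: "0 \<le> ?n" by (rule L2_ctrl_norm_nonneg)
      have nK: "K * ?n < 1 / 2" "K * ?n < d" "M * ?n < \<epsilon> / 2"
        using small K(1) M(1) unfolding \<delta>_def by (simp_all add: field_simps)
      have LA: "(1 + L) * ?A \<le> K * ?n"
      proof -
        have "(1 + L) * ?A \<le> (1 + L) * (C * ?n)"
          by (rule mult_left_mono[OF C(2)[OF u]]) (use L(1) in simp)
        also have "\<dots> \<le> K * ?n" using mult_right_mono[OF K(2) n] by (simp add: mult.assoc)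
        finally show ?thesis .
      qed
      have sm: "(1 + L) * ?A \<le> 1 / 2" using LA nK(1) by linarith
      obtain \<eta> where \<eta>: "driven (pull u) \<eta>" "\<eta> 0 = 0" "norm (\<eta> 1) \<le> (1 + L) * ?A"
        "norm (\<eta> 1 - ?z) \<le> L * (1 + L) * ?A\<^sup>2"
        by (rule small_driven_path[OF L pull_integrable[OF u] sm], assumption+)
      have n\<eta>: "norm (\<eta> 1) \<le> K * ?n" using \<eta>(3) LA by linarith
      have 1: "norm (\<eta> 1 \<cdot> \<gamma> 1 - \<gamma> 1 - right_deriv (\<eta> 1)) \<le> \<epsilon> / 2 * ?n"
      proof -
        have "norm (\<eta> 1) < d" using n\<eta> nK(2) by linarith
        then have "norm (\<eta> 1 \<cdot> \<gamma> 1 - \<gamma> 1 - right_deriv (\<eta> 1)) \<le> e * norm (\<eta> 1)" by (rule d(2))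
        also have "\<dots> \<le> e * (K * ?n)" by (rule mult_left_mono[OF n\<eta>]) (use e in simp)
        also have "\<dots> = \<epsilon> / 2 * ?n" using K(1) by (simp add: e_def)
        finally show ?thesis .
      qed
      have 2: "norm (right_deriv (\<eta> 1) - right_deriv ?z) \<le> \<epsilon> / 2 * ?n"
      proof -
        have A0: "0 \<le> ?A" by (rule integral_nonneg[OF pull_integrable_on(2)[OF u]]) simp
        have "norm (right_deriv (\<eta> 1) - right_deriv ?z) \<le> B * norm (\<eta> 1 - ?z)"
          using B(2)[of "\<eta> 1 - ?z"] by (simp only: linear_diff[OF linear_right_deriv])
        also have "\<dots> \<le> B * (L * (1 + L) * ?A\<^sup>2)"
          by (rule mult_left_mono[OF \<eta>(4)]) (use B(1) in simp)
        also have "\<dots> \<le> B * (L * (1 + L) * (C * ?n)\<^sup>2)"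
          by (intro mult_left_mono power_mono C(2)[OF u] A0) (use B(1) L(1) in auto)
        also have "\<dots> = (B * (L * (1 + L) * C\<^sup>2)) * ?n * ?n" by (simp add: power2_eq_square mult_ac)
        also have "\<dots> \<le> M * ?n * ?n" by (intro mult_right_mono M(2) n)
        also have "\<dots> \<le> \<epsilon> / 2 * ?n" by (rule mult_right_mono[OF less_imp_le[OF nK(3)] n])
        finally show ?thesis .
      qed
      have tri: "norm (p - q - z) \<le> A + A'" if "norm (p - q - y) \<le> A" "norm (y - z) \<le> A'"
        for p q y z :: "(real, 'n) vec" and A A' :: real
      proof -
        have "p - q - z = (p - q - y) + (y - z)" by simp
        then have "norm (p - q - z) \<le> norm (p - q - y) + norm (y - z)" by (simp only: norm_triangle_ineq)
        then show ?thesis using that by linarith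
      qed
      show ?thesis
        unfolding endpoint_perturbed[OF u \<eta>(1,2)] endpoint_unperturbed endpoint_deriv_def
        using tri[OF 1 2] by simp
    qed
    then show ?thesis using \<delta> by blast
  qed
  ultimately show ?thesis
    unfolding has_L2_derivative_def
    by (intro conjI ballI allI)
       (auto simp: endpoint_deriv_def integral_pull_add integral_pull_scale
          linear_add[OF linear_right_deriv] linear_cmul[OF linear_right_deriv])
qed

section \<open>The annihilator of the image and the corank\<close>

definition annihilator :: "(real, 'n) vec set" where
  "annihilator = {v. \<forall>t\<in>{0..1}. \<forall>j\<in>{1..r}. v \<bullet> Ad (\<gamma> t) (b j) = 0}"

lemma annihilator_eq:
  "annihilator = {v. \<forall>x\<in>(\<lambda>u. integral {0..1} (pull u)) ` L2_controls r. orthogonal x v}"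
proof (intro equalityI subsetI)
  fix v assume v: "v \<in> annihilator"
  have "v \<bullet> integral {0..1} (pull u) = 0" if u: "u \<in> L2_controls r" for u
  proof -
    have "v \<bullet> pull u t = 0" if "t \<in> {0..1}" for t
      unfolding pull_def drive_def using v that
      by (simp add: Ad_simps inner_sum_right annihilator_def)
    then have "integral {0..1} (\<lambda>t. v \<bullet> pull u t) = integral {0..1::real} (\<lambda>t. 0)"
      by (rule Henstock_Kurzweil_Integration.integral_cong)
    moreover have "integral {0..1} (\<lambda>t. v \<bullet> pull u t) = v \<bullet> integral {0..1} (pull u)"
      using integral_linear[OF pull_integrable_on(1)[OF u] bounded_linear_inner_right[of v]] by (simp add: o_def)
    ultimately show ?thesis by simp
  qed
  then show "v \<in> {v. \<forall>x\<in>(\<lambda>u. integral {0..1} (pull u)) ` L2_controls r. orthogonal x v}"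
    by (simp add: orthogonal_def inner_commute)
next
  fix v assume "v \<in> {v. \<forall>x\<in>(\<lambda>u. integral {0..1} (pull u)) ` L2_controls r. orthogonal x v}"
  then have v: "v \<bullet> integral {0..1} (pull u) = 0" if "u \<in> L2_controls r" for u
    using that by (simp add: orthogonal_def inner_commute)
  show "v \<in> annihilator"
    unfolding annihilator_def
  proof (intro CollectI ballI)
    fix t j assume t: "t \<in> {0..1::real}" and j: "j \<in> {1..r}"
    define \<phi> where "\<phi> t = v \<bullet> Ad (\<gamma> t) (b j)" for t
    \<comment> \<open>The function \<phi> itself serves as the j-th control: the integral of its
      square is then 0, and \<phi> vanishes by continuity.\<close>
    define u where "u i t = (if i = j then \<phi> t else 0)" for i t
    have c: "continuous_on {0..1} \<phi>"
      unfolding \<phi>_def[abs_def] by (intro continuous_intros Ad_curve_continuous)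
    have u: "u \<in> L2_controls r"
      unfolding L2_controls_def
    proof (intro CollectI ballI conjI)
      fix i
      have ci: "continuous_on {0..1} (u i)"
        using c by (cases "i = j") (simp_all add: u_def[abs_def])
      show "u i \<in> borel_measurable (lebesgue_on {0..1})"
        by (rule continuous_imp_measurable_on_sets_lebesgue[OF ci]) simp
      have "continuous_on {0..1} (\<lambda>t. (u i t)\<^sup>2)" by (intro continuous_intros ci)
      then show "integrable (lebesgue_on {0..1}) (\<lambda>t. (u i t)\<^sup>2)"
        by (intro absolutely_integrable_imp_integrable absolutely_integrable_continuous_real) auto
    qed
    have dr: "drive u t = \<phi> t *\<^sub>R b j" for t
    proof -
      have "drive u t = (\<Sum>i=1..r. if i = j then \<phi> t *\<^sub>R b j else 0)"
        unfolding drive_def by (intro sum.cong) (auto simp: u_def)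
      then show ?thesis using j by simp
    qed
    have "v \<bullet> pull u t = \<phi> t * \<phi> t" for t
      by (simp add: pull_def dr Ad_simps \<phi>_def)
    then have "((\<lambda>t. \<phi> t * \<phi> t) has_integral 0) {0..1}"
      using has_integral_linear[OF integrable_integral[OF pull_integrable_on(1)[OF u]] bounded_linear_inner_right[of v]] v[OF u]
      by (simp add: o_def)
    then have "\<phi> t * \<phi> t = 0"
      using has_integral_0_cbox_imp_0[of 0 1 "\<lambda>t. \<phi> t * \<phi> t" t] t c
      by (simp add: continuous_on_mult)
    then show "v \<bullet> Ad (\<gamma> t) (b j) = 0" by (simp add: \<phi>_def)
  qed
qed

text \<open>On \<open>L2_controls r\<close> the selected derivative is
  \<open>endpoint_deriv\<close>. Its injective factor \<open>right_deriv\<close> preserves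
  dimension, and the orthogonal complement of what remains is the annihilator.\<close>

lemma corank_eq: "corank gmul b r \<gamma> = dim annihilator"
proof -
  let ?I = "\<lambda>u. integral {0..1} (pull u)"
  let ?D = "SOME D. has_L2_derivative r (endpoint_map gmul b r (\<gamma> 0)) D (controls \<gamma>)"
  let ?S = "?I ` L2_controls r"
  have "has_L2_derivative r (endpoint_map gmul b r (\<gamma> 0)) ?D (controls \<gamma>)"
    by (rule someI[where P="\<lambda>D. has_L2_derivative r (endpoint_map gmul b r (\<gamma> 0)) D (controls \<gamma>)",
          OF has_L2_derivative_endpoint])
  then have "?D u = endpoint_deriv u" if "u \<in> L2_controls r" for u
    using has_L2_derivative_unique[OF _ has_L2_derivative_endpoint that] by blast
  then have "?D ` L2_controls r = endpoint_deriv ` L2_controls r" by (rule image_cong[OF refl])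
  also have "\<dots> = right_deriv ` ?S" unfolding image_image endpoint_deriv_def ..
  finally have "dim (?D ` L2_controls r) = dim (right_deriv ` ?S)" by simp
  also have "\<dots> = dim ?S"
    by (rule dim_image_eq[OF linear_right_deriv inj_on_subset[OF inj_right_deriv subset_UNIV]])
  finally have 1: "dim (?D ` L2_controls r) = dim ?S" .
  have sub: "subspace ?S"
    unfolding subspace_def
  proof (intro conjI ballI allI)
    have mem: "0 *\<^sub>R (\<lambda>_ _. 0) \<in> L2_controls r" by (rule L2_controls_scale) (simp add: L2_controls_def)
    have "?I (0 *\<^sub>R (\<lambda>_ _. 0)) = 0" by (rule trans[OF integral_pull_scale scaleR_zero_left])
    from image_eqI[where f="?I", OF this[symmetric] mem] show "0 \<in> ?S" .
    show "x + y \<in> ?S" if xy: "x \<in> ?S" "y \<in> ?S" for x y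
    proof -
      obtain u w where "x = ?I u" "u \<in> L2_controls r" "y = ?I w" "w \<in> L2_controls r" using xy by blast
      then show ?thesis using integral_pull_add[of u w] L2_controls_add[of u r w] by (metis imageI)
    qed
    show "c *\<^sub>R x \<in> ?S" if x: "x \<in> ?S" for c x
    proof -
      obtain u where "x = ?I u" "u \<in> L2_controls r" using x by blast
      then show ?thesis using integral_pull_scale[of c u] L2_controls_scale[of u r c] by (metis imageI)
    qed
  qed
  have "dim {v \<in> UNIV. \<forall>x\<in>?S. orthogonal x v} + dim ?S = dim (UNIV :: (real, 'n) vec set)"
    by (rule dim_subspace_orthogonal_to_vectors[OF sub subspace_UNIV subset_UNIV])
  then have "dim annihilator + dim ?S = CARD('n)"
    unfolding annihilator_eq by simp
  then show ?thesis unfolding corank_def 1 by simp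
qed

end

section \<open>Extremal polynomials along the curve\<close>

context horizontal_start begin

lemma inner_Phi_has_derivative:
  assumes "nilpotent_exp_group gmul invr b N" "coded N u"
  shows "((\<lambda>x. v \<bullet> Phi N u x) has_derivative (\<lambda>d. - (v \<bullet> Phi N (prol_bracket u (field_inverse x d)) x))) (at x)"
proof -
  interpret nilpotent_exp_group gmul invr b N by (rule assms)
  have "((\<lambda>x. v \<bullet> Phi N u x) has_derivative (\<lambda>d. v \<bullet> - Phi N (prol_bracket u (field_inverse x d)) x)) (at x)"
    by (rule has_derivative_inner_right[OF Phi_has_derivative[OF assms(2)]])
  then show ?thesis by simp
qed

lemma Phi_prol_bracket_linear:
  assumes "coded N u"
  shows "Phi N (prol_bracket u (\<Sum>j\<in>I. c j *\<^sub>R w j)) x = (\<Sum>j\<in>I. c j *\<^sub>R Phi N (prol_bracket u (w j)) x)"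
proof (cases "finite I")
  case True
  have "prol_bracket u (\<Sum>j\<in>I. c j *\<^sub>R w j) = (\<lambda>Ys. \<Sum>j\<in>I. c j *\<^sub>R prol_bracket u (w j) Ys)"
    unfolding prol_bracket_def
    by (rule ext) (simp only: linear_sum[OF coded_linear_Cons[OF assms]] linear_cmul[OF coded_linear_Cons[OF assms]])
  then show ?thesis unfolding Phi_def by (simp only: flows_linear[OF True])
next
  case False
  have "prol_bracket u 0 = (\<lambda>Ys. \<Sum>j\<in>{}. c j *\<^sub>R prol_bracket u (w j) Ys)"
    unfolding prol_bracket_def by (rule ext) (simp add: linear_0[OF coded_linear_Cons[OF assms]])
  then have "Phi N (prol_bracket u 0) x = (\<Sum>j\<in>{}. c j *\<^sub>R Phi N (prol_bracket u (w j)) x)"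
    unfolding Phi_def by (simp only: flows_linear[OF finite.emptyI])
  then show ?thesis using False by simp
qed

lemma continuous_Phi:
  assumes "nilpotent_exp_group gmul invr b N" "coded N u"
  shows "continuous_on UNIV (Phi N u)"
proof -
  interpret nilpotent_exp_group gmul invr b N by (rule assms)
  show ?thesis
    by (rule has_derivative_continuous_on, rule has_derivative_at_withinI, rule Phi_has_derivative[OF assms(2)])
qed

lemma continuous_field_inverse: "continuous_on UNIV (\<lambda>x. field_inverse x z)"
proof -
  have m: "continuous_on UNIV (\<lambda>x. f x \<cdot> g x)" if "continuous_on UNIV f" "continuous_on UNIV g"
    for f g :: "(real, 'n) vec \<Rightarrow> (real, 'n) vec"
    using continuous_on_compose2[OF smooth_map_continuous[OF smooth_mul] continuous_on_Pair[OF that] subset_UNIV]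
    by simp
  have "continuous_on UNIV (\<lambda>x. partial_prod x (Suc i))" for i
  proof (induction i)
    case (Suc i)
    have "continuous_on UNIV (\<lambda>x. (coord x (Suc i) *\<^sub>R b (Suc i)) \<cdot> partial_prod x (Suc i))"
      by (rule m[OF _ Suc.IH]) (intro continuous_intros linear_continuous_on linear_conv_bounded_linear[THEN iffD1] linear_coord)
    then show ?case by (simp add: partial_prod_Suc)
  qed simp
  then have p: "continuous_on UNIV (\<lambda>x. partial_prod x j)" if "j \<in> {1..CARD('n)}" for j
    using that by (cases j) auto
  show ?thesis
    unfolding field_inverse_def
    by (intro continuous_on_sum continuous_on_scaleR continuous_on_const
        continuous_on_compose2[OF continuous_Ad continuous_on_compose2[OF continuous_inv p]] subset_UNIV)
qed

lemma continuous_Phi_derivative: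
  assumes N: "nilpotent_exp_group gmul invr b N" and u: "coded N u"
  shows "continuous_on UNIV (\<lambda>x. - (v \<bullet> Phi N (prol_bracket u (field_inverse x z)) x))"
proof -
  have "continuous_on UNIV (\<lambda>x. Phi N (prol_bracket u (field_inverse x z)) x)"
  proof (rule continuous_linear_family[where T="\<lambda>x Z. Phi N (prol_bracket u Z) x"])
    show "linear (\<lambda>Z. Phi N (prol_bracket u Z) x)" for x
    proof (rule linearI)
      show "Phi N (prol_bracket u (y + y')) x = Phi N (prol_bracket u y) x + Phi N (prol_bracket u y') x" for y y'
        \<comment> \<open>Additivity is the sum formula over the two booleans, homogeneity the one
          over a single point.\<close>
        using Phi_prol_bracket_linear[OF u, where c="\<lambda>_. 1" and w="\<lambda>i. if i then y else y'" and I=UNIV and x=x] by (simp add: UNIV_bool add.commute)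
      show "Phi N (prol_bracket u (c *\<^sub>R y)) x = c *\<^sub>R Phi N (prol_bracket u y) x" for c y
        using Phi_prol_bracket_linear[OF u, where c="\<lambda>_. c" and w="\<lambda>_. y" and I="{()}" and x=x] by simp
    qed
    show "continuous_on UNIV (\<lambda>x. Phi N (prol_bracket u Z) x)" for Z
      by (rule continuous_Phi[OF N coded_prol_bracket'[OF u]])
  qed (rule continuous_field_inverse)
  then show ?thesis by (intro continuous_intros)
qed

text \<open>The left velocity of a horizontal curve lies in the first stratum, so only brackets with
  \<open>b 1\<close>, ..., \<open>b r\<close> occur, and each raises the degree by exactly
  one.\<close>

lemma Phi_along_curve:
  assumes N: "nilpotent_exp_group gmul invr b N" and u: "coded N u"
  shows "ac_path (\<lambda>t. v \<bullet> Phi N u (\<gamma> t))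
    (\<lambda>t. - (\<Sum>j=1..r. controls \<gamma> j t * (v \<bullet> Phi N (prol_bracket u (b j)) (\<gamma> t))))"
proof -
  have "ac_path (\<lambda>t. v \<bullet> Phi N u (\<gamma> t))
    (\<lambda>t. - (v \<bullet> Phi N (prol_bracket u (field_inverse (\<gamma> t) (field (drive (controls \<gamma>) t) (\<gamma> t)))) (\<gamma> t)))"
    by (rule ac_path_compose[OF curve_driven[unfolded driven_def] inner_Phi_has_derivative[OF N u]
          continuous_Phi_derivative[OF N u]])
  then show ?thesis
    unfolding field_inverse_field drive_def Phi_prol_bracket_linear[OF u] by (simp add: inner_sum_right)
qed

lemma Phi_0: "0 < N \<Longrightarrow> Phi N u 0 = u []"
proof -
  assume N: "0 < N"
  have "flows N 0 i u = u" for i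
    by (induction i) (simp_all add: flow_0[OF N] coord_def)
  then show ?thesis by (simp add: Phi_def)
qed

text \<open>Truncation orders decrease as the degree rises, so one \<open>N\<close> that is large
  enough for degree \<open>k\<close> serves all degrees up to 1 that the induction visits.\<close>

lemma annihilator_stratum:
  assumes v: "v \<in> annihilator" and N: "s \<le> N"
  shows "k \<le> 1 \<Longrightarrow> nat (int s + 1 - k) \<le> N \<Longrightarrow> u \<in> prol_stratum br V s k \<Longrightarrow> t \<in> {0..1} \<Longrightarrow>
    v \<bullet> Phi N u (\<gamma> t) = 0"
proof (induction "nat (1 - k)" arbitrary: k u t rule: less_induct)
  case less
  note NG = nilpotent_exp_groupI[OF N]
  interpret nilpotent_exp_group gmul invr b N by (rule NG)
  have u: "coded N u" by (rule coded_mono[OF coded_stratum[OF less.prems(3)] less.prems(2)])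
  show ?case
  proof (cases "k = 1")
    case True
    then obtain w where w: "w \<in> V 1" "u = prol_embed br w"
      using less.prems(3) by (auto simp: stratum_pos)
    have "span (b ` {1..r}) \<subseteq> {w. v \<bullet> Ad (\<gamma> t) w = 0}"
    proof (rule span_minimal)
      show "b ` {1..r} \<subseteq> {w. v \<bullet> Ad (\<gamma> t) w = 0}"
        using v less.prems(4) by (auto simp: annihilator_def)
      show "subspace {w. v \<bullet> Ad (\<gamma> t) w = 0}"
        by (auto simp: subspace_def Ad_simps inner_add_right)
    qed
    then have "v \<bullet> Ad (\<gamma> t) w = 0" using w(1) unfolding V1_span by blast
    then show ?thesis by (simp add: w(2) Phi_embed)
  next
    case False
    then have k: "k \<le> 0" using less.prems(1) by simp
    have z: "v \<bullet> Phi N (prol_bracket u (b j)) (\<gamma> \<tau>) = 0" if j: "j \<in> {1..r}" and \<tau>: "\<tau> \<in> {0..1}" for j \<tau>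
    proof (rule less.hyps)
      show "prol_bracket u (b j) \<in> prol_stratum br V s (k + int 1)"
        by (rule stratum_prol_bracket[OF less.prems(3) _ b_V1[OF j]]) (use s_pos in simp)
      show "nat (1 - (k + int 1)) < nat (1 - k)" "k + int 1 \<le> 1" using k by auto
      show "nat (int s + 1 - (k + int 1)) \<le> N" using less.prems(2) by simp
    qed (rule \<tau>)
    have "((\<lambda>\<tau>. - (\<Sum>j=1..r. controls \<gamma> j \<tau> * (v \<bullet> Phi N (prol_bracket u (b j)) (\<gamma> \<tau>)))) has_integral
        (v \<bullet> Phi N u (\<gamma> t) - v \<bullet> Phi N u (\<gamma> 0))) {0..t}"
      by (rule ac_pathD(2)[OF Phi_along_curve[OF NG u] less.prems(4)])
    moreover have "((\<lambda>\<tau>. - (\<Sum>j=1..r. controls \<gamma> j \<tau> * (v \<bullet> Phi N (prol_bracket u (b j)) (\<gamma> \<tau>)))) has_integral 0) {0..t}"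
      by (rule has_integral_is_0) (use z less.prems(4) in auto)
    ultimately have "v \<bullet> Phi N u (\<gamma> t) - v \<bullet> Phi N u (\<gamma> 0) = 0" by (rule has_integral_unique)
    moreover have "Phi N u (\<gamma> 0) = 0"
      unfolding start Phi_0[OF N_pos] by (rule stratum_nonpos(1)[OF k less.prems(3)])
    ultimately show ?thesis by simp
  qed
qed

lemma extremal_poly_b:
  assumes j: "j \<in> {1..CARD('n)}"
  shows "extremal_poly b J X v (int j) x = v \<bullet> Ad x (b j)"
proof -
  interpret nilpotent_exp_group gmul invr b s by (rule nilpotent_exp_groupI) simp
  have "coded s (X (int j))" unfolding X_b[OF j] by (rule coded_embed) (rule foldl_br_0)
  from extremal_poly_eq[OF int_J[OF j] order_refl this] show ?thesis
    by (simp only: X_b[OF j] Phi_embed)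
qed

lemma annihilator_iff: "v \<in> annihilator \<longleftrightarrow> (\<forall>t\<in>{0..1}. \<gamma> t \<in> extremal_variety b J X r v)"
proof
  assume v: "v \<in> annihilator"
  show "\<forall>t\<in>{0..1}. \<gamma> t \<in> extremal_variety b J X r v"
    unfolding extremal_variety_def
  proof (intro ballI CollectI impI)
    fix t :: real and j assume t: "t \<in> {0..1}" and j: "j \<in> J" "j \<le> int r"
    show "extremal_poly b J X v j (\<gamma> t) = 0"
    proof (cases "j \<le> 0")
      case True
      \<comment> \<open>The order has to reach the step, for the brackets of the Lie algebra, and to
        cover the degree of \<open>X j\<close>.\<close>
      define N where "N = max s (nat (int s + 1 - deg j))"
      have N: "s \<le> N" "nat (int s + 1 - deg j) \<le> N" by (simp_all add: N_def)
      have X: "X j \<in> prol_stratum br V s (deg j)" by (rule deg(2)[OF j(1)])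
      have "deg j \<le> 1" using deg_nonpos[OF j(1) True] by simp
      from annihilator_stratum[OF v N(1) this N(2) X t] show ?thesis
        using extremal_poly_eq[OF j(1) N(1) coded_mono[OF coded_stratum[OF X] N(2)]] by simp
    next
      case False
      then obtain i where i: "j = int i" "i \<in> {1..r}"
        using j(2) zero_le_imp_eq_int[of j] by auto
      show ?thesis using v t i(2) unfolding i(1) extremal_poly_b[OF r_sub[OF i(2)]] annihilator_def by simp
    qed
  qed
next
  assume z: "\<forall>t\<in>{0..1}. \<gamma> t \<in> extremal_variety b J X r v"
  show "v \<in> annihilator"
    unfolding annihilator_def
  proof (intro CollectI ballI)
    fix t :: real and j assume t: "t \<in> {0..1}" and j: "j \<in> {1..r}"
    have "extremal_poly b J X v (int j) (\<gamma> t) = 0"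
      using z t int_J[OF r_sub[OF j]] j unfolding extremal_variety_def by simp
    then show "v \<bullet> Ad (\<gamma> t) (b j) = 0" by (simp only: extremal_poly_b[OF r_sub[OF j]])
  qed
qed

section \<open>Dual curves and the conclusion\<close>

lemma struct_const_eq:
  assumes k: "k \<in> {1..CARD('n)}"
  shows "struct_const gmul b i j k = coord (br (b i) (b j)) k"
proof -
  let ?R = "representation (b ` {1..CARD('n)}) (br (b i) (b j))"
  have "br (b i) (b j) \<in> span (b ` {1..CARD('n)})"
  proof -
    have "(\<Sum>l=1..CARD('n). coord (br (b i) (b j)) l *\<^sub>R b l) \<in> span (b ` {1..CARD('n)})"
      by (intro span_sum span_scale span_base imageI)
    then show ?thesis by (simp only: coord_sum_b)
  qed
  from sum_representation_eq[OF b_independent this finite_imageI[OF finite_atLeastAtMost] subset_refl]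
  have "(\<Sum>l=1..CARD('n). ?R (b l) *\<^sub>R b l) = br (b i) (b j)"
    by (simp only: sum.reindex[OF b_inj] o_def)
  then have "coord (br (b i) (b j)) k = coord (\<Sum>l=1..CARD('n). ?R (b l) *\<^sub>R b l) k" by (simp only:)
  also have "\<dots> = (\<Sum>l=1..CARD('n). ?R (b l) * coord (b l) k)"
    by (simp add: linear_sum[OF linear_coord] linear_cmul[OF linear_coord])
  also have "\<dots> = (\<Sum>l=1..CARD('n). if k = l then ?R (b l) else 0)"
    by (intro sum.cong refl) (simp add: coord_b[OF k])
  also have "\<dots> = ?R (b k)" using k by (simp add: sum.delta)
  finally show ?thesis by (simp add: struct_const_def)
qed

lemma annihilator_abnormal:
  assumes v: "v \<in> annihilator" "v \<noteq> 0"
  shows "abnormal_extremal gmul b r \<gamma>"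
proof -
  define \<xi> where "\<xi> i t = v \<bullet> Ad (\<gamma> t) (b i)" for i t
  have NG: "nilpotent_exp_group gmul invr b s" by (rule nilpotent_exp_groupI) simp
  interpret nilpotent_exp_group gmul invr b s by (rule NG)
  have coded: "coded s (prol_embed br w)" for w by (rule coded_embed) (rule foldl_br_0)
  have \<xi>_Phi: "\<xi> i = (\<lambda>t. v \<bullet> Phi s (prol_embed br (b i)) (\<gamma> t))" for i
    by (rule ext) (simp only: \<xi>_def Phi_embed)
  obtain C where lip: "C-lipschitz_on {0..1} \<gamma>"
    using horizontal unfolding horizontal_curve_def by blast
  have lipschitz: "\<exists>C. C-lipschitz_on {0..1} (\<xi> i)" for i
  proof -
    have "bounded (\<gamma> ` {0..1})"
      by (intro compact_imp_bounded compact_continuous_image curve_continuous compact_Icc)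
    then obtain R where R: "\<forall>x\<in>\<gamma> ` {0..1}. norm x \<le> R" unfolding bounded_iff by (rule exE)
    obtain L where "L-lipschitz_on (cball 0 R) (\<lambda>x. v \<bullet> Phi s (prol_embed br (b i)) x)"
      by (rule C1_lipschitz[OF inner_Phi_has_derivative[OF NG coded] continuous_Phi_derivative[OF NG coded]
            compact_cball[of 0 R] convex_cball]) (rule that; assumption)
    then have "L-lipschitz_on (\<gamma> ` {0..1}) (\<lambda>x. v \<bullet> Phi s (prol_embed br (b i)) x)"
      by (rule lipschitz_on_subset) (use R in auto)
    from lipschitz_on_compose2[OF lip this] show ?thesis unfolding \<xi>_Phi by (rule exI)
  qed
  have nonzero: "\<exists>i\<in>{1..CARD('n)}. \<xi> i t \<noteq> 0" for t
  proof (rule ccontr)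
    assume "\<not> (\<exists>i\<in>{1..CARD('n)}. \<xi> i t \<noteq> 0)"
    then have z: "v \<bullet> Ad (\<gamma> t) (b i) = 0" if "i \<in> {1..CARD('n)}" for i using that unfolding \<xi>_def by blast
    have "v \<bullet> Ad (\<gamma> t) w = 0" for w
    proof -
      have "v \<bullet> Ad (\<gamma> t) (\<Sum>i=1..CARD('n). coord w i *\<^sub>R b i) = 0"
        unfolding Ad_simps inner_sum_right inner_scaleR_right by (rule sum.neutral) (use z in simp)
      then show ?thesis by (simp only: coord_sum_b)
    qed
    \<comment> \<open>The map \<open>Ad (\<gamma> t)\<close> is onto; this vector is the preimage of
      \<open>v\<close>, so \<open>v\<close> would be orthogonal to itself.\<close>
    from this[of "Ad (invr (\<gamma> t)) v"] show False using v(2) by simp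
  qed
  have zero: "\<xi> i t = 0" if "i \<in> {1..r}" "t \<in> {0..1}" for i t
    using v(1) that by (simp add: \<xi>_def annihilator_def)
  have deriv: "(\<xi> i has_real_derivative
        - (\<Sum>k=1..CARD('n). \<Sum>j=1..r. struct_const gmul b i j k * controls \<gamma> j t * \<xi> k t)) (at t)"
    if \<gamma>: "(\<gamma> has_vector_derivative field (drive (controls \<gamma>) t) (\<gamma> t)) (at t)" for i t
  proof -
    let ?c = "drive (controls \<gamma>) t"
    have D: "(\<xi> i has_derivative (\<lambda>h. - (v \<bullet> Phi s (prol_bracket (prol_embed br (b i))
        (field_inverse (\<gamma> t) (h *\<^sub>R field ?c (\<gamma> t)))) (\<gamma> t)))) (at t)"
      unfolding \<xi>_Phi
      by (rule has_derivative_compose[OF \<gamma>[unfolded has_vector_derivative_def] inner_Phi_has_derivative[OF NG coded]])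
    have br: "br (b i) (b j) = (\<Sum>k=1..CARD('n). struct_const gmul b i j k *\<^sub>R b k)" for j
    proof -
      have "(\<Sum>k=1..CARD('n). struct_const gmul b i j k *\<^sub>R b k) = (\<Sum>k=1..CARD('n). coord (br (b i) (b j)) k *\<^sub>R b k)"
        by (intro sum.cong refl) (simp only: struct_const_eq)
      then show ?thesis by (simp only: coord_sum_b)
    qed
    have E: "v \<bullet> Phi s (prol_bracket (prol_embed br (b i)) (field_inverse (\<gamma> t) (h *\<^sub>R field ?c (\<gamma> t)))) (\<gamma> t)
        = (\<Sum>k=1..CARD('n). \<Sum>j=1..r. struct_const gmul b i j k * controls \<gamma> j t * \<xi> k t) * h" for h
    proof -
      have "v \<bullet> Phi s (prol_bracket (prol_embed br (b i)) (field_inverse (\<gamma> t) (h *\<^sub>R field ?c (\<gamma> t)))) (\<gamma> t)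
          = v \<bullet> Ad (\<gamma> t) (br (b i) (h *\<^sub>R ?c))"
        by (simp only: field_linear[symmetric] field_inverse_field prol_bracket_embed Phi_embed)
      also have "\<dots> = h * (\<Sum>j=1..r. controls \<gamma> j t * (v \<bullet> Ad (\<gamma> t) (br (b i) (b j))))"
        unfolding drive_def by (simp only: br_simps Ad_simps inner_sum_right inner_scaleR_right)
      also have "\<dots> = h * (\<Sum>j=1..r. \<Sum>k=1..CARD('n). struct_const gmul b i j k * controls \<gamma> j t * \<xi> k t)"
        unfolding br Ad_simps inner_sum_right inner_scaleR_right \<xi>_def[symmetric] sum_distrib_left
        by (simp only: mult_ac)
      also have "\<dots> = (\<Sum>k=1..CARD('n). \<Sum>j=1..r. struct_const gmul b i j k * controls \<gamma> j t * \<xi> k t) * h"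
        by (subst sum.swap) (rule mult.commute)
      finally show ?thesis .
    qed
    show ?thesis
      unfolding has_field_derivative_def
      by (rule has_derivative_eq_rhs[OF D]) (rule ext, simp only: E mult_minus_left)
  qed
  have "AE t in lebesgue_on {0..1}. (\<xi> i has_real_derivative
        - (\<Sum>k=1..CARD('n). \<Sum>j=1..r. struct_const gmul b i j k * controls \<gamma> j t * \<xi> k t)) (at t)" for i
    using curve_derivative by eventually_elim (rule deriv)
  then show ?thesis
    unfolding abnormal_extremal_def
    using horizontal lipschitz nonzero zero by (intro conjI exI[of _ \<xi>] ballI) auto
qed

lemma dim_annihilator_ge_iff:
  "m \<le> dim annihilator \<longleftrightarrow>
    (\<exists>v. inj_on v {1..m} \<and> independent (v ` {1..m}) \<and> v ` {1..m} \<subseteq> annihilator)"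
proof
  assume m: "m \<le> dim annihilator"
  obtain B where B: "B \<subseteq> annihilator" "independent B" "card B = dim annihilator"
    using basis_exists[of annihilator] by metis
  obtain B' where B': "B' \<subseteq> B" "card B' = m" "finite B'"
    using obtain_subset_with_card_n[of m B] m B(3) by metis
  obtain v where "bij_betw v {1..m} B'"
    using ex_bij_betw_nat_finite_1[OF B'(3)] B'(2) by metis
  then have "inj_on v {1..m}" "v ` {1..m} = B'" by (auto simp: bij_betw_def)
  then show "\<exists>v. inj_on v {1..m} \<and> independent (v ` {1..m}) \<and> v ` {1..m} \<subseteq> annihilator"
    using B B' independent_mono[OF B(2) B'(1)] by (intro exI[of _ v]) auto
next
  assume "\<exists>v. inj_on v {1..m} \<and> independent (v ` {1..m}) \<and> v ` {1..m} \<subseteq> annihilator"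
  then obtain v where v: "inj_on v {1..m}" "independent (v ` {1..m})" "v ` {1..m} \<subseteq> annihilator" by blast
  have "card (v ` {1..m}) \<le> dim annihilator" by (rule independent_card_le_dim[OF v(3,2)])
  then show "m \<le> dim annihilator" using card_image[OF v(1)] by simp
qed

end

theorem theorem3p8:
  fixes gmul :: "real ^ 'n::{finite,linorder} \<Rightarrow> (real, 'n) vec \<Rightarrow> (real, 'n) vec"
    and invr :: "(real, 'n) vec \<Rightarrow> (real, 'n) vec"
    and V :: "nat \<Rightarrow> (real, 'n) vec set"
    and s r m :: nat
    and b :: "nat \<Rightarrow> (real, 'n) vec"
    and J :: "int set"
    and X :: "int \<Rightarrow> (real, 'n) vec prol"
    and \<gamma> :: "real \<Rightarrow> (real, 'n) vec"
  assumes "lie_group gmul invr"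
    and "stratification (lie_bracket gmul) V s"
    and "r = dim (V 1)"
    and "adapted_prol_basis (lie_bracket gmul) V s CARD('n) b J X"
    and "exp_coords_second_type gmul b"
    and "horizontal_curve gmul b r \<gamma>"
    and "\<gamma> 0 = 0"
    and "m \<ge> 1"
  shows "(abnormal_extremal gmul b r \<gamma> \<and> corank gmul b r \<gamma> \<ge> m) \<longleftrightarrow>
         (\<exists>v :: nat \<Rightarrow> (real, 'n) vec.
            inj_on v {1..m} \<and> independent (v ` {1..m}) \<and>
            (\<forall>t\<in>{0..1}. \<gamma> t \<in> (\<Inter>i\<in>{1..m}. extremal_variety b J X r (v i))))"
proof -
  interpret lie_group_rn gmul invr by unfold_locales (rule assms(1))
  interpret horizontal_start gmul invr b V s r J X \<gamma>
    by unfold_locales (rule assms)+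
  have *: "(\<forall>t\<in>{0..1}. \<gamma> t \<in> (\<Inter>i\<in>{1..m}. extremal_variety b J X r (v i))) \<longleftrightarrow> v ` {1..m} \<subseteq> annihilator"
    for v :: "nat \<Rightarrow> (real, 'n) vec"
    unfolding image_subset_iff annihilator_iff by blast
  \<comment> \<open>As m \<ge> 1, the bound on the corank already supplies a nonzero vector in the
    annihilator and with it a dual curve.\<close>
  have "abnormal_extremal gmul b r \<gamma>" if m: "m \<le> dim annihilator"
  proof -
    have "dim annihilator \<noteq> 0" using m assms(8) by linarith
    then have "\<not> annihilator \<subseteq> {0}" unfolding dim_eq_0 .
    then obtain v where "v \<in> annihilator" "v \<noteq> 0" by blast
    then show ?thesis by (rule annihilator_abnormal)
  qed
  then show ?thesis
    unfolding corank_eq * dim_annihilator_ge_iff[symmetric] by blast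
qed

end
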